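(* Let $\mathbb K$ be a field of characteristic zero, and let $R$ be a nonzero continuous regular unital $\mathbb K$-algebra with no nonzero abelian idempotents. Then there is a unital injective $\mathbb K$-algebra homomorphism $Q(A_1(\mathbb K))\to R$, where $Q(A_1(\mathbb K))$ is the quotient division ring of the first Weyl algebra over $\mathbb K$.
   Context: All rings are associative and unital. A ring $R$ is von Neumann regular if for every $a\in R$ there is $b\in R$ with $aba=a$. The principal right ideals of a regular ring $R$, ordered by inclusion, form a complemented modular lattice $\mathcal L(R)$. A regular ring is continuous if $\mathcal L(R)$ is a complete lattice and satisfies $x\wedge\bigvee_i y_i=\bigvee_i(x\wedge y_i)$ for upward directed families $(y_i)$ and $x\vee\bigwedge_i y_i=\bigwedge_i(x\vee y_i)$ for downward directed families $(y_i)$. An idempotent $e\in R$ is abelian if every idempotent of $eRe$ is central in $eRe$. The first Weyl algebra is $A_1(\mathbb K)=\mathbb K\langle x,y\rangle/(yx-xy-1)$, the unital associative $\mathbb K$-algebra generated by $x,y$ subject to $yx-xy=1$. It is a left and right Noetherian domain, hence a left and right Ore domain; $Q(A_1(\mathbb K))$ denotes its quotient division ring, obtained by inverting all nonzero elements (Ore localization). *)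

theory Defs
  imports "HOL-Library.Poly_Mapping" "HOL-Computational_Algebra.Polynomial"
    "HOL-Algebra.Complete_Lattice"
begin

section \<open>Unital associative algebras\<close>

locale unital_algebra = vector_space scale
  for scale :: "'k::field \<Rightarrow> 'r::ring_1 \<Rightarrow> 'r" +
  assumes scale_mult_left: "scale c (a * b) = scale c a * b"
    and scale_mult_right: "scale c (a * b) = a * scale c b"

locale unital_algebra_hom =
  A: unital_algebra scaleA + B: unital_algebra scaleB + Vector_Spaces.linear scaleA scaleB f
  for scaleA :: "'k::field \<Rightarrow> 'a::ring_1 \<Rightarrow> 'a"
    and scaleB :: "'k \<Rightarrow> 'b::ring_1 \<Rightarrow> 'b"
    and f :: "'a \<Rightarrow> 'b" +
  assumes map_mult: "f (a * b) = f a * f b"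
    and map_one: "f 1 = 1"


section \<open>Continuous regular rings\<close>

definition von_neumann_regular :: "'r::ring_1 itself \<Rightarrow> bool"
  where "von_neumann_regular _ \<longleftrightarrow> (\<forall>a :: 'r. \<exists>b. a * b * a = a)"

definition principal_right_ideal :: "'r::ring_1 \<Rightarrow> 'r set"
  where "principal_right_ideal a = {a * r | r. True}"

definition principal_right_ideals :: "'r::ring_1 itself \<Rightarrow> 'r set gorder"
  where "principal_right_ideals _ =
    \<lparr>carrier = {principal_right_ideal a | a. True}, eq = (=), le = (\<subseteq>)\<rparr>"

definition upward_directed :: "('a, 'b) gorder_scheme \<Rightarrow> 'a set \<Rightarrow> bool"
  where "upward_directed L D \<longleftrightarrow> D \<subseteq> carrier L \<and> D \<noteq> {} \<and>
    (\<forall>y\<in>D. \<forall>z\<in>D. \<exists>w\<in>D. y \<sqsubseteq>\<^bsub>L\<^esub> w \<and> z \<sqsubseteq>\<^bsub>L\<^esub> w)"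

definition downward_directed :: "('a, 'b) gorder_scheme \<Rightarrow> 'a set \<Rightarrow> bool"
  where "downward_directed L D \<longleftrightarrow> D \<subseteq> carrier L \<and> D \<noteq> {} \<and>
    (\<forall>y\<in>D. \<forall>z\<in>D. \<exists>w\<in>D. w \<sqsubseteq>\<^bsub>L\<^esub> y \<and> w \<sqsubseteq>\<^bsub>L\<^esub> z)"

text \<open>Directed families are represented by their sets of members, which is enough because
  only their joins and meets occur. Joins and meets are those of the lattice of principal right
  ideals; in particular an infinite meet need not be the intersection a priori.\<close>

definition continuous_regular_ring :: "'r::ring_1 itself \<Rightarrow> bool"
  where "continuous_regular_ring R \<longleftrightarrow> von_neumann_regular R \<and>
    (let L = principal_right_ideals R in
      complete_lattice L \<and>
      (\<forall>x\<in>carrier L. \<forall>D. upward_directed L D \<longrightarrow>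
        x \<sqinter>\<^bsub>L\<^esub> \<Squnion>\<^bsub>L\<^esub> D = \<Squnion>\<^bsub>L\<^esub> ((\<lambda>y. x \<sqinter>\<^bsub>L\<^esub> y) ` D)) \<and>
      (\<forall>x\<in>carrier L. \<forall>D. downward_directed L D \<longrightarrow>
        x \<squnion>\<^bsub>L\<^esub> \<Sqinter>\<^bsub>L\<^esub> D = \<Sqinter>\<^bsub>L\<^esub> ((\<lambda>y. x \<squnion>\<^bsub>L\<^esub> y) ` D)))"

definition corner :: "'r::ring_1 \<Rightarrow> 'r set"
  where "corner e = {e * r * e | r. True}"

definition abelian_idempotent :: "'r::ring_1 \<Rightarrow> bool"
  where "abelian_idempotent e \<longleftrightarrow> e * e = e \<and>
    (\<forall>f\<in>corner e. f * f = f \<longrightarrow> (\<forall>x\<in>corner e. f * x = x * f))"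


section \<open>Ore localization at the nonzero elements\<close>

class right_ore_domain = ring_1_no_zero_divisors +
  assumes right_ore: "a \<noteq> 0 \<Longrightarrow> b \<noteq> 0 \<Longrightarrow> \<exists>u v. a * u = b * v \<and> a * u \<noteq> 0"
begin

lemma common_denom:
  assumes "s \<noteq> 0" "t \<noteq> 0"
  obtains u v where "s * u = t * v" "s * u \<noteq> 0" "u \<noteq> 0" "v \<noteq> 0"
  using right_ore[OF assms] by (metis mult_zero_right)

lemma swap_denom:
  assumes "s \<noteq> 0"
  obtains s' b' where "b * s' = s * b'" "s' \<noteq> 0"
proof (cases "b = 0")
  case True
  then show ?thesis using that[of 1 0] by simp
next
  case False
  then show ?thesis using common_denom[OF False assms] that by metis
qed

end

text \<open>The pair \<open>(a, s)\<close> stands for the right fraction \<open>a s\<^sup>-\<^sup>1\<close>.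
  For a domain that is also left Ore, such as the Weyl algebra, the left fractions give
  the same division ring.\<close>

definition ore_rel :: "'a::right_ore_domain \<times> 'a \<Rightarrow> 'a \<times> 'a \<Rightarrow> bool"
  where "ore_rel = (\<lambda>(a, s) (b, t).
    s \<noteq> 0 \<and> t \<noteq> 0 \<and> (\<exists>u v. s * u = t * v \<and> s * u \<noteq> 0 \<and> a * u = b * v))"

lemma ore_rel_simp: "ore_rel (a, s) (b, t) \<longleftrightarrow>
    s \<noteq> 0 \<and> t \<noteq> 0 \<and> (\<exists>u v. s * u = t * v \<and> s * u \<noteq> 0 \<and> a * u = b * v)"
  by (simp add: ore_rel_def)

lemma ore_rel_refl_iff [simp]: "ore_rel (a, s) (a, s) \<longleftrightarrow> s \<noteq> 0"
  by (auto simp: ore_rel_simp intro: exI[of _ 1])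

lemma ore_rel_sym: "ore_rel p q \<Longrightarrow> ore_rel q p"
  proof -
  obtain a s b t where pq: "p = (a, s)" "q = (b, t)" by (metis prod.exhaust)
  assume "ore_rel p q"
  then show ?thesis unfolding pq ore_rel_simp by metis
qed

lemma ore_rel_trans: "ore_rel p q \<Longrightarrow> ore_rel q r \<Longrightarrow> ore_rel p r"
proof -
  obtain a s b t c w where pq: "p = (a, s)" "q = (b, t)" "r = (c, w)"
    by (metis prod.exhaust)
  assume "ore_rel p q" "ore_rel q r"
  then obtain u v m n where *: "s * u = t * v" "s * u \<noteq> 0" "a * u = b * v"
      "t * m = w * n" "t * m \<noteq> 0" "b * m = c * n" "s \<noteq> 0" "w \<noteq> 0"
    unfolding pq ore_rel_simp by blast
  then have "v \<noteq> 0" "m \<noteq> 0" by auto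
  then obtain x y where xy: "v * x = m * y" "v * x \<noteq> 0" "x \<noteq> 0"
    by (rule common_denom)
  have "s * u * x = t * (v * x)" using *(1) by (simp add: mult.assoc)
  also have "\<dots> = w * n * y" by (simp only: *(4) xy(1) mult.assoc[symmetric])
  finally have "s * (u * x) = w * (n * y)" by (simp only: mult.assoc)
  moreover have "a * (u * x) = c * (n * y)"
  proof -
    have "a * u * x = b * (v * x)" using *(3) by (simp add: mult.assoc)
    also have "\<dots> = c * n * y" by (simp only: *(6) xy(1) mult.assoc[symmetric])
    finally show ?thesis by (simp only: mult.assoc)
  qed
  moreover have "s * (u * x) \<noteq> 0"
    using no_zero_divisors[OF *(2) xy(3)] by (simp only: mult.assoc not_False_eq_True)
  ultimately show ?thesis
    using * unfolding pq ore_rel_simp by blast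
qed

lemma ore_rel_expand: "s \<noteq> 0 \<Longrightarrow> c \<noteq> 0 \<Longrightarrow> ore_rel (a, s) (a * c, s * c)"
  unfolding ore_rel_simp by (metis mult.right_neutral mult_eq_0_iff)

lemma ore_rel_expandD:
  assumes "ore_rel p q"
  obtains u v where "u \<noteq> 0" "v \<noteq> 0" "fst p * u = fst q * v" "snd p * u = snd q * v"
    "snd p \<noteq> 0" "snd q \<noteq> 0"
proof -
  obtain a s b t where pq: "p = (a, s)" "q = (b, t)" by (metis prod.exhaust)
  obtain u v where "s * u = t * v" "s * u \<noteq> 0" "a * u = b * v" "s \<noteq> 0" "t \<noteq> 0"
    using assms unfolding pq ore_rel_simp by blast
  moreover from this have "u \<noteq> 0" "v \<noteq> 0" by auto
  ultimately show ?thesis using that[of u v] pq by simp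
qed

quotient_type (overloaded) 'a ore_quotient = "'a::right_ore_domain \<times> 'a" / partial: ore_rel
proof (rule part_equivpI)
  show "\<exists>x. ore_rel x x" by (rule exI[of _ "(0, 1)"]) simp
qed (auto intro!: sympI transpI intro: ore_rel_sym ore_rel_trans)

lemma ore_abs_eq: "ore_rel p q \<Longrightarrow> abs_ore_quotient p = abs_ore_quotient q"
  by (rule Quotient_rel_abs[OF Quotient_ore_quotient])

definition ore_add :: "'a::right_ore_domain \<times> 'a \<Rightarrow> 'a \<times> 'a \<Rightarrow> 'a \<times> 'a"
  where "ore_add = (\<lambda>(a, s) (b, t).
    let (u, v) = SOME (u, v). s * u = t * v \<and> s * u \<noteq> 0
    in (a * u + b * v, s * u))"

text \<open>From \<open>b t' = s b'\<close> one gets \<open>s\<^sup>-\<^sup>1 b = b' t'\<^sup>-\<^sup>1\<close>, hence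
  \<open>(a s\<^sup>-\<^sup>1)(b t\<^sup>-\<^sup>1) = (a b')(t t')\<^sup>-\<^sup>1\<close>.\<close>

definition ore_mult :: "'a::right_ore_domain \<times> 'a \<Rightarrow> 'a \<times> 'a \<Rightarrow> 'a \<times> 'a"
  where "ore_mult = (\<lambda>(a, s) (b, t).
    let (t', b') = SOME (t', b'). b * t' = s * b' \<and> t' \<noteq> 0
    in (a * b', t * t'))"

lemma ore_add_rel:
  assumes "s \<noteq> 0" "t \<noteq> 0" "s * u = t * v" "s * u \<noteq> 0"
  shows "ore_rel (ore_add (a, s) (b, t)) (a * u + b * v, s * u)"
proof -
  define P where "P = (\<lambda>(u, v). s * u = t * v \<and> s * u \<noteq> 0)"
  obtain u' v' where uv': "(u', v') = Eps P" by (metis prod.exhaust)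
  have "P (u, v)" unfolding P_def prod.case using assms by blast
  then have "P (Eps P)" by (rule someI)
  then have "P (u', v')" by (simp only: uv')
  then have 1: "s * u' = t * v'" "s * u' \<noteq> 0" unfolding P_def prod.case by blast+
  have 2: "ore_add (a, s) (b, t) = (a * u' + b * v', s * u')"
    unfolding ore_add_def Let_def prod.case P_def[symmetric] uv'[symmetric] ..
  have "u' \<noteq> 0" "u \<noteq> 0" using 1(2) assms(4) mult_zero_right by blast+
  then obtain x y where xy: "u' * x = u * y" "u' * x \<noteq> 0"
    using right_ore by metis
  have "t * (v' * x) = s * (u' * x)" by (simp only: 1(1) mult.assoc[symmetric])
  also have "\<dots> = t * (v * y)" unfolding xy(1) by (simp only: assms(3) mult.assoc[symmetric])
  finally have "t * (v' * x) = t * (v * y)" .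
  then have "v' * x = v * y" using assms by simp
  then have "(a * u' + b * v') * x = (a * u + b * v) * y"
    by (simp only: distrib_right mult.assoc xy(1))
  moreover have "s * u' * x = s * u * y"
    by (simp only: mult.assoc xy(1))
  moreover have "s * u' * x \<noteq> 0"
    using no_zero_divisors[OF \<open>s \<noteq> 0\<close> xy(2)] by (simp only: mult.assoc not_False_eq_True)
  ultimately show ?thesis
    using 1 assms unfolding 2 ore_rel_simp by blast
qed

lemma ore_mult_rel:
  assumes "s \<noteq> 0" "t \<noteq> 0" "b * t' = s * b'" "t' \<noteq> 0"
  shows "ore_rel (ore_mult (a, s) (b, t)) (a * b', t * t')"
proof -
  define P where "P = (\<lambda>(t', b'). b * t' = s * b' \<and> t' \<noteq> 0)"
  obtain u' v' where uv': "(u', v') = Eps P" by (metis prod.exhaust)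
  have "P (t', b')" unfolding P_def prod.case using assms by blast
  then have "P (Eps P)" by (rule someI)
  then have "P (u', v')" by (simp only: uv')
  then have 1: "b * u' = s * v'" "u' \<noteq> 0" unfolding P_def prod.case by blast+
  have 2: "ore_mult (a, s) (b, t) = (a * v', t * u')"
    unfolding ore_mult_def Let_def prod.case P_def[symmetric] uv'[symmetric] ..
  obtain x y where xy: "u' * x = t' * y" "u' * x \<noteq> 0"
    by (rule common_denom[OF 1(2) assms(4)])
  have "s * (v' * x) = b * (u' * x)" by (simp only: 1(1) mult.assoc[symmetric])
  also have "\<dots> = s * (b' * y)" unfolding xy(1) by (simp only: assms(3) mult.assoc[symmetric])
  finally have "s * (v' * x) = s * (b' * y)" .
  then have "v' * x = b' * y" using assms by simp
  then have "(a * v') * x = (a * b') * y"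
    by (simp only: mult.assoc)
  moreover have "t * u' * x = t * t' * y"
    by (simp only: mult.assoc xy(1))
  moreover have "t * u' * x \<noteq> 0"
    using no_zero_divisors[OF \<open>t \<noteq> 0\<close> xy(2)] by (simp only: mult.assoc not_False_eq_True)
  moreover have "t * u' \<noteq> 0" "t * t' \<noteq> 0" using 1(2) assms by auto
  ultimately show ?thesis
    unfolding 2 ore_rel_simp by blast
qed

lemma ore_respectI:
  fixes f :: "'a::right_ore_domain \<times> 'a \<Rightarrow> 'a \<times> 'a \<Rightarrow> 'a \<times> 'a"
  assumes l: "\<And>a s b t c. s \<noteq> 0 \<Longrightarrow> t \<noteq> 0 \<Longrightarrow> c \<noteq> 0 \<Longrightarrow>
      ore_rel (f (a, s) (b, t)) (f (a * c, s * c) (b, t))"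
    and r: "\<And>a s b t c. s \<noteq> 0 \<Longrightarrow> t \<noteq> 0 \<Longrightarrow> c \<noteq> 0 \<Longrightarrow>
      ore_rel (f (a, s) (b, t)) (f (a, s) (b * c, t * c))"
    and "ore_rel p p'" "ore_rel q q'"
  shows "ore_rel (f p q) (f p' q')"
proof -
  from \<open>ore_rel p p'\<close> obtain u u' where u: "u \<noteq> 0" "u' \<noteq> 0" "fst p * u = fst p' * u'"
    "snd p * u = snd p' * u'" "snd p \<noteq> 0" "snd p' \<noteq> 0" by (rule ore_rel_expandD)
  from \<open>ore_rel q q'\<close> obtain v v' where v: "v \<noteq> 0" "v' \<noteq> 0" "fst q * v = fst q' * v'"
    "snd q * v = snd q' * v'" "snd q \<noteq> 0" "snd q' \<noteq> 0" by (rule ore_rel_expandD)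
  have *: "ore_rel (f p q) (f (fst p * u, snd p * u) q)"
    if "snd p \<noteq> 0" "snd q \<noteq> 0" "u \<noteq> 0" for p q u
    using l[of "snd p" "snd q" u "fst p" "fst q"] that by simp
  have **: "ore_rel (f p q) (f p (fst q * u, snd q * u))"
    if "snd p \<noteq> 0" "snd q \<noteq> 0" "u \<noteq> 0" for p q u
    using r[of "snd p" "snd q" u "fst p" "fst q"] that by simp
  have "ore_rel (f p q) (f p' q)"
  proof (rule ore_rel_trans)
    show "ore_rel (f p q) (f (fst p * u, snd p * u) q)" using u v by (intro *)
    show "ore_rel (f (fst p * u, snd p * u) q) (f p' q)"
      unfolding u(3,4) using u v by (intro ore_rel_sym[OF *])
  qed
  moreover have "ore_rel (f p' q) (f p' q')"
  proof (rule ore_rel_trans)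
    show "ore_rel (f p' q) (f p' (fst q * v, snd q * v))" using u v by (intro **)
    show "ore_rel (f p' (fst q * v, snd q * v)) (f p' q')"
      unfolding v(3,4) using u v by (intro ore_rel_sym[OF **])
  qed
  ultimately show ?thesis by (rule ore_rel_trans)
qed

instantiation ore_quotient :: (right_ore_domain) division_ring
begin

lift_definition zero_ore_quotient :: "'a ore_quotient" is "(0, 1)" by simp

lift_definition one_ore_quotient :: "'a ore_quotient" is "(1, 1)" by simp

lift_definition uminus_ore_quotient :: "'a ore_quotient \<Rightarrow> 'a ore_quotient"
  is "\<lambda>(a, s). (- a, s)"
  by (force simp: ore_rel_simp)

lift_definition plus_ore_quotient :: "'a ore_quotient \<Rightarrow> 'a ore_quotient \<Rightarrow> 'a ore_quotient"
  is ore_add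
proof (rule ore_respectI[where f = ore_add], goal_cases)
  case (1 _ _ _ _ a s b t c)
  then have sc: "s * c \<noteq> 0" by simp
  obtain u v where uv: "(s * c) * u = t * v" "(s * c) * u \<noteq> 0"
    using right_ore[OF sc \<open>t \<noteq> 0\<close>] by blast
  have "ore_rel (ore_add (a * c, s * c) (b, t)) (a * c * u + b * v, s * c * u)"
    using sc 1 uv by (intro ore_add_rel)
  moreover have "ore_rel (ore_add (a, s) (b, t)) (a * (c * u) + b * v, s * (c * u))"
    using 1 uv by (intro ore_add_rel) (simp_all only: mult.assoc not_False_eq_True)
  ultimately show ?case
    by (simp only: mult.assoc) (rule ore_rel_trans[OF _ ore_rel_sym])
next
  case (2 _ _ _ _ a s b t c)
  then have tc: "t * c \<noteq> 0" by simp
  obtain u v where uv: "s * u = (t * c) * v" "s * u \<noteq> 0"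
    using right_ore[OF \<open>s \<noteq> 0\<close> tc] by blast
  have "ore_rel (ore_add (a, s) (b * c, t * c)) (a * u + b * c * v, s * u)"
    using tc 2 uv by (intro ore_add_rel)
  moreover have "ore_rel (ore_add (a, s) (b, t)) (a * u + b * (c * v), s * u)"
    using 2 uv by (intro ore_add_rel) (simp_all only: mult.assoc not_False_eq_True)
  ultimately show ?case
    by (simp only: mult.assoc) (rule ore_rel_trans[OF _ ore_rel_sym])
qed

lift_definition times_ore_quotient :: "'a ore_quotient \<Rightarrow> 'a ore_quotient \<Rightarrow> 'a ore_quotient"
  is ore_mult
proof (rule ore_respectI[where f = ore_mult], goal_cases)
  case (1 _ _ _ _ a s b t c)
  then have sc: "s * c \<noteq> 0" by simp
  obtain t' b' where tb: "b * t' = (s * c) * b'" "t' \<noteq> 0"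
    using swap_denom[OF sc] .
  have "ore_rel (ore_mult (a * c, s * c) (b, t)) (a * c * b', t * t')"
    using sc 1 tb by (intro ore_mult_rel)
  moreover have "ore_rel (ore_mult (a, s) (b, t)) (a * (c * b'), t * t')"
    using 1 tb by (intro ore_mult_rel) (simp_all only: mult.assoc not_False_eq_True)
  ultimately show ?case
    by (simp only: mult.assoc) (rule ore_rel_trans[OF _ ore_rel_sym])
next
  case (2 _ _ _ _ a s b t c)
  then have tc: "t * c \<noteq> 0" by simp
  obtain t' b' where tb: "(b * c) * t' = s * b'" "t' \<noteq> 0"
    using swap_denom[OF \<open>s \<noteq> 0\<close>] .
  have "ore_rel (ore_mult (a, s) (b * c, t * c)) (a * b', t * c * t')"
    using tc 2 tb by (intro ore_mult_rel)
  moreover have "ore_rel (ore_mult (a, s) (b, t)) (a * b', t * (c * t'))"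
    using 2 tb by (intro ore_mult_rel) (simp_all add: mult.assoc)
  ultimately show ?case
    by (simp only: mult.assoc) (rule ore_rel_trans[OF _ ore_rel_sym])
qed

definition minus_ore_quotient :: "'a ore_quotient \<Rightarrow> 'a ore_quotient \<Rightarrow> 'a ore_quotient"
  where "x - y = x + - y" for x y :: "'a ore_quotient"

lift_definition inverse_ore_quotient :: "'a ore_quotient \<Rightarrow> 'a ore_quotient"
  is "\<lambda>(a, s). if a = 0 then (0, 1) else (s, a)"
proof -
  fix p q :: "'a \<times> 'a"
  assume rel: "ore_rel p q"
  obtain a s b t where pq: "p = (a, s)" "q = (b, t)" by (metis prod.exhaust)
  obtain u v where *: "s * u = t * v" "s * u \<noteq> 0" "a * u = b * v" "s \<noteq> 0" "t \<noteq> 0"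
    using rel unfolding pq ore_rel_simp by blast
  have "u \<noteq> 0" "v \<noteq> 0" using * by auto
  then have ab: "a = 0 \<longleftrightarrow> b = 0" using *(3) by (metis mult_eq_0_iff)
  have "ore_rel (s, a) (t, b)" if "a \<noteq> 0"
  proof -
    have "a * u \<noteq> 0" using that \<open>u \<noteq> 0\<close> by simp
    then show ?thesis using * ab that unfolding ore_rel_simp by blast
  qed
  then show "ore_rel ((\<lambda>(a, s). if a = 0 then (0, 1) else (s, a)) p)
      ((\<lambda>(a, s). if a = 0 then (0, 1) else (s, a)) q)"
    using ab by (simp add: pq)
qed

definition divide_ore_quotient :: "'a ore_quotient \<Rightarrow> 'a ore_quotient \<Rightarrow> 'a ore_quotient"
  where "x div y = x * inverse y" for x y :: "'a ore_quotient"


definition Frac :: "'a \<Rightarrow> 'a \<Rightarrow> 'a ore_quotient"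
  where "Frac a s = abs_ore_quotient (a, s)"

lemma Frac_eq_iff: "s \<noteq> 0 \<Longrightarrow> t \<noteq> 0 \<Longrightarrow> Frac a s = Frac b t \<longleftrightarrow> ore_rel (a, s) (b, t)"
  unfolding Frac_def using Quotient_rel[OF Quotient_ore_quotient, of "(a, s)" "(b, t)"] by simp

lemma Frac_expand: "s \<noteq> 0 \<Longrightarrow> c \<noteq> 0 \<Longrightarrow> Frac (a * c) (s * c) = Frac a s"
  by (subst Frac_eq_iff) (auto intro: ore_rel_sym ore_rel_expand)

lemma Frac_cases:
  obtains a s where "x = Frac a s" "s \<noteq> 0"
proof -
  have "\<exists>a s. x = Frac a s \<and> s \<noteq> 0"
    unfolding Frac_def
  proof (induction x rule: ore_quotient.abs_induct)
    case (1 y)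
    then show ?case by (cases y) auto
  qed
  then show ?thesis using that by blast
qed

lemma Frac_0: "(0 :: 'a ore_quotient) = Frac 0 1"
  and Frac_1: "(1 :: 'a ore_quotient) = Frac 1 1"
  by (simp_all add: Frac_def zero_ore_quotient_def one_ore_quotient_def)

lemma Frac_uminus: "s \<noteq> 0 \<Longrightarrow> - Frac a s = Frac (- a) s"
  by (simp add: Frac_def uminus_ore_quotient.abs_eq)

lemma Frac_add:
  assumes "s \<noteq> 0" "t \<noteq> 0" "s * u = t * v" "s * u \<noteq> 0"
  shows "Frac a s + Frac b t = Frac (a * u + b * v) (s * u)"
  using ore_add_rel[OF assms, of a b] assms unfolding Frac_def
  by (simp add: plus_ore_quotient.abs_eq ore_abs_eq)

lemma Frac_mult:
  assumes "s \<noteq> 0" "t \<noteq> 0" "b * t' = s * b'" "t' \<noteq> 0"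
  shows "Frac a s * Frac b t = Frac (a * b') (t * t')"
  using ore_mult_rel[OF assms, of a] assms unfolding Frac_def
  by (simp add: times_ore_quotient.abs_eq ore_abs_eq)

lemma Frac_inverse: "s \<noteq> 0 \<Longrightarrow> a \<noteq> 0 \<Longrightarrow> inverse (Frac a s) = Frac s a"
  by (simp add: Frac_def inverse_ore_quotient.abs_eq)

lemma Frac_add_same: "s \<noteq> 0 \<Longrightarrow> Frac a s + Frac b s = Frac (a + b) s"
  using Frac_add[of s s 1 1 a b] by simp

lemma Frac_zero: "s \<noteq> 0 \<Longrightarrow> Frac 0 s = 0"
  using Frac_expand[of 1 s 0] by (simp add: Frac_0)

lemma Frac_self: "s \<noteq> 0 \<Longrightarrow> Frac s s = 1"
  using Frac_expand[of 1 s 1] by (simp add: Frac_1)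

lemma Frac_eq_0_iff: "s \<noteq> 0 \<Longrightarrow> Frac a s = 0 \<longleftrightarrow> a = 0"
  by (auto simp: Frac_zero) (auto simp: Frac_0 Frac_eq_iff ore_rel_simp)

lemma Frac_cases2:
  obtains a b s where "x = Frac a s" "y = Frac b s" "s \<noteq> 0"
proof -
  obtain a s where x: "x = Frac a s" "s \<noteq> 0" by (rule Frac_cases)
  obtain b t where y: "y = Frac b t" "t \<noteq> 0" by (rule Frac_cases)
  obtain u v where uv: "s * u = t * v" "s * u \<noteq> 0" "u \<noteq> 0" "v \<noteq> 0"
    by (rule common_denom[OF x(2) y(2)])
  have "x = Frac (a * u) (s * u)"
    by (simp only: x(1) Frac_expand[OF x(2) uv(3)])
  moreover have "y = Frac (b * v) (s * u)"
    by (simp only: y(1) uv(1) Frac_expand[OF y(2) uv(4)])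
  ultimately show ?thesis using uv that by blast
qed

lemma Frac_cases3:
  obtains a b c s where "x = Frac a s" "y = Frac b s" "z = Frac c s" "s \<noteq> 0"
proof -
  obtain a b s where x: "x = Frac a s" "y = Frac b s" "s \<noteq> 0" by (rule Frac_cases2)
  obtain c t where y: "z = Frac c t" "t \<noteq> 0" by (rule Frac_cases)
  obtain u v where uv: "s * u = t * v" "s * u \<noteq> 0" "u \<noteq> 0" "v \<noteq> 0"
    by (rule common_denom[OF x(3) y(2)])
  have "x = Frac (a * u) (s * u)" "y = Frac (b * u) (s * u)"
    by (simp_all only: x(1,2) Frac_expand[OF x(3) uv(3)])
  moreover have "z = Frac (c * v) (s * u)"
    by (simp only: y(1) uv(1) Frac_expand[OF y(2) uv(4)])
  ultimately show ?thesis using uv that by blast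
qed

instance
proof
  fix x y z :: "'a ore_quotient"
  show "(x + y) + z = x + (y + z)"
    by (rule Frac_cases3[of x y z]) (simp add: Frac_add_same add.assoc)
  show "x + y = y + x"
    by (rule Frac_cases2[of x y]) (simp add: Frac_add_same add.commute)
  show "0 + x = x"
    by (rule Frac_cases[of x]) (simp add: Frac_zero[symmetric] Frac_add_same)
  show "- x + x = 0"
    by (rule Frac_cases[of x]) (simp add: Frac_uminus Frac_add_same Frac_zero)
  show "x - y = x + - y" by (rule minus_ore_quotient_def)
  show "x div y = x * inverse y" by (rule divide_ore_quotient_def)
  show "(x * y) * z = x * (y * z)"
  proof -
    obtain a s where x: "x = Frac a s" "s \<noteq> 0" by (rule Frac_cases)
    obtain b t where y: "y = Frac b t" "t \<noteq> 0" by (rule Frac_cases)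
    obtain c r where z: "z = Frac c r" "r \<noteq> 0" by (rule Frac_cases)
    obtain p b' where p: "b * p = s * b'" "p \<noteq> 0" using swap_denom[OF x(2)] .
    have tp: "t * p \<noteq> 0" using p y by simp
    obtain q c' where q: "c * q = (t * p) * c'" "q \<noteq> 0" using swap_denom[OF tp] .
    have "(x * y) * z = Frac (a * b') (t * p) * Frac c r"
      by (simp only: x(1) y(1) z(1) Frac_mult[OF x(2) y(2) p])
    also have "\<dots> = Frac (a * b' * c') (r * q)"
      by (rule Frac_mult[OF tp z(2) q])
    finally have 1: "(x * y) * z = Frac (a * b' * c') (r * q)" .
    have "c * q = t * (p * c')" using q(1) by (simp only: mult.assoc)
    then have 2: "y * z = Frac (b * (p * c')) (r * q)"
      unfolding y(1) z(1) using Frac_mult[OF y(2) z(2) _ q(2)] by blast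
    have rq: "r * q \<noteq> 0" using q z by simp
    have 3: "b * (p * c') * 1 = s * (b' * c')"
      by (simp only: p(1) mult_1_right mult.assoc[symmetric])
    have "x * (y * z) = Frac (a * (b' * c')) (r * q * 1)"
      unfolding x(1) 2 by (rule Frac_mult[OF x(2) rq 3 one_neq_zero])
    with 1 show ?thesis by (simp only: mult.assoc mult_1_right)
  qed
  show "1 * x = x"
  proof (rule Frac_cases[of x])
    fix a s assume "x = Frac a s" "s \<noteq> 0"
    then show ?thesis using Frac_mult[of 1 s a 1 a 1] by (simp add: Frac_1)
  qed
  show "x * 1 = x"
  proof (rule Frac_cases[of x])
    fix a s assume "x = Frac a s" "s \<noteq> 0"
    then show ?thesis using Frac_mult[of s 1 1 s 1 a] by (simp add: Frac_1)
  qed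
  show "(x + y) * z = x * z + y * z"
  proof -
    obtain a b s where x: "x = Frac a s" "y = Frac b s" "s \<noteq> 0" by (rule Frac_cases2)
    obtain c r where z: "z = Frac c r" "r \<noteq> 0" by (rule Frac_cases)
    obtain p c' where p: "c * p = s * c'" "p \<noteq> 0" using swap_denom[OF x(3)] .
    show ?thesis using x z p
      by (simp add: Frac_add_same Frac_mult[OF x(3) z(2) p] distrib_right)
  qed
  show "x * (y + z) = x * y + x * z"
  proof -
    obtain a s where x: "x = Frac a s" "s \<noteq> 0" by (rule Frac_cases)
    obtain b c t where y: "y = Frac b t" "z = Frac c t" "t \<noteq> 0" by (rule Frac_cases2)
    obtain p b' where p: "b * p = s * b'" "p \<noteq> 0" using swap_denom[OF x(2)] .
    obtain q c' where q: "c * q = s * c'" "q \<noteq> 0" using swap_denom[OF x(2)] .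
    obtain u v where uv: "p * u = q * v" "p * u \<noteq> 0" by (rule common_denom[OF p(2) q(2)])
    have b: "b * (p * u) = s * (b' * u)" by (simp only: p(1) mult.assoc[symmetric])
    have c: "c * (p * u) = s * (c' * v)" unfolding uv(1) by (simp only: q(1) mult.assoc[symmetric])
    have bc: "(b + c) * (p * u) = s * (b' * u + c' * v)"
      using b c by (simp add: distrib_left distrib_right)
    have t: "t * (p * u) \<noteq> 0" using y(3) uv(2) mult_eq_0_iff by blast
    show ?thesis unfolding x y Frac_add_same[OF y(3)] Frac_mult[OF x(2) y(3) b uv(2)]
        Frac_mult[OF x(2) y(3) c uv(2)] Frac_mult[OF x(2) y(3) bc uv(2)] Frac_add_same[OF t]
      by (simp only: distrib_left)
  qed
  show "(0 :: 'a ore_quotient) \<noteq> 1"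
    by (simp add: Frac_0 Frac_1 Frac_eq_iff ore_rel_simp)
  show "inverse x * x = 1" if "x \<noteq> 0"
  proof (rule Frac_cases[of x])
    fix a s assume x: "x = Frac a s" "s \<noteq> 0"
    then have "a \<noteq> 0" using that by (auto simp: Frac_eq_0_iff)
    then show ?thesis using x Frac_mult[of a s a 1 1 s] by (simp add: Frac_inverse Frac_self)
  qed
  show "x * inverse x = 1" if "x \<noteq> 0"
  proof (rule Frac_cases[of x])
    fix a s assume x: "x = Frac a s" "s \<noteq> 0"
    then have "a \<noteq> 0" using that by (auto simp: Frac_eq_0_iff)
    then show ?thesis using x Frac_mult[of s a s 1 1 a] by (simp add: Frac_inverse Frac_self)
  qed
  show "inverse (0 :: 'a ore_quotient) = 0"
    by (simp add: zero_ore_quotient_def inverse_ore_quotient.abs_eq)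
qed

end

definition ore_of :: "'a::right_ore_domain \<Rightarrow> 'a ore_quotient"
  where "ore_of a = Frac a 1"

lemma ore_of_0: "ore_of 0 = 0" and ore_of_1: "ore_of 1 = 1"
  by (simp_all add: ore_of_def Frac_0 Frac_1)

lemma ore_of_add: "ore_of (a + b) = ore_of a + ore_of b"
  by (simp add: ore_of_def Frac_add_same)

lemma ore_of_mult: "ore_of (a * b) = ore_of a * ore_of b"
  using Frac_mult[of 1 1 b 1 b a] by (simp add: ore_of_def)

lemma inj_ore_of: "inj ore_of"
  by (rule injI) (auto simp: ore_of_def Frac_eq_iff ore_rel_simp)

lemma Frac_eq_ore_of: "s \<noteq> 0 \<Longrightarrow> Frac a s = ore_of a * inverse (ore_of s)"
  using Frac_mult[of 1 s 1 1 1 a] by (simp add: ore_of_def Frac_inverse)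


section \<open>The first Weyl algebra\<close>

datatype weyl_gen = Gen_x | Gen_y

text \<open>Words are written additively, since the ring structure on \<^typ>\<open>'w \<Rightarrow>\<^sub>0 'k\<close>
  is that of the monoid algebra of an additive monoid \<^typ>\<open>'w\<close>.\<close>

datatype weyl_word = Word "weyl_gen list"

instantiation weyl_word :: monoid_add
begin

definition zero_weyl_word :: weyl_word
  where "0 = Word []"

fun plus_weyl_word :: "weyl_word \<Rightarrow> weyl_word \<Rightarrow> weyl_word"
  where "Word u + Word v = Word (u @ v)"

instance
proof
  fix a b c :: weyl_word
  show "a + b + c = a + (b + c)" by (cases a; cases b; cases c) simp
  show "0 + a = a" "a + 0 = a" by (cases a; simp add: zero_weyl_word_def)+
qed

end

type_synonym 'k free_algebra_xy = "weyl_word \<Rightarrow>\<^sub>0 'k"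

definition free_x :: "'k::field_char_0 free_algebra_xy"
  where "free_x = Poly_Mapping.single (Word [Gen_x]) 1"

definition free_y :: "'k::field_char_0 free_algebra_xy"
  where "free_y = Poly_Mapping.single (Word [Gen_y]) 1"

definition two_sided_ideal :: "'a::ring_1 set \<Rightarrow> bool"
  where "two_sided_ideal I \<longleftrightarrow> 0 \<in> I \<and> (\<forall>a\<in>I. \<forall>b\<in>I. a - b \<in> I) \<and>
    (\<forall>a\<in>I. \<forall>r. r * a \<in> I \<and> a * r \<in> I)"

definition ideal_generated :: "'a::ring_1 set \<Rightarrow> 'a set"
  where "ideal_generated S = \<Inter> {I. two_sided_ideal I \<and> S \<subseteq> I}"

lemma two_sided_ideal_generated: "two_sided_ideal (ideal_generated S)"
  unfolding two_sided_ideal_def ideal_generated_def by blast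

lemma ideal_generated_base: "S \<subseteq> ideal_generated S"
  unfolding ideal_generated_def by blast

lemma ideal_generated_least: "two_sided_ideal I \<Longrightarrow> S \<subseteq> I \<Longrightarrow> ideal_generated S \<subseteq> I"
  unfolding ideal_generated_def by blast

lemma two_sided_idealD:
  assumes "two_sided_ideal I"
  shows "0 \<in> I" "a \<in> I \<Longrightarrow> b \<in> I \<Longrightarrow> a - b \<in> I" "a \<in> I \<Longrightarrow> - a \<in> I"
    "a \<in> I \<Longrightarrow> b \<in> I \<Longrightarrow> a + b \<in> I" "a \<in> I \<Longrightarrow> r * a \<in> I" "a \<in> I \<Longrightarrow> a * r \<in> I"
proof -
  show z: "0 \<in> I" using assms by (simp add: two_sided_ideal_def)
  show d: "a - b \<in> I" if "a \<in> I" "b \<in> I" for a b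
    using assms that by (simp add: two_sided_ideal_def)
  show m: "- a \<in> I" if "a \<in> I" for a
    using d[OF z that] by simp
  show "a + b \<in> I" if "a \<in> I" "b \<in> I"
    using d[OF that(1) m[OF that(2)]] by simp
  show "r * a \<in> I" "a * r \<in> I" if "a \<in> I"
    using assms that by (simp_all add: two_sided_ideal_def)
qed

definition weyl_ideal :: "'k::field_char_0 free_algebra_xy set"
  where "weyl_ideal = ideal_generated {free_y * free_x - free_x * free_y - 1}"

lemma two_sided_ideal_weyl: "two_sided_ideal weyl_ideal"
  unfolding weyl_ideal_def by (rule two_sided_ideal_generated)

lemmas weyl_idealD = two_sided_idealD[OF two_sided_ideal_weyl]

definition weyl_rel :: "'k::field_char_0 free_algebra_xy \<Rightarrow> 'k free_algebra_xy \<Rightarrow> bool"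
  where "weyl_rel p q \<longleftrightarrow> p - q \<in> weyl_ideal"


lemma weyl_ideal_gen: "free_y * free_x - free_x * free_y - 1 \<in> weyl_ideal"
  unfolding weyl_ideal_def using ideal_generated_base by blast

quotient_type (overloaded) 'k weyl = "'k::field_char_0 free_algebra_xy" / weyl_rel
proof (rule equivpI)
  show "reflp (weyl_rel :: 'k free_algebra_xy \<Rightarrow> _)"
    by (rule reflpI) (simp add: weyl_rel_def weyl_idealD(1))
  show "symp (weyl_rel :: 'k free_algebra_xy \<Rightarrow> _)"
  proof (rule sympI)
    fix p q :: "'k free_algebra_xy"
    assume "weyl_rel p q"
    then show "weyl_rel q p"
      unfolding weyl_rel_def using weyl_idealD(3)[of "p - q"] by simp
  qed
  show "transp (weyl_rel :: 'k free_algebra_xy \<Rightarrow> _)"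
  proof (rule transpI)
    fix p q r :: "'k free_algebra_xy"
    assume "weyl_rel p q" "weyl_rel q r"
    then show "weyl_rel p r"
      unfolding weyl_rel_def using weyl_idealD(4)[of "p - q" "q - r"] by simp
  qed
qed

instantiation weyl :: (field_char_0) ring
begin

lift_definition zero_weyl :: "'a weyl" is "0 :: 'a free_algebra_xy" .

lift_definition uminus_weyl :: "'a weyl \<Rightarrow> 'a weyl" is uminus
  unfolding weyl_rel_def by (metis minus_diff_minus weyl_idealD(3))

lift_definition plus_weyl :: "'a weyl \<Rightarrow> 'a weyl \<Rightarrow> 'a weyl" is "(+)"
  unfolding weyl_rel_def by (metis add_diff_add weyl_idealD(4))

lift_definition minus_weyl :: "'a weyl \<Rightarrow> 'a weyl \<Rightarrow> 'a weyl" is "(-)"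
proof -
  fix p p' q q' :: "'a free_algebra_xy"
  assume "weyl_rel p p'" "weyl_rel q q'"
  then show "weyl_rel (p - q) (p' - q')"
    unfolding weyl_rel_def using weyl_idealD(2)[of "p - p'" "q - q'"]
    by (simp add: algebra_simps)
qed

lift_definition times_weyl :: "'a weyl \<Rightarrow> 'a weyl \<Rightarrow> 'a weyl" is "(*)"
proof -
  fix p p' q q' :: "'a free_algebra_xy"
  assume *: "weyl_rel p p'" "weyl_rel q q'"
  have "(p - p') * q + p' * (q - q') \<in> weyl_ideal"
    using * unfolding weyl_rel_def by (blast intro: weyl_idealD(4-6))
  then show "weyl_rel (p * q) (p' * q')"
    unfolding weyl_rel_def by (simp add: algebra_simps)
qed

instance
proof
  fix a b c :: "'a weyl"
  show "a + b + c = a + (b + c)" by transfer (simp add: weyl_rel_def weyl_idealD add.assoc)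
  show "a + b = b + a" by transfer (simp add: weyl_rel_def weyl_idealD add.commute)
  show "0 + a = a" by transfer (simp add: weyl_rel_def weyl_idealD)
  show "- a + a = 0" by transfer (simp add: weyl_rel_def weyl_idealD)
  show "a - b = a + - b" by transfer (simp add: weyl_rel_def weyl_idealD)
  show "a * b * c = a * (b * c)" by transfer (simp add: weyl_rel_def weyl_idealD mult.assoc)
  show "(a + b) * c = a * c + b * c"
    by transfer (simp add: weyl_rel_def weyl_idealD distrib_right)
  show "a * (b + c) = a * b + a * c"
    by transfer (simp add: weyl_rel_def weyl_idealD distrib_left)
qed

end

lift_definition weyl_const :: "'k::field_char_0 \<Rightarrow> 'k weyl"
  is "Poly_Mapping.single 0" .

lift_definition weyl_x :: "'k::field_char_0 weyl" is free_x .

lift_definition weyl_y :: "'k::field_char_0 weyl" is free_y .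


subsection \<open>The action on polynomials\<close>

primrec gen_action :: "weyl_gen \<Rightarrow> 'k::field_char_0 poly \<Rightarrow> 'k poly"
  where "gen_action Gen_x v = pCons 0 v"
  | "gen_action Gen_y v = pderiv v"

primrec word_action :: "weyl_word \<Rightarrow> 'k::field_char_0 poly \<Rightarrow> 'k poly"
  where "word_action (Word gs) v = fold gen_action (rev gs) v"

definition free_action :: "'k::field_char_0 free_algebra_xy \<Rightarrow> 'k poly \<Rightarrow> 'k poly"
  where "free_action p v = (\<Sum>w\<in>Poly_Mapping.keys p. smult (Poly_Mapping.lookup p w) (word_action w v))"

lemma word_action_plus: "word_action (u + w) v = word_action u (word_action w v)"
  by (cases u; cases w) simp

lemma gen_action_linear: "gen_action g (v + w) = gen_action g v + gen_action g w"
  "gen_action g (smult c v) = smult c (gen_action g v)"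
  by (cases g; simp add: pderiv_add pderiv_smult)+

lemma fold_action_linear: "fold gen_action gs (v + w) = fold gen_action gs v + fold gen_action gs w"
  "fold gen_action gs (smult c v) = smult c (fold gen_action gs v)"
  by (induction gs arbitrary: v w) (simp_all add: gen_action_linear)

lemma word_action_linear: "word_action g (v + w) = word_action g v + word_action g w"
  "word_action g (smult c v) = smult c (word_action g v)"
  by (cases g; simp add: fold_action_linear)+

lemma word_action_0: "word_action g 0 = 0"
  using word_action_linear(2)[of g 0 0] by simp

lemma free_action_0 [simp]: "free_action 0 v = 0"
  by (simp add: free_action_def)

lemma free_action_add: "free_action (p + q) v = free_action p v + free_action q v"
  unfolding free_action_def
  by (rule setsum_keys_plus_distrib) (simp_all add: smult_add_left)

lemma free_action_uminus: "free_action (- p) v = - free_action p v"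
  using free_action_add[of p "- p" v] by (simp add: eq_neg_iff_add_eq_0 add.commute)

lemma free_action_diff: "free_action (p - q) v = free_action p v - free_action q v"
  using free_action_add[of p "- q" v] by (simp add: free_action_uminus)

lemma free_action_single [simp]: "free_action (Poly_Mapping.single w c) v = smult c (word_action w v)"
  by (simp add: free_action_def)

lemma smult_sum_right: "smult c (sum f A) = (\<Sum>x\<in>A. smult c (f x))"
  by (induction A rule: infinite_finite_induct) (simp_all add: smult_add_right)

lemma free_action_linear: "free_action p (v + w) = free_action p v + free_action p w"
  "free_action p (smult c v) = smult c (free_action p v)"
  by (simp_all add: free_action_def word_action_linear smult_add_right sum.distrib
      smult_sum_right mult.commute)

lemma free_algebra_induct [case_names zero add single]:
  fixes p :: "'a \<Rightarrow>\<^sub>0 'b::ab_group_add"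
  assumes "P 0" "\<And>p q. P p \<Longrightarrow> P q \<Longrightarrow> P (p + q)" "\<And>w c. P (Poly_Mapping.single w c)"
  shows "P p"
proof (induction p rule: update_induct)
  case (update f a b)
  have "Poly_Mapping.update a b f = f + Poly_Mapping.single a b"
    using update(1)
    by (intro poly_mapping_eqI) (auto simp: lookup_update lookup_add lookup_single in_keys_iff)
  then show ?case using assms update by simp
qed (rule assms)

lemma free_action_mult: "free_action (p * q) v = free_action p (free_action q v)"
proof (induction p rule: free_algebra_induct)
  case (single w c)
  show ?case
  proof (induction q rule: free_algebra_induct)
    case zero
    show ?case by (simp add: word_action_0)
  next
    case (add q r)
    then show ?case by (simp add: distrib_left free_action_add word_action_linear smult_add_right)
  next
    case (single u d)
    show ?case by (simp add: mult_single word_action_plus word_action_linear)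
  qed
qed (simp_all add: distrib_right free_action_add)

lemma free_action_ideal: "p \<in> weyl_ideal \<Longrightarrow> free_action p v = 0"
proof -
  let ?I = "{p :: 'a free_algebra_xy. \<forall>v. free_action p v = 0}"
  have 0: "free_action p 0 = 0" for p :: "'a free_algebra_xy"
    using free_action_linear(2)[of p 0 0] by simp
  have "two_sided_ideal ?I"
    by (auto simp: two_sided_ideal_def free_action_diff free_action_mult 0)
  moreover have "free_y * free_x - free_x * free_y - 1 \<in> ?I"
    by (auto simp: free_action_diff free_action_mult free_x_def free_y_def pderiv_pCons
        zero_weyl_word_def simp flip: single_one)
  ultimately show "p \<in> weyl_ideal \<Longrightarrow> free_action p v = 0"
    using ideal_generated_least[of ?I "{free_y * free_x - free_x * free_y - 1}"]
    unfolding weyl_ideal_def by auto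
qed

lift_definition weyl_action :: "'k::field_char_0 weyl \<Rightarrow> 'k poly \<Rightarrow> 'k poly" is free_action
  unfolding weyl_rel_def using free_action_ideal
  by (metis eq_iff_diff_eq_0 free_action_diff ext)

instantiation weyl :: (field_char_0) ring_1
begin

lift_definition one_weyl :: "'a weyl" is "1 :: 'a free_algebra_xy" .

instance
proof
  fix a :: "'a weyl"
  show "1 * a = a" "a * 1 = a" by (transfer, simp add: weyl_rel_def weyl_idealD)+
  have "free_action (1 :: 'a free_algebra_xy) 1 = 1"
    by (simp add: zero_weyl_word_def flip: single_one)
  then have "(1 :: 'a free_algebra_xy) \<notin> weyl_ideal" using free_action_ideal by fastforce
  then show "(0 :: 'a weyl) \<noteq> 1"
    by transfer (use weyl_idealD(3)[of "-1"] in \<open>auto simp: weyl_rel_def\<close>)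
qed

end


lemma weyl_const_add: "weyl_const (c + d) = weyl_const c + weyl_const d"
  by transfer (simp add: weyl_rel_def weyl_idealD single_add)

lemma weyl_const_mult: "weyl_const (c * d) = weyl_const c * weyl_const d"
  by transfer (simp add: weyl_rel_def weyl_idealD mult_single)

lemma weyl_const_0: "weyl_const 0 = 0"
  by transfer (simp add: weyl_rel_def weyl_idealD)

lemma weyl_const_1: "weyl_const 1 = 1"
  by transfer (simp add: weyl_rel_def weyl_idealD)

lemma single_0_commute:
  fixes p :: "'a::field_char_0 free_algebra_xy"
  shows "Poly_Mapping.single 0 c * p = p * Poly_Mapping.single 0 c"
  by (induction p rule: free_algebra_induct)
    (simp_all add: distrib_left distrib_right mult_single mult.commute)

lemma weyl_const_commute: "weyl_const c * a = a * weyl_const c"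
  by transfer (simp add: weyl_rel_def weyl_idealD single_0_commute)

lemma weyl_const_left_commute: "a * (weyl_const c * b) = weyl_const c * (a * b)"
  by (metis mult.assoc weyl_const_commute)

lemma weyl_relation: "weyl_y * weyl_x = weyl_x * weyl_y + 1"
  by transfer (use weyl_ideal_gen in \<open>simp add: weyl_rel_def algebra_simps\<close>)

lemma weyl_induct [case_names add const x y]:
  fixes a :: "'k::field_char_0 weyl"
  assumes add: "\<And>a b. P a \<Longrightarrow> P b \<Longrightarrow> P (a + b)"
    and const: "\<And>c. P (weyl_const c)"
    and x: "\<And>a. P a \<Longrightarrow> P (weyl_x * a)"
    and y: "\<And>a. P a \<Longrightarrow> P (weyl_y * a)"
  shows "P a"
proof (induction a rule: weyl.abs_induct)
  case (1 p)
  show ?case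
  proof (induction p rule: free_algebra_induct)
    case zero
    show ?case using const[of 0] by (simp add: weyl_const_0 zero_weyl_def)
  next
    case (add p q)
    then show ?case using assms(1)[OF add] by (simp add: plus_weyl.abs_eq)
  next
    case (single w c)
    obtain gs where w: "w = Word gs" by (cases w)
    show ?case unfolding w
    proof (induction gs)
      case Nil
      then show ?case
        using const[of c] by (simp add: weyl_const.abs_eq zero_weyl_word_def)
    next
      case (Cons g gs)
      show ?case
      proof (cases g)
        case Gen_x
        then show ?thesis using x[OF Cons]
          by (simp add: weyl_x_def times_weyl.abs_eq free_x_def mult_single)
      next
        case Gen_y
        then show ?thesis using y[OF Cons]
          by (simp add: weyl_y_def times_weyl.abs_eq free_y_def mult_single)
      qed
    qed
  qed
qed

lemma free_action_0_right: "free_action p 0 = 0"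
  using free_action_linear(2)[of p 0 0] by simp

lemma weyl_action_add: "weyl_action (a + b) v = weyl_action a v + weyl_action b v"
  by transfer (simp add: free_action_add)

lemma weyl_action_mult: "weyl_action (a * b) v = weyl_action a (weyl_action b v)"
  by transfer (simp add: free_action_mult)

lemma weyl_action_const: "weyl_action (weyl_const c) v = smult c v"
  by (simp add: weyl_const.abs_eq weyl_action.abs_eq zero_weyl_word_def)

lemma weyl_action_x: "weyl_action weyl_x v = pCons 0 v"
  by (simp add: weyl_x_def weyl_action.abs_eq free_x_def)

lemma weyl_action_y: "weyl_action weyl_y v = pderiv v"
  by (simp add: weyl_y_def weyl_action.abs_eq free_y_def)

lemma weyl_action_0: "weyl_action 0 v = 0"
  by (simp add: zero_weyl_def weyl_action.abs_eq)

lemma weyl_action_0_right: "weyl_action a 0 = 0"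
  by transfer (rule free_action_0_right)

lemmas weyl_action_simps = weyl_action_add weyl_action_mult weyl_action_const
  weyl_action_x weyl_action_y weyl_action_0 weyl_action_0_right


subsection \<open>Normal forms\<close>

definition weyl_px :: "'k::field_char_0 poly \<Rightarrow> 'k weyl"
  where "weyl_px p = fold_coeffs (\<lambda>c r. weyl_const c + weyl_x * r) p 0"

lemma weyl_px_0 [simp]: "weyl_px 0 = 0"
  by (simp add: weyl_px_def)

lemma weyl_px_pCons [simp]: "weyl_px (pCons c p) = weyl_const c + weyl_x * weyl_px p"
  by (cases "p = 0 \<and> c = 0") (auto simp: weyl_px_def weyl_const_0)

lemma weyl_px_add: "weyl_px (p + q) = weyl_px p + weyl_px q"
  by (induction p q rule: poly_induct2) (simp_all add: weyl_const_add algebra_simps)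

lemma weyl_px_smult: "weyl_px (smult c p) = weyl_const c * weyl_px p"
  by (induction p)
    (simp_all add: weyl_const_mult distrib_left weyl_const_left_commute)

lemma weyl_px_mult: "weyl_px (p * q) = weyl_px p * weyl_px q"
  by (induction p) (simp_all add: weyl_px_add weyl_px_smult weyl_const_0 distrib_right mult.assoc)

lemma weyl_y_px: "weyl_y * weyl_px p = weyl_px p * weyl_y + weyl_px (pderiv p)"
proof (induction p)
  case (pCons c p)
  have "weyl_y * weyl_px (pCons c p) = weyl_const c * weyl_y + (weyl_y * weyl_x) * weyl_px p"
    by (simp add: distrib_left weyl_const_commute mult.assoc)
  also have "\<dots> = weyl_const c * weyl_y + weyl_x * (weyl_y * weyl_px p) + weyl_px p"
    by (simp add: weyl_relation distrib_right mult.assoc add.assoc)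
  finally show ?case
    unfolding pCons.IH by (simp add: pderiv_pCons weyl_px_add weyl_const_0 algebra_simps)
qed simp

definition weyl_nf :: "'k::field_char_0 poly poly \<Rightarrow> 'k weyl"
  where "weyl_nf P = fold_coeffs (\<lambda>p r. weyl_px p + r * weyl_y) P 0"

lemma weyl_nf_0 [simp]: "weyl_nf 0 = 0"
  by (simp add: weyl_nf_def)

lemma weyl_nf_pCons [simp]: "weyl_nf (pCons p P) = weyl_px p + weyl_nf P * weyl_y"
  by (cases "P = 0 \<and> p = 0") (auto simp: weyl_nf_def)

lemma weyl_nf_add: "weyl_nf (P + Q) = weyl_nf P + weyl_nf Q"
  by (induction P Q rule: poly_induct2) (simp_all add: weyl_px_add algebra_simps)

lemma weyl_nf_smult: "weyl_nf (smult p Q) = weyl_px p * weyl_nf Q"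
  by (induction Q) (simp_all add: weyl_px_mult distrib_left mult.assoc)

definition y_shift :: "'k::field_char_0 poly poly \<Rightarrow> 'k poly poly"
  where "y_shift P = pCons 0 P + map_poly pderiv P"

lemma y_shift_pCons: "y_shift (pCons p P) = pCons (pderiv p) ([:p:] + y_shift P)"
  by (simp add: y_shift_def map_poly_pCons)

lemma weyl_y_nf: "weyl_y * weyl_nf P = weyl_nf (y_shift P)"
proof (induction P)
  case 0
  show ?case by (simp add: y_shift_def)
next
  case (pCons p P)
  have "weyl_y * weyl_nf (pCons p P) = weyl_y * weyl_px p + (weyl_y * weyl_nf P) * weyl_y"
    by (simp add: distrib_left mult.assoc)
  then show ?case
    by (simp add: y_shift_pCons pCons.IH weyl_y_px weyl_nf_add algebra_simps)
qed

lemma weyl_nf_surj: "\<exists>P. a = weyl_nf P"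
proof (induction a rule: weyl_induct)
  case (add a b)
  then show ?case by (metis weyl_nf_add)
next
  case (const c)
  have "weyl_const c = weyl_nf [:[:c:]:]" by simp
  then show ?case ..
next
  case (x a)
  then obtain P where "a = weyl_nf P" ..
  then have "weyl_x * a = weyl_nf (smult [:0, 1:] P)"
    by (simp add: weyl_nf_smult weyl_const_0 weyl_const_1)
  then show ?case ..
next
  case (y a)
  then show ?case by (metis weyl_y_nf)
qed

lemma weyl_action_px: "weyl_action (weyl_px p) v = p * v"
  by (induction p) (simp_all add: weyl_action_simps)

lemma pderiv_surj: "\<exists>v. pderiv v = (w :: 'k::field_char_0 poly)"
proof -
  have *: "\<exists>v. pderiv v = (\<Sum>i\<le>n. monom (f i) i)" for f :: "nat \<Rightarrow> 'k" and n
  proof (induction n)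
    case 0
    have "pderiv (monom (f 0) 1) = monom (f 0) 0" by (simp add: pderiv_monom)
    then show ?case by auto
  next
    case (Suc n)
    then obtain v where v: "pderiv v = (\<Sum>i\<le>n. monom (f i) i)" ..
    have "pderiv (v + monom (f (Suc n) / of_nat (Suc (Suc n))) (Suc (Suc n))) =
        (\<Sum>i\<le>Suc n. monom (f i) i)"
      by (simp add: pderiv_add v pderiv_monom del: of_nat_Suc)
    then show ?case ..
  qed
  show ?thesis using *[of "coeff w" "degree w"] by (simp add: poly_as_sum_of_monoms)
qed

lemma weyl_nf_faithful: "(\<And>v. weyl_action (weyl_nf P) v = 0) \<Longrightarrow> P = 0"
proof (induction P)
  case (pCons p P)
  have *: "p * v + weyl_action (weyl_nf P) (pderiv v) = 0" for v
    using pCons.prems[of v] by (simp add: weyl_action_simps weyl_action_px)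
  have p: "p = 0" using *[of 1] by (simp add: weyl_action_simps)
  have "weyl_action (weyl_nf P) w = 0" for w
  proof -
    obtain v where "pderiv v = w" using pderiv_surj by blast
    then show ?thesis using *[of v] p by simp
  qed
  then show ?case using pCons.IH p by simp
qed simp

lemma weyl_nf_eq_0_iff: "weyl_nf P = 0 \<longleftrightarrow> P = 0"
  using weyl_nf_faithful[of P] by (auto simp: weyl_action_simps)

lemma y_shift_nonzero: "P \<noteq> 0 \<Longrightarrow> degree (y_shift P) = Suc (degree P) \<and> y_shift P \<noteq> 0"
proof -
  assume P: "P \<noteq> 0"
  have "degree (map_poly pderiv P) < degree (pCons 0 P)"
    using P degree_le[of "degree P" "map_poly pderiv P"]
    by (simp add: coeff_map_poly coeff_eq_0)
  then have "degree (y_shift P) = degree (pCons 0 P)"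
    unfolding y_shift_def by (rule degree_add_eq_left)
  then show ?thesis using P by auto
qed

lemma weyl_nf_mult_nonzero:
  "P \<noteq> 0 \<Longrightarrow> Q \<noteq> 0 \<Longrightarrow>
    \<exists>R. R \<noteq> 0 \<and> degree R = degree P + degree Q \<and> weyl_nf P * weyl_nf Q = weyl_nf R"
proof (induction P arbitrary: Q)
  case (pCons p P)
  have eq: "weyl_nf (pCons p P) * weyl_nf Q = weyl_nf (smult p Q) + weyl_nf P * weyl_nf (y_shift Q)"
    by (simp add: distrib_right mult.assoc weyl_nf_smult weyl_y_nf)
  show ?case
  proof (cases "P = 0")
    case True
    then show ?thesis using pCons.prems eq by (intro exI[of _ "smult p Q"]) auto
  next
    case False
    then obtain R where R: "R \<noteq> 0" "degree R = degree P + degree (y_shift Q)"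
        "weyl_nf P * weyl_nf (y_shift Q) = weyl_nf R"
      using pCons.IH y_shift_nonzero[OF pCons.prems(2)] by blast
    have d: "degree R = degree (pCons p P) + degree Q"
      using R False y_shift_nonzero[OF pCons.prems(2)] by simp
    have "degree (smult p Q) < degree R"
      using d False degree_smult_le[of p Q] by simp
    then have "degree (smult p Q + R) = degree R" by (rule degree_add_eq_right)
    then show ?thesis using d eq R False
      by (intro exI[of _ "smult p Q + R"]) (auto simp: weyl_nf_add)
  qed
qed simp

instance weyl :: (field_char_0) ring_1_no_zero_divisors
proof
  fix a b :: "'a weyl"
  obtain P Q where "a = weyl_nf P" "b = weyl_nf Q" using weyl_nf_surj by metis
  moreover assume "a \<noteq> 0" "b \<noteq> 0"
  ultimately show "a * b \<noteq> 0"
    using weyl_nf_mult_nonzero[of P Q] by (auto simp: weyl_nf_eq_0_iff)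
qed


subsection \<open>The Ore condition\<close>

definition total_deg_le :: "nat \<Rightarrow> 'k::field_char_0 poly poly \<Rightarrow> bool"
  where "total_deg_le n P \<longleftrightarrow> (\<forall>i j. coeff (coeff P j) i \<noteq> 0 \<longrightarrow> i + j \<le> n)"

lemma total_deg_le_exists: "\<exists>n. total_deg_le n P"
proof (induction P)
  case (pCons p P)
  then obtain n where n: "total_deg_le n P" by blast
  have "total_deg_le (Suc (n + degree p)) (pCons p P)"
    unfolding total_deg_le_def
  proof (intro allI impI)
    fix i j assume "coeff (coeff (pCons p P) j) i \<noteq> 0"
    then show "i + j \<le> Suc (n + degree p)"
      using n by (cases j) (force simp: total_deg_le_def dest: le_degree)+
  qed
  then show ?case ..
qed (simp add: total_deg_le_def)

lemma total_deg_le_mono: "total_deg_le m P \<Longrightarrow> m \<le> n \<Longrightarrow> total_deg_le n P"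
  by (meson order_trans total_deg_le_def)

lemma total_deg_le_add: "total_deg_le n P \<Longrightarrow> total_deg_le n Q \<Longrightarrow> total_deg_le n (P + Q)"
  by (auto simp: total_deg_le_def) (metis add.right_neutral)

lemma total_deg_le_smult:
  assumes "\<And>i. coeff p i \<noteq> 0 \<Longrightarrow> i \<le> m" "total_deg_le n Q"
  shows "total_deg_le (m + n) (smult p Q)"
  unfolding total_deg_le_def
proof (intro allI impI)
  fix i j assume "coeff (coeff (smult p Q) j) i \<noteq> 0"
  then obtain k where k: "k \<le> i" "coeff p k * coeff (coeff Q j) (i - k) \<noteq> 0"
    unfolding coeff_smult coeff_mult by (meson atMost_iff sum.not_neutral_contains_not_neutral)
  then have "k \<le> m" "i - k + j \<le> n"
    using assms(1)[of k] assms(2) unfolding total_deg_le_def mult_eq_0_iff de_Morgan_disj by blast+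
  with k show "i + j \<le> m + n" by simp
qed

lemma total_deg_le_y_shift: "total_deg_le n P \<Longrightarrow> total_deg_le (Suc n) (y_shift P)"
  unfolding y_shift_def
proof (rule total_deg_le_add)
  assume P: "total_deg_le n P"
  show "total_deg_le (Suc n) (pCons 0 P)"
    unfolding total_deg_le_def
  proof (intro allI impI)
    fix i j assume "coeff (coeff (pCons 0 P) j) i \<noteq> 0"
    then show "i + j \<le> Suc n"
      using P by (cases j) (auto simp: total_deg_le_def)
  qed
  show "total_deg_le (Suc n) (map_poly pderiv P)"
    unfolding total_deg_le_def
  proof (intro allI impI)
    fix i j assume "coeff (coeff (map_poly pderiv P) j) i \<noteq> 0"
    then have "coeff (coeff P j) (Suc i) \<noteq> 0"
      by (auto simp: coeff_map_poly coeff_pderiv)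
    then show "i + j \<le> Suc n" using P by (fastforce simp: total_deg_le_def)
  qed
qed

lemma weyl_nf_mult_total_deg:
  "total_deg_le m P \<Longrightarrow> total_deg_le n Q \<Longrightarrow>
    \<exists>R. total_deg_le (m + n) R \<and> weyl_nf P * weyl_nf Q = weyl_nf R"
proof (induction P arbitrary: m n Q)
  case 0
  then show ?case by (intro exI[of _ 0]) (simp add: total_deg_le_def)
next
  case (pCons p P)
  have eq: "weyl_nf (pCons p P) * weyl_nf Q = weyl_nf (smult p Q) + weyl_nf P * weyl_nf (y_shift Q)"
    by (simp add: distrib_right mult.assoc weyl_nf_smult weyl_y_nf)
  have "i \<le> m" if "coeff p i \<noteq> 0" for i
  proof -
    have "coeff (coeff (pCons p P) 0) i \<noteq> 0" using that by simp
    then have "i + 0 \<le> m" using pCons.prems(1) unfolding total_deg_le_def by blast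
    then show ?thesis by simp
  qed
  then have 1: "total_deg_le (m + n) (smult p Q)"
    using pCons.prems by (intro total_deg_le_smult)
  show ?case
  proof (cases "P = 0")
    case True
    then show ?thesis using 1 eq by (intro exI[of _ "smult p Q"]) simp
  next
    case False
    have P: "Suc (i + j) \<le> m" if "coeff (coeff P j) i \<noteq> 0" for i j
    proof -
      have "coeff (coeff (pCons p P) (Suc j)) i \<noteq> 0" using that by simp
      then have "i + Suc j \<le> m" using pCons.prems(1) unfolding total_deg_le_def by blast
      then show ?thesis by simp
    qed
    have m: "m > 0"
      using P[of "degree P" "degree (coeff P (degree P))"] False by simp
    have "total_deg_le (m - 1) P"
      unfolding total_deg_le_def using P by fastforce
    then obtain R where R: "total_deg_le (m - 1 + Suc n) R"
        "weyl_nf P * weyl_nf (y_shift Q) = weyl_nf R"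
      using pCons.IH total_deg_le_y_shift[OF pCons.prems(2)] by blast
    then have "total_deg_le (m + n) R" using m by simp
    then show ?thesis using 1 eq R
      by (intro exI[of _ "smult p Q + R"]) (auto simp: weyl_nf_add total_deg_le_add)
  qed
qed

definition weyl_scale :: "'k::field_char_0 \<Rightarrow> 'k weyl \<Rightarrow> 'k weyl"
  where "weyl_scale c a = weyl_const c * a"

interpretation weyl: unital_algebra weyl_scale
proof
  fix c :: 'a and a b :: "'a weyl"
  show "weyl_scale c (a * b) = a * weyl_scale c b"
    by (simp only: weyl_scale_def weyl_const_left_commute)
qed (simp_all add: weyl_scale_def weyl_const_add weyl_const_mult weyl_const_1
      distrib_left distrib_right mult.assoc)

definition deg_pairs :: "nat \<Rightarrow> (nat \<times> nat) set"
  where "deg_pairs n = {(i, j). i + j \<le> n}"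

lemma deg_pairs_Suc: "deg_pairs (Suc n) = deg_pairs n \<union> (\<lambda>i. (i, Suc n - i)) ` {..Suc n}"
  by (auto simp: deg_pairs_def image_iff)

lemma finite_deg_pairs [simp]: "finite (deg_pairs n)"
proof (rule finite_subset)
  show "deg_pairs n \<subseteq> {..n} \<times> {..n}" by (auto simp: deg_pairs_def)
qed simp

lemma card_deg_pairs: "2 * card (deg_pairs n) = (n + 1) * (n + 2)"
proof (induction n)
  case 0
  have "deg_pairs 0 = {(0, 0)}" by (auto simp: deg_pairs_def)
  then show ?case by simp
next
  case (Suc n)
  have "card (deg_pairs (Suc n)) = card (deg_pairs n) + card ((\<lambda>i. (i, Suc n - i)) ` {..Suc n})"
    unfolding deg_pairs_Suc by (rule card_Un_disjoint, simp, simp) (auto simp: deg_pairs_def)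
  also have "card ((\<lambda>i. (i, Suc n - i)) ` {..Suc n}) = Suc (Suc n)"
    by (subst card_image) (auto simp: inj_on_def)
  finally show ?case using Suc by simp
qed

definition weyl_mon :: "nat \<times> nat \<Rightarrow> 'k::field_char_0 weyl"
  where "weyl_mon ij = weyl_nf (monom (monom 1 (fst ij)) (snd ij))"

lemma weyl_nf_sum: "weyl_nf (sum f A) = (\<Sum>x\<in>A. weyl_nf (f x))"
  by (induction A rule: infinite_finite_induct) (simp_all add: weyl_nf_add)

lemma weyl_sum_mon:
  fixes u :: "nat \<times> nat \<Rightarrow> 'a::field_char_0"
  shows "(\<Sum>ij\<in>A. weyl_scale (u ij) (weyl_mon ij)) =
    weyl_nf (\<Sum>ij\<in>A. monom (monom (u ij) (fst ij)) (snd ij))"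
proof -
  have "weyl_scale c (weyl_mon ij) = weyl_nf (monom (monom c (fst ij)) (snd ij))"
    for c :: "'a" and ij
  proof -
    have "weyl_scale c (weyl_mon ij) = weyl_px [:c:] * weyl_mon ij"
      by (simp add: weyl_scale_def)
    also have "\<dots> = weyl_nf (monom (monom c (fst ij)) (snd ij))"
      unfolding weyl_mon_def weyl_nf_smult[symmetric] by (simp add: smult_monom)
    finally show ?thesis .
  qed
  then show ?thesis by (simp add: weyl_nf_sum)
qed

lemma coeff_sum_mon:
  assumes "finite A"
  shows "coeff (coeff (\<Sum>ij\<in>A. monom (monom (u ij) (fst ij)) (snd ij)) j) i =
    (if (i, j) \<in> A then u (i, j) else 0)"
proof -
  have "coeff (coeff (\<Sum>ij\<in>A. monom (monom (u ij) (fst ij)) (snd ij)) j) i =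
      (\<Sum>ij\<in>A. if ij = (i, j) then u ij else 0)"
    unfolding coeff_sum by (rule sum.cong) (auto simp: prod_eq_iff)
  then show ?thesis using assms by (simp add: sum.delta')
qed

lemma weyl_mon_span:
  assumes "total_deg_le n P"
  shows "weyl_nf P \<in> weyl.span (weyl_mon ` deg_pairs n)"
proof -
  have "P = (\<Sum>ij\<in>deg_pairs n. monom (monom (coeff (coeff P (snd ij)) (fst ij)) (fst ij)) (snd ij))"
    using assms
    by (intro poly_eqI) (simp only: coeff_sum_mon[OF finite_deg_pairs] fst_conv snd_conv, auto simp: total_deg_le_def deg_pairs_def)
  then have "weyl_nf P =
      (\<Sum>ij\<in>deg_pairs n. weyl_scale (coeff (coeff P (snd ij)) (fst ij)) (weyl_mon ij))"
    unfolding weyl_sum_mon by simp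
  also have "\<dots> \<in> weyl.span (weyl_mon ` deg_pairs n)"
    by (intro weyl.span_sum weyl.span_scale weyl.span_base imageI)
  finally show ?thesis .
qed

lemma (in vector_space) nontrivial_relation:
  assumes "finite I" "finite T" "F ` I \<subseteq> span T" "card T < card I"
  obtains u where "\<exists>i\<in>I. u i \<noteq> 0" "(\<Sum>i\<in>I. scale (u i) (F i)) = 0"
proof (cases "inj_on F I")
  case True
  have "dependent (F ` I)"
    using independent_span_bound[OF assms(2) _ assms(3)] assms(4) card_image[OF True] by auto
  then obtain u where "\<exists>v\<in>F ` I. u v \<noteq> 0" "(\<Sum>v\<in>F ` I. scale (u v) v) = 0"
    using dependent_finite[of "F ` I"] assms(1) by auto
  then show ?thesis using that[of "u \<circ> F"] True by (auto simp: sum.reindex)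
next
  case False
  then obtain i j where ij: "i \<in> I" "j \<in> I" "i \<noteq> j" "F i = F j" by (auto simp: inj_on_def)
  define u :: "'c \<Rightarrow> 'a" where "u = (\<lambda>k. if k = i then 1 else if k = j then - 1 else 0)"
  have "(\<Sum>k\<in>I. scale (u k) (F k)) = (\<Sum>k\<in>{i, j}. scale (u k) (F k))"
    using ij assms(1) by (intro sum.mono_neutral_right) (auto simp: u_def)
  also have "\<dots> = 0" using ij by (simp add: u_def)
  finally have "(\<Sum>k\<in>I. scale (u k) (F k)) = 0" .
  moreover have "\<exists>k\<in>I. u k \<noteq> 0" using ij(1) by (auto simp: u_def)
  ultimately show ?thesis using that[of u] by blast
qed

lemma weyl_right_ore:
  fixes a b :: "'k::field_char_0 weyl"
  assumes "a \<noteq> 0" "b \<noteq> 0"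
  shows "\<exists>u v. a * u = b * v \<and> a * u \<noteq> 0"
proof -
  obtain P Q where PQ: "a = weyl_nf P" "b = weyl_nf Q" using weyl_nf_surj by metis
  obtain n1 n2 where n12: "total_deg_le n1 P" "total_deg_le n2 Q"
    using total_deg_le_exists by metis
  define n where "n = max n1 n2"
  have n: "total_deg_le n P" "total_deg_le n Q"
    using total_deg_le_mono[OF n12(1)] total_deg_le_mono[OF n12(2)] by (simp_all add: n_def)
  define D where "D = deg_pairs (3 * n)"
  define I where "I = (UNIV :: bool set) \<times> D"
  define T :: "'k weyl set" where "T = weyl_mon ` deg_pairs (n + 3 * n)"
  define F where "F = (\<lambda>(s, ij). (if s then a else b) * weyl_mon ij)"
  have mon: "total_deg_le (3 * n) (monom (monom (1 :: 'k) (fst ij)) (snd ij))" if "ij \<in> D" for ij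
    using that by (auto simp: total_deg_le_def D_def deg_pairs_def split: if_splits)
  have "F (s, ij) \<in> weyl.span T" if "ij \<in> D" for s ij
  proof -
    have "\<exists>R. total_deg_le (n + 3 * n) R \<and> F (s, ij) = weyl_nf R"
      using weyl_nf_mult_total_deg[OF n(1) mon[OF that]] weyl_nf_mult_total_deg[OF n(2) mon[OF that]]
      by (auto simp: F_def PQ weyl_mon_def)
    then show ?thesis unfolding T_def using weyl_mon_span by metis
  qed
  then have span: "F ` I \<subseteq> weyl.span T" by (auto simp: I_def)
  have "card T \<le> card (deg_pairs (n + 3 * n))"
    unfolding T_def by (rule card_image_le) simp
  also have "\<dots> < card I"
    using card_deg_pairs[of "n + 3 * n"] card_deg_pairs[of "3 * n"]
    by (simp add: I_def D_def card_cartesian_product algebra_simps)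
  finally have card: "card T < card I" .
  have fin: "finite D" "finite I" "finite T" by (simp_all add: D_def I_def T_def)
  obtain u where u: "\<exists>i\<in>I. u i \<noteq> 0" "(\<Sum>i\<in>I. weyl_scale (u i) (F i)) = 0"
    by (rule weyl.nontrivial_relation[OF fin(2,3) span card])
  define w where "w s = (\<Sum>ij\<in>D. weyl_scale (u (s, ij)) (weyl_mon ij))" for s
  have I: "I = Pair True ` D \<union> Pair False ` D" unfolding I_def UNIV_bool by auto
  have "(\<Sum>i\<in>I. weyl_scale (u i) (F i)) =
      (\<Sum>i\<in>Pair True ` D. weyl_scale (u i) (F i)) + (\<Sum>i\<in>Pair False ` D. weyl_scale (u i) (F i))"
    unfolding I using fin by (intro sum.union_disjoint) auto
  also have "\<dots> = a * w True + b * w False"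
    by (simp add: sum.reindex inj_on_def w_def F_def sum_distrib_left weyl.scale_mult_right)
  finally have eq: "a * w True = b * - w False"
    using u(2) by (simp add: eq_neg_iff_add_eq_0)
  have w0: "u (s, ij) = 0" if "w s = 0" "ij \<in> D" for s ij
  proof -
    have "(\<Sum>ij\<in>D. monom (monom (u (s, ij)) (fst ij)) (snd ij)) = 0"
      using that(1) unfolding w_def weyl_sum_mon by (simp add: weyl_nf_eq_0_iff)
    then show ?thesis
      using coeff_sum_mon[OF fin(1), of "\<lambda>ij. u (s, ij)" "snd ij" "fst ij"] that(2) by simp
  qed
  have "w True \<noteq> 0"
  proof
    assume t: "w True = 0"
    then have "w False = 0" using eq assms by simp
    with t have "u i = 0" if "i \<in> I" for i
      using w0 that unfolding I by blast
    then show False using u(1) by blast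
  qed
  then have "a * w True \<noteq> 0" using assms by simp
  with eq show ?thesis by blast
qed

instance weyl :: (field_char_0) right_ore_domain
  by standard (rule weyl_right_ore)


subsection \<open>The quotient division ring\<close>

type_synonym 'k weyl_field = "'k weyl ore_quotient"

definition weyl_field_scale :: "'k::field_char_0 \<Rightarrow> 'k weyl_field \<Rightarrow> 'k weyl_field"
  where "weyl_field_scale c q = ore_of (weyl_const c) * q"

lemma ore_of_const_commute:
  fixes q :: "'k::field_char_0 weyl_field"
  shows "ore_of (weyl_const c) * q = q * ore_of (weyl_const c)"
proof -
  obtain a s where q: "q = Frac a s" "s \<noteq> 0" by (rule Frac_cases)
  have "q * ore_of (weyl_const c) = Frac (a * weyl_const c) s"
    unfolding q ore_of_def
    using Frac_mult[of s 1 "weyl_const c" s "weyl_const c" a] q weyl_const_commute[of c s] by simp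
  moreover have "ore_of (weyl_const c) * q = Frac (weyl_const c * a) s"
    unfolding q ore_of_def using Frac_mult[of 1 s a 1 a "weyl_const c"] q by simp
  ultimately show ?thesis by (simp add: weyl_const_commute)
qed

interpretation weyl_field: unital_algebra weyl_field_scale
proof
  fix c :: 'a and a b :: "'a weyl_field"
  show "weyl_field_scale c (a * b) = a * weyl_field_scale c b"
    unfolding weyl_field_scale_def by (metis mult.assoc ore_of_const_commute)
qed (simp_all add: weyl_field_scale_def weyl_const_add weyl_const_mult weyl_const_1
      ore_of_add ore_of_mult ore_of_1 distrib_left distrib_right mult.assoc)

end

theory Submission
  imports Defs
begin

text \<open>The Weyl algebra \<open>A\<close> is exhausted by boxes \<open>B\<^sub>k = span {x\<^sup>i y\<^sup>j. i < m, j < n}\<close> of dimension \<open>2 ^ k\<close> with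
  \<open>B\<^sub>k\<^sub>+\<^sub>1 = B\<^sub>k \<oplus> B\<^sub>k c\<^sub>k\<close>, where \<open>c\<^sub>k\<close> is alternately a power of \<open>y\<close> and of \<open>x\<close>. In a ring \<open>R\<close> without
  nonzero abelian idempotents every idempotent is a sum of two equivalent orthogonal ones, so \<open>R\<close> contains
  a tower of \<open>2 ^ k \<times> 2 ^ k\<close> matrix units, and \<open>R\<close> as a right module is identified with
  \<open>B\<^sub>k \<otimes> f\<^sub>k R\<close> compatibly in \<open>k\<close>. Left multiplication by \<open>a \<in> A\<close> is thereby defined on the
  submodule spanned by those \<open>v \<in> B\<^sub>k\<close> with \<open>a v \<in> B\<^sub>k\<close>. As the codimension of these \<open>v\<close> in \<open>B\<^sub>k\<close> is
  negligible compared with \<open>2 ^ k\<close>, the join of these submodules is \<open>R\<close>: a complement would embed in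
  arbitrarily small pieces of \<open>R\<close>, giving infinitely many independent copies of itself, which
  continuity forbids. Carrying this out in one half of \<open>R\<close> leaves the other half free to hold graphs, and
  upper continuity, applied to these, glues the partial maps to an element of \<open>R\<close>. This element is injective for \<open>a \<noteq> 0\<close> since \<open>A\<close> is a domain, hence a unit, and the resulting
  homomorphism extends to the quotient division ring.\<close>

section \<open>The lattice of principal right ideals\<close>

abbreviation PR :: "'r::ring_1 set set"
  where "PR \<equiv> range principal_right_ideal"

lemma principal_right_ideal_iff: "r \<in> principal_right_ideal a \<longleftrightarrow> (\<exists>t. r = a * t)"
  by (auto simp: principal_right_ideal_def)

lemma PR_closed:
  assumes "J \<in> PR"
  shows "0 \<in> J" "x \<in> J \<Longrightarrow> y \<in> J \<Longrightarrow> x + y \<in> J" "x \<in> J \<Longrightarrow> y \<in> J \<Longrightarrow> x - y \<in> J"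
    "x \<in> J \<Longrightarrow> - x \<in> J" "x \<in> J \<Longrightarrow> x * r \<in> J"
proof -
  obtain a where J: "J = principal_right_ideal a" using assms by blast
  show "0 \<in> J" unfolding J principal_right_ideal_iff by (rule exI[of _ 0]) simp
  show "x \<in> J \<Longrightarrow> y \<in> J \<Longrightarrow> x + y \<in> J" "x \<in> J \<Longrightarrow> y \<in> J \<Longrightarrow> x - y \<in> J"
    unfolding J principal_right_ideal_iff by (metis distrib_left, metis right_diff_distrib)
  show "x \<in> J \<Longrightarrow> - x \<in> J" unfolding J principal_right_ideal_iff by (metis mult_minus_right)
  show "x \<in> J \<Longrightarrow> x * r \<in> J" unfolding J principal_right_ideal_iff by (metis mult.assoc)
qed

lemma self_in_principal: "a \<in> principal_right_ideal a"
  unfolding principal_right_ideal_iff by (metis mult_1_right)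

lemma principal_subset_iff: "J \<in> PR \<Longrightarrow> principal_right_ideal a \<subseteq> J \<longleftrightarrow> a \<in> J"
proof -
  assume J: "J \<in> PR"
  have "principal_right_ideal a \<subseteq> J" if "a \<in> J"
    using PR_closed(5)[OF J that] unfolding principal_right_ideal_def by blast
  then show ?thesis using self_in_principal[of a] by blast
qed

text \<open>In a continuous ring this intersection is again principal (\<open>rcl_PR\<close>), so
  \<open>rcl\<close> of a union is the lattice join and can be handled elementwise.\<close>

definition rcl :: "'r::ring_1 set \<Rightarrow> 'r set"
  where "rcl S = \<Inter> {J \<in> PR. S \<subseteq> J}"

lemma subset_rcl: "S \<subseteq> rcl S"
  by (auto simp: rcl_def)

lemma rcl_least: "J \<in> PR \<Longrightarrow> S \<subseteq> J \<Longrightarrow> rcl S \<subseteq> J"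
  by (auto simp: rcl_def)

lemma rcl_mono: "S \<subseteq> T \<Longrightarrow> rcl S \<subseteq> rcl T"
  by (auto simp: rcl_def)

definition rsum :: "'r::ring_1 set \<Rightarrow> 'r set \<Rightarrow> 'r set"
  where "rsum J K = {x + y | x y. x \<in> J \<and> y \<in> K}"

locale continuous_ring =
  fixes R :: "'r::ring_1 itself"
  assumes continuous: "continuous_regular_ring R"
begin

lemma regular: "\<exists>b. a * b * a = a" for a :: 'r
  using continuous unfolding continuous_regular_ring_def von_neumann_regular_def by blast

lemma idempotent_generator:
  assumes "J \<in> (PR :: 'r set set)"
  obtains e where "e * e = e" "e \<in> J" "J = {r. e * r = r}"
proof -
  obtain a where a: "J = principal_right_ideal a" using assms by blast
  obtain b where b: "a * b * a = a" using regular by blast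
  have "J = {r. (a * b) * r = r}"
  proof (intro Set.set_eqI iffI)
    fix r assume "r \<in> J"
    then show "r \<in> {r. (a * b) * r = r}" unfolding a principal_right_ideal_iff
      using b by (auto simp: mult.assoc[symmetric])
  next
    fix r assume "r \<in> {r. (a * b) * r = r}"
    then have "r = a * (b * r)" by (simp add: mult.assoc)
    then show "r \<in> J" unfolding a principal_right_ideal_iff by blast
  qed
  moreover have "(a * b) * (a * b) = a * b" using b by (simp add: mult.assoc[symmetric])
  ultimately show ?thesis using that[of "a * b"] by simp
qed

text \<open>\<open>d * c\<close> is idempotent with the same right annihilator as \<open>c\<close>,
  so this annihilator is generated by \<open>1 - d * c\<close>.\<close>

lemma annihilator_PR: "{r :: 'r. c * r = 0} \<in> PR"
proof -
  obtain d where d: "c * d * c = c" using regular by blast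
  have "{r. c * r = 0} = principal_right_ideal (1 - d * c)"
    unfolding principal_right_ideal_def
  proof (intro Set.set_eqI iffI)
    fix r assume "r \<in> {r. c * r = 0}"
    then have "r = (1 - d * c) * r" by (simp add: algebra_simps)
    then show "r \<in> {(1 - d * c) * r | r. True}" by blast
  next
    fix r assume "r \<in> {(1 - d * c) * r | r. True}"
    then obtain t where t: "r = (1 - d * c) * t" by blast
    have "c * (1 - d * c) = 0" using d by (simp add: algebra_simps)
    then show "r \<in> {r. c * r = 0}" unfolding t by (simp add: mult.assoc[symmetric])
  qed
  then show ?thesis by blast
qed

lemma equalizer_PR: "{r :: 'r. c * r = d * r} \<in> PR"
  using annihilator_PR[of "c - d"] by (simp add: left_diff_distrib)

lemma fixed_PR: "{r :: 'r. c * r = r} \<in> PR"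
  using equalizer_PR[of c 1] by simp

text \<open>If \<open>e\<close> generates \<open>J\<close>, only the part \<open>(1 - e) * b\<close>
  of the generator of \<open>K\<close> is new. The element \<open>f\<close> fixes this part and
  kills \<open>e\<close>, so \<open>e + f\<close> acts as the identity exactly on the sum.\<close>

lemma rsum_PR:
  assumes "J \<in> PR" "K \<in> (PR :: 'r set set)"
  shows "rsum J K \<in> PR"
proof -
  obtain e where e: "e * e = e" "J = {r. e * r = r}" using assms(1) by (rule idempotent_generator)
  obtain b where b: "K = principal_right_ideal b" using assms(2) by blast
  obtain c where c: "((1 - e) * b) * c * ((1 - e) * b) = (1 - e) * b" using regular by blast
  define f where "f = (1 - e) * b * c * (1 - e)"
  have "f * e = (1 - e) * b * c * ((1 - e) * e)" by (simp add: f_def mult.assoc)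
  then have fe: "f * e = 0" using e(1) by (simp add: left_diff_distrib)
  have fb: "f * b = (1 - e) * b" unfolding f_def using c by (simp add: mult.assoc)
  have ff: "f * f = f"
  proof -
    have "f * f = f * ((1 - e) * b) * c * (1 - e)" by (simp add: f_def mult.assoc)
    also have "f * ((1 - e) * b) = (1 - e) * b"
      using fb fe by (simp add: mult.assoc[symmetric] right_diff_distrib)
    finally show ?thesis by (simp add: f_def)
  qed
  have "rsum J K = {r. (e + f) * r = r}"
  proof (intro Set.set_eqI iffI)
    fix r assume "r \<in> rsum J K"
    then obtain j t where r: "r = j + b * t" "e * j = j"
      unfolding rsum_def e(2) b principal_right_ideal_def by blast
    have fj: "f * j = 0" using r(2) fe by (metis mult.assoc mult_zero_left)
    have "(e + f) * b = b" using fb by (simp add: algebra_simps)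
    then have "(e + f) * (b * t) = b * t" by (simp add: mult.assoc[symmetric])
    then show "r \<in> {r. (e + f) * r = r}" using r fj by (simp add: distrib_left distrib_right)
  next
    fix r assume r: "r \<in> {r. (e + f) * r = r}"
    define z where "z = b * (c * (1 - e) * r)"
    have "f * r = z - e * z" unfolding f_def z_def by (simp only: mult.assoc left_diff_distrib mult_1_left)
    then have "r = e * (r - z) + z"
      using r by (simp add: distrib_right right_diff_distrib add_diff_eq diff_add_eq)
    moreover have "e * (r - z) \<in> J"
      unfolding e(2) using e(1) by (simp add: mult.assoc[symmetric])
    moreover have "z \<in> K" unfolding b z_def principal_right_ideal_iff by blast
    ultimately show "r \<in> rsum J K" unfolding rsum_def by blast
  qed
  then show ?thesis using fixed_PR by simp
qed

section \<open>Joins, meets and continuity of the lattice\<close>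

abbreviation L :: "'r set gorder"
  where "L \<equiv> principal_right_ideals R"

lemma L_simps [simp]: "carrier L = PR" "le L = (\<subseteq>)" "eq L = (=)"
  by (auto simp: principal_right_ideals_def)

lemma complete_L: "complete_lattice L"
  using continuous unfolding continuous_regular_ring_def Let_def by blast

sublocale L: complete_lattice L by (rule complete_L)

text \<open>Any element of the intersection generates a principal right ideal below every member,
  hence below the lattice meet; so arbitrary meets are set intersections.\<close>

lemma Inter_PR:
  assumes "\<D> \<subseteq> (PR :: 'r set set)"
  shows "\<Inter>\<D> \<in> PR" and "\<Sqinter>\<^bsub>L\<^esub>\<D> = \<Inter>\<D>"
proof -
  have "greatest L (\<Sqinter>\<^bsub>L\<^esub>\<D>) (Lower L \<D>)" by (rule L.inf_glb) (simp add: assms)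
  then have 1: "\<Sqinter>\<^bsub>L\<^esub>\<D> \<in> PR" "\<And>x. x \<in> \<D> \<Longrightarrow> \<Sqinter>\<^bsub>L\<^esub>\<D> \<subseteq> x"
    "\<And>y. y \<in> PR \<Longrightarrow> (\<forall>x\<in>\<D>. y \<subseteq> x) \<Longrightarrow> y \<subseteq> \<Sqinter>\<^bsub>L\<^esub>\<D>"
    using assms by (auto simp: greatest_def Lower_def)
  have "\<Inter>\<D> \<subseteq> \<Sqinter>\<^bsub>L\<^esub>\<D>"
  proof
    fix r assume "r \<in> \<Inter>\<D>"
    then have "\<forall>x\<in>\<D>. principal_right_ideal r \<subseteq> x"
      using assms principal_subset_iff[of _ r] by blast
    then have "principal_right_ideal r \<subseteq> \<Sqinter>\<^bsub>L\<^esub>\<D>" using 1(3) by blast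
    then show "r \<in> \<Sqinter>\<^bsub>L\<^esub>\<D>" using self_in_principal by blast
  qed
  with 1(2) show "\<Sqinter>\<^bsub>L\<^esub>\<D> = \<Inter>\<D>" by blast
  with 1(1) show "\<Inter>\<D> \<in> PR" by simp
qed

lemma rcl_PR: "rcl (S :: 'r set) \<in> PR"
  unfolding rcl_def by (rule Inter_PR(1)) blast

lemma sup_L:
  assumes "\<D> \<subseteq> (PR :: 'r set set)"
  shows "\<Squnion>\<^bsub>L\<^esub>\<D> = rcl (\<Union>\<D>)"
proof -
  have "least L (\<Squnion>\<^bsub>L\<^esub>\<D>) (Upper L \<D>)" by (rule L.sup_lub) (simp add: assms)
  then have 1: "\<Squnion>\<^bsub>L\<^esub>\<D> \<in> PR" "\<And>x. x \<in> \<D> \<Longrightarrow> x \<subseteq> \<Squnion>\<^bsub>L\<^esub>\<D>"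
    "\<And>y. y \<in> PR \<Longrightarrow> (\<forall>x\<in>\<D>. x \<subseteq> y) \<Longrightarrow> \<Squnion>\<^bsub>L\<^esub>\<D> \<subseteq> y"
    using assms by (auto simp: least_def Upper_def)
  show ?thesis
  proof
    show "\<Squnion>\<^bsub>L\<^esub>\<D> \<subseteq> rcl (\<Union>\<D>)" using 1(3)[OF rcl_PR] subset_rcl[of "\<Union>\<D>"] by blast
    show "rcl (\<Union>\<D>) \<subseteq> \<Squnion>\<^bsub>L\<^esub>\<D>" by (rule rcl_least[OF 1(1)]) (use 1(2) in blast)
  qed
qed

lemma meet_L: "J \<in> PR \<Longrightarrow> K \<in> PR \<Longrightarrow> J \<sqinter>\<^bsub>L\<^esub> K = J \<inter> K" for J K :: "'r set"
  unfolding meet_def using Inter_PR(2)[of "{J, K}"] by simp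

lemma join_L: "J \<in> PR \<Longrightarrow> K \<in> PR \<Longrightarrow> J \<squnion>\<^bsub>L\<^esub> K = rcl (J \<union> K)" for J K :: "'r set"
  unfolding join_def using sup_L[of "{J, K}"] by simp

lemma rcl_Un: 
  assumes "J \<in> PR" "K \<in> (PR :: 'r set set)"
  shows "rcl (J \<union> K) = rsum J K"
proof
  show "rcl (J \<union> K) \<subseteq> rsum J K"
  proof (rule rcl_least[OF rsum_PR[OF assms]])
    show "J \<union> K \<subseteq> rsum J K"
      using PR_closed(1)[OF assms(1)] PR_closed(1)[OF assms(2)] unfolding rsum_def
      by (auto, metis add.right_neutral, metis add.left_neutral)
  qed
  show "rsum J K \<subseteq> rcl (J \<union> K)"
    using subset_rcl[of "J \<union> K"] PR_closed(2)[OF rcl_PR] unfolding rsum_def by blast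
qed

text \<open>The elements on which two left multiplications agree form a principal right ideal, so
  agreement on generators passes to their join. This replaces any explicit description of an
  infinite join.\<close>

lemma rcl_closed: "x \<in> rcl S \<Longrightarrow> (\<And>s. s \<in> S \<Longrightarrow> c * s = d * s) \<Longrightarrow> c * x = d * x" for x :: 'r
  using rcl_least[OF equalizer_PR[of c d], of S] by blast

lemma rcl_closed_0: "x \<in> rcl S \<Longrightarrow> (\<And>s. s \<in> S \<Longrightarrow> c * s = 0) \<Longrightarrow> c * x = 0" for x :: 'r
  using rcl_closed[of x S c 0] by simp

lemma rcl_closed_1: "x \<in> rcl S \<Longrightarrow> (\<And>s. s \<in> S \<Longrightarrow> c * s = s) \<Longrightarrow> c * x = x" for x :: 'r
  using rcl_closed[of x S c 1] by simp

text \<open>Meeting the members of the chain with \<open>J\<close> gives the family consisting of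
  \<open>{0}\<close> alone, and upper continuity identifies the join of that family with the meet of
  \<open>J\<close> and the join of the chain.\<close>

lemma upper_continuous:
  assumes J: "J \<in> PR" and D: "\<D> \<subseteq> (PR :: 'r set set)"
    and dir: "\<And>E F. E \<in> \<D> \<Longrightarrow> F \<in> \<D> \<Longrightarrow> E \<subseteq> F \<or> F \<subseteq> E"
    and disj: "\<And>E. E \<in> \<D> \<Longrightarrow> J \<inter> E = {0}"
  shows "J \<inter> rcl (\<Union>\<D>) = {0}"
proof (cases "\<D> = {}")
  \<comment> \<open>Directed families are nonempty by definition, so the empty chain is treated
    apart.\<close>
  case True
  have "{0 :: 'r} \<in> PR" using annihilator_PR[of 1] by simp
  then have "rcl {} \<subseteq> {0 :: 'r}" by (rule rcl_least) simp
  then show ?thesis using True PR_closed(1)[OF J] PR_closed(1)[OF rcl_PR[of "{}"]] by auto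
next
  case False
  have "\<exists>w\<in>\<D>. E \<subseteq> w \<and> F \<subseteq> w" if "E \<in> \<D>" "F \<in> \<D>" for E F
    using dir[OF that] that by (metis order_refl)
  then have "upward_directed L \<D>" unfolding upward_directed_def L_simps using D False by (intro conjI ballI)
  then have "J \<sqinter>\<^bsub>L\<^esub> \<Squnion>\<^bsub>L\<^esub>\<D> = \<Squnion>\<^bsub>L\<^esub>((\<lambda>y. J \<sqinter>\<^bsub>L\<^esub> y) ` \<D>)"
    using continuous J unfolding continuous_regular_ring_def Let_def L_simps by auto
  also have "(\<lambda>y. J \<sqinter>\<^bsub>L\<^esub> y) ` \<D> = {{0}}"
  proof -
    have "J \<sqinter>\<^bsub>L\<^esub> y = {0}" if "y \<in> \<D>" for y using meet_L[OF J, of y] D disj that by auto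
    then show ?thesis using False by auto
  qed
  also have "\<Squnion>\<^bsub>L\<^esub>{{0}} = rcl {0}"
    using sup_L[of "{{0}}"] annihilator_PR[of 1] by simp
  also have "\<dots> = {0}"
    using rcl_least[OF annihilator_PR[of 1], of "{0}"] subset_rcl[of "{0 :: 'r}"] by auto
  finally show ?thesis unfolding sup_L[OF D] meet_L[OF J rcl_PR] .
qed

lemma lower_continuous:
  assumes J: "J \<in> PR" and D: "\<D> \<subseteq> (PR :: 'r set set)" "\<D> \<noteq> {}"
    and dir: "\<And>E F. E \<in> \<D> \<Longrightarrow> F \<in> \<D> \<Longrightarrow> E \<subseteq> F \<or> F \<subseteq> E"
    and x: "\<And>E. E \<in> \<D> \<Longrightarrow> x \<in> rcl (J \<union> E)"
  shows "x \<in> rcl (J \<union> \<Inter>\<D>)"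
proof -
  have "\<exists>w\<in>\<D>. w \<subseteq> E \<and> w \<subseteq> F" if "E \<in> \<D>" "F \<in> \<D>" for E F
    using dir[OF that] that by (metis order_refl)
  then have "downward_directed L \<D>" unfolding downward_directed_def L_simps using D by (intro conjI ballI)
  then have "J \<squnion>\<^bsub>L\<^esub> \<Sqinter>\<^bsub>L\<^esub>\<D> = \<Sqinter>\<^bsub>L\<^esub>((\<lambda>y. J \<squnion>\<^bsub>L\<^esub> y) ` \<D>)"
    using continuous J unfolding continuous_regular_ring_def Let_def L_simps by auto
  also have "(\<lambda>y. J \<squnion>\<^bsub>L\<^esub> y) ` \<D> = (\<lambda>y. rcl (J \<union> y)) ` \<D>"
    using join_L[OF J] D(1) by (intro image_cong) auto
  also have "\<Sqinter>\<^bsub>L\<^esub>\<dots> = \<Inter>\<dots>" by (rule Inter_PR(2)) (use rcl_PR in blast)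
  finally have "rcl (J \<union> \<Inter>\<D>) = \<Inter>((\<lambda>y. rcl (J \<union> y)) ` \<D>)"
    unfolding join_L[OF J Inter_PR(1)[OF D(1)]] Inter_PR(2)[OF D(1)] .
  then show ?thesis using x by blast
qed

end

section \<open>Continuous rings have no infinite families of independent copies\<close>

context continuous_ring
begin

lemma left_multiples_PR:
  assumes "E \<in> PR"
  shows "{c * r | r. r \<in> E} \<in> (PR :: 'r set set)"
proof -
  obtain a where "E = principal_right_ideal a" using assms by blast
  then have "{c * r | r. r \<in> E} = principal_right_ideal (c * a)"
    by (auto simp: principal_right_ideal_def mult.assoc)
  then show ?thesis by blast
qed

text \<open>If \<open>w \<noteq> 0\<close>, the right ideals generated by the \<open>\<gamma> i\<close> would be infinitely many independent
  copies of the one generated by \<open>w\<close>. The differences \<open>\<gamma> i - \<gamma> (i + 1)\<close> generate a principal right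
  ideal \<open>D\<close> that contains \<open>\<gamma> 0\<close> up to arbitrarily late tails; lower continuity then puts \<open>\<gamma> 0\<close>
  into \<open>D\<close>, whereas upper continuity makes \<open>D\<close> independent of \<open>\<gamma> 0\<close>.\<close>

lemma no_infinite_copies:
  fixes \<gamma> \<delta> :: "nat \<Rightarrow> 'r"
  assumes dual: "\<And>i j. \<delta> i * \<gamma> j = (if i = j then w else 0)"
    and \<gamma>w: "\<And>j. \<gamma> j * w = \<gamma> j"
  shows "w = 0"
proof -
  define U where "U n = rcl {\<gamma> i | i. n \<le> i}" for n
  define S where "S n = rcl {\<gamma> i | i. i < n}" for n
  define D where "D = rcl (range (\<lambda>i. \<gamma> i - \<gamma> (Suc i)))"
  define D' where "D' n = rcl {\<gamma> i - \<gamma> (Suc i) | i. i < n}" for n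
  have PR: "U n \<in> PR" "S n \<in> PR" "D \<in> PR" "D' n \<in> PR" for n
    by (simp_all only: U_def S_def D_def D'_def rcl_PR)
  have U_anti: "U n \<subseteq> U m" if "m \<le> n" for m n
    unfolding U_def using that by (intro rcl_mono Collect_mono) (metis le_trans)
  have S_mono: "S m \<subseteq> S n" "D' m \<subseteq> D' n" if "m \<le> n" for m n
    unfolding S_def D'_def using that
    by (intro rcl_mono Collect_mono; metis less_le_trans)+
  \<comment> \<open>The meet of the tails is \<open>{0}\<close>: it is independent of every finite
    initial join \<open>S n\<close>, hence of the join of all of them, and yet it is contained in
    that join.\<close>
  define X where "X = \<Inter>(range U)"
  have X: "X \<in> PR" unfolding X_def by (rule Inter_PR) (use PR in blast)
  have "X \<inter> S n = {0}" for n
  proof -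
    have "r = 0" if r: "r \<in> X" "r \<in> S n" for r
    proof -
      \<comment> \<open>This sum fixes every \<open>\<gamma> j\<close> with \<open>j < n\<close>,
        while each \<open>\<delta> i\<close> with \<open>i < n\<close> kills the tail
        \<open>U n\<close>.\<close>
      have "(\<Sum>i<n. \<gamma> i * \<delta> i) * r = r"
      proof (rule rcl_closed_1[OF r(2)[unfolded S_def]])
        fix s assume "s \<in> {\<gamma> i | i. i < n}"
        then obtain j where j: "s = \<gamma> j" "j < n" by blast
        have "(\<Sum>i<n. \<gamma> i * \<delta> i) * s = (\<Sum>i<n. if j = i then \<gamma> i * w else 0)"
          unfolding sum_distrib_right j(1) by (rule sum.cong) (auto simp: mult.assoc dual)
        then show "(\<Sum>i<n. \<gamma> i * \<delta> i) * s = s" using j \<gamma>w by simp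
      qed
      moreover have "\<delta> i * r = 0" if "i < n" for i
      proof (rule rcl_closed_0)
        show "r \<in> rcl {\<gamma> i | i. n \<le> i}" using r(1) unfolding X_def U_def by blast
      qed (use that dual in auto)
      ultimately show "r = 0" by (simp add: sum_distrib_right mult.assoc)
    qed
    then show ?thesis using PR_closed(1)[OF X] PR_closed(1)[OF PR(2)] by blast
  qed
  then have "X \<inter> rcl (\<Union>(range S)) = {0}"
    using PR S_mono by (intro upper_continuous[OF X]) (blast, metis imageE nat_le_linear, blast)
  moreover have "X \<subseteq> rcl (\<Union>(range S))"
  proof -
    have "\<gamma> i \<in> rcl (\<Union>(range S))" for i
      using subset_rcl[of "{\<gamma> j | j. j < Suc i}"] subset_rcl[of "\<Union>(range S)"] unfolding S_def by blast
    then have "U 0 \<subseteq> rcl (\<Union>(range S))" unfolding U_def using rcl_PR by (intro rcl_least) auto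
    then show ?thesis unfolding X_def by blast
  qed
  ultimately have X0: "X = {0}" by blast
  \<comment> \<open>Telescoping puts \<open>\<gamma> 0 - \<gamma> n\<close> into \<open>D\<close>,
    so \<open>\<gamma> 0\<close> lies in the join of \<open>D\<close> with each tail.\<close>
  have "\<gamma> 0 \<in> rcl (D \<union> X)"
    unfolding X_def
  proof (rule lower_continuous[OF PR(3)])
    fix E assume "E \<in> range U"
    then obtain n where E: "E = U n" by blast
    have diff: "\<gamma> i - \<gamma> (Suc i) \<in> D" for i unfolding D_def by (rule subsetD[OF subset_rcl]) blast
    have "\<gamma> 0 - \<gamma> n \<in> D"
    proof (induction n)
      case 0
      show ?case using PR_closed(1)[OF PR(3)] by simp
    next
      case (Suc n)
      show ?case using PR_closed(2)[OF PR(3) Suc diff[of n]] by simp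
    qed
    moreover have "\<gamma> n \<in> U n" unfolding U_def by (rule subsetD[OF subset_rcl]) blast
    ultimately have "\<gamma> 0 - \<gamma> n \<in> rcl (D \<union> E)" "\<gamma> n \<in> rcl (D \<union> E)"
      using subset_rcl[of "D \<union> E"] unfolding E by blast+
    then show "\<gamma> 0 \<in> rcl (D \<union> E)" using PR_closed(2)[OF rcl_PR] by fastforce
  next
    show "E \<subseteq> F \<or> F \<subseteq> E" if "E \<in> range U" "F \<in> range U" for E F
      using that U_anti by (metis imageE nat_le_linear)
  qed (use PR in auto)
  also have "rcl (D \<union> X) \<subseteq> D" by (rule rcl_least) (use PR X0 PR_closed(1)[OF PR(3)] in auto)
  finally have "\<gamma> 0 \<in> D" .
  moreover have "D \<subseteq> rcl (\<Union>(range D'))"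
  proof -
    have "\<gamma> i - \<gamma> (Suc i) \<in> rcl (\<Union>(range D'))" for i
      using subset_rcl[of "{\<gamma> j - \<gamma> (Suc j) | j. j < Suc i}"] subset_rcl[of "\<Union>(range D')"]
      unfolding D'_def by blast
    then show ?thesis unfolding D_def using rcl_PR by (intro rcl_least) auto
  qed
  moreover have "principal_right_ideal (\<gamma> 0) \<inter> rcl (\<Union>(range D')) = {0}"
  proof (rule upper_continuous)
    fix E assume "E \<in> range D'"
    then obtain n where E: "E = D' n" by blast
    have "r = 0" if r: "r = \<gamma> 0 * t" "r \<in> D' n" for r t
    proof -
      \<comment> \<open>The sum of the \<open>\<delta> i\<close> takes the value \<open>w\<close> on
        each of \<open>\<gamma> 0\<close> to \<open>\<gamma> n\<close>; it kills the differences
        generating \<open>D' n\<close> and detects \<open>\<gamma> 0 * t\<close> through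
        \<open>w * t\<close>.\<close>
      have "(\<Sum>i\<le>n. \<delta> i) * r = 0"
      proof (rule rcl_closed_0[OF r(2)[unfolded D'_def]])
        fix s assume "s \<in> {\<gamma> i - \<gamma> (Suc i) | i. i < n}"
        then obtain j where j: "s = \<gamma> j - \<gamma> (Suc j)" "j < n" by blast
        have "(\<Sum>i\<le>n. \<delta> i) * \<gamma> k = w" if "k \<le> n" for k
          using that by (simp add: sum_distrib_right dual)
        then show "(\<Sum>i\<le>n. \<delta> i) * s = 0" using j by (simp add: right_diff_distrib)
      qed
      moreover have "(\<Sum>i\<le>n. \<delta> i) * \<gamma> 0 = w" by (simp add: sum_distrib_right dual)
      ultimately have "w * t = 0" unfolding r(1) by (simp add: mult.assoc[symmetric])
      then show ?thesis unfolding r(1) using \<gamma>w[of 0] by (metis mult.assoc mult_zero_right)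
    qed
    then show "principal_right_ideal (\<gamma> 0) \<inter> E = {0}"
      using PR_closed(1)[OF PR(4)] PR_closed(1)[OF rangeI] unfolding E principal_right_ideal_iff[abs_def]
      by (auto simp: principal_right_ideal_iff)
  next
    show "E \<subseteq> F \<or> F \<subseteq> E" if "E \<in> range D'" "F \<in> range D'" for E F
      using that S_mono by (metis imageE nat_le_linear)
  qed (use PR in auto)
  ultimately have "\<gamma> 0 = 0" using self_in_principal[of "\<gamma> 0"] by blast
  then show "w = 0" using dual[of 0 0] by simp
qed

text \<open>The idempotent \<open>w = 1 - a * b\<close> measures the failure. Its translates
  \<open>a ^ j * w\<close>, with dual elements \<open>w * b ^ i\<close>, are independent copies of
  \<open>w\<close>, so \<open>no_infinite_copies\<close> makes it vanish.\<close>

lemma directly_finite: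
  assumes "b * a = (1 :: 'r)"
  shows "a * b = 1"
proof -
  define w where "w = 1 - a * b"
  have bw: "b * w = 0" and wa: "w * a = 0"
    using assms by (simp_all add: w_def algebra_simps flip: mult.assoc) (simp add: mult.assoc assms)
  have ww: "w * w = w" using wa by (simp add: w_def algebra_simps flip: mult.assoc)
  have pow: "b ^ i * a ^ i = 1" for i
  proof (induction i)
    case (Suc i)
    have "b ^ Suc i * a ^ Suc i = b ^ i * (b * a) * a ^ i"
      by (simp only: power_Suc2[of b] power_Suc[of a] mult.assoc)
    then show ?case using Suc assms by simp
  qed simp
  have "w = 0"
  proof (rule no_infinite_copies)
    fix i j
    show "(w * b ^ i) * (a ^ j * w) = (if i = j then w else 0)"
    proof (cases i j rule: linorder_cases)
      case less
      then obtain k where "j = i + Suc k" using less_iff_Suc_add by auto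
      then have "(w * b ^ i) * (a ^ j * w) = w * (b ^ i * a ^ i) * (a * a ^ k) * w"
        by (simp only: power_add power_Suc mult.assoc power_commutes)
      then show ?thesis using wa less pow by (simp flip: mult.assoc)
    next
      case equal
      have "(w * b ^ i) * (a ^ i * w) = w * (b ^ i * a ^ i) * w" by (simp add: mult.assoc)
      then show ?thesis using pow ww equal by simp
    next
      case greater
      then obtain k where "i = j + Suc k" using less_iff_Suc_add by auto
      then have "i = Suc k + j" by simp
      then have "(w * b ^ i) * (a ^ j * w) = w * b ^ Suc k * (b ^ j * a ^ j) * w"
        by (simp only: power_add mult.assoc)
      also have "\<dots> = w * b ^ k * (b * w)" by (simp only: pow power_Suc2 mult.assoc mult_1_left)
      finally show ?thesis using bw greater by simp
    qed
  next
    show "a ^ j * w * w = a ^ j * w" for j using ww by (simp add: mult.assoc)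
  qed
  then show ?thesis by (simp add: w_def)
qed

lemma injective_unit:
  assumes "\<And>r. c * r = 0 \<Longrightarrow> r = (0 :: 'r)"
  obtains d where "c * d = 1" "d * c = 1"
proof -
  obtain d where "c * d * c = c" using regular by blast
  then have "c * (d * c - 1) = 0" by (simp add: algebra_simps)
  then have "d * c = 1" using assms by fastforce
  then show ?thesis using that directly_finite by blast
qed

text \<open>The element is read off the complement of \<open>(1 - p) R\<close> that is the join of the graphs of the
  \<open>X k\<close>, the isomorphism \<open>\<beta>\<close> serving to make room for these graphs.\<close>

lemma glue:
  fixes p \<beta> \<beta>' :: 'r
  assumes p: "p * p = p" and \<beta>: "\<beta>' * \<beta> = p" "\<beta> * \<beta>' = 1 - p" "\<beta> * p = \<beta>" "p * \<beta>' = \<beta>'"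
    and E: "\<And>k. E k \<in> PR" "\<And>k. E k \<subseteq> E (Suc k)" "\<And>k s. s \<in> E k \<Longrightarrow> p * s = s"
    and X: "\<And>k s. s \<in> E k \<Longrightarrow> p * (X k * s) = X k * s"
      "\<And>k s. s \<in> E k \<Longrightarrow> X (Suc k) * s = X k * s"
    and dense: "p \<in> rcl (\<Union>(range E))"
  obtains x where "p * x = x" "x * p = x" "\<And>k s. s \<in> E k \<Longrightarrow> x * s = X k * s"
proof -
  define q where "q = 1 - p"
  have p\<beta>: "p * \<beta> = 0"
  proof -
    have "p * \<beta> = p * (\<beta> * \<beta>') * \<beta>" using \<beta>(1,3) by (simp add: mult.assoc)
    then show ?thesis using p \<beta>(2) by (simp add: right_diff_distrib)
  qed
  \<comment> \<open>The graph of \<open>X k\<close> over \<open>E k\<close>: the first coordinate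
    lies in \<open>p R\<close>, the second is moved by \<open>\<beta>\<close> into
    \<open>(1 - p) R\<close>.\<close>
  define G where "G k = {(p + \<beta> * X k) * s | s. s \<in> E k}" for k
  have G_PR: "G k \<in> PR" for k unfolding G_def by (rule left_multiples_PR[OF E(1)])
  have G_Suc: "G k \<subseteq> G (Suc k)" for k
  proof
    fix g assume "g \<in> G k"
    then obtain s where s: "g = (p + \<beta> * X k) * s" "s \<in> E k" unfolding G_def by blast
    then have "g = (p + \<beta> * X (Suc k)) * s" using X(2) by (simp add: distrib_right mult.assoc)
    then show "g \<in> G (Suc k)" unfolding G_def using s E(2) by blast
  qed
  have G_mono: "G m \<subseteq> G n" if "m \<le> n" for m n 
    by (rule lift_Suc_mono_le[of G, OF G_Suc that])
  define \<Gamma> where "\<Gamma> = rcl (\<Union>(range G))"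
  have \<Gamma>: "\<Gamma> \<in> PR" by (simp only: \<Gamma>_def rcl_PR)
  define Q where "Q = principal_right_ideal q"
  have Q: "Q \<in> PR" by (simp add: Q_def)
  have disj: "Q \<inter> \<Gamma> = {0}"
    unfolding \<Gamma>_def
  proof (rule upper_continuous[OF Q])
    fix F assume "F \<in> range G"
    then obtain k where F: "F = G k" by blast
    have "r = 0" if r: "r \<in> Q" "r \<in> G k" for r
    proof -
      obtain s where s: "r = (p + \<beta> * X k) * s" "s \<in> E k" using r(2) unfolding G_def by blast
      have "p * r = 0" using r(1) p unfolding Q_def principal_right_ideal_iff q_def
        by (auto simp: right_diff_distrib simp flip: mult.assoc)
      moreover have "p * r = s"
        using p p\<beta> E(3)[OF s(2)] unfolding s(1) by (simp add: distrib_left distrib_right flip: mult.assoc)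
      ultimately show ?thesis using s by simp
    qed
    then show "Q \<inter> F = {0}" using F PR_closed(1)[OF Q] PR_closed(1)[OF G_PR] by blast
  next
    show "F \<subseteq> F' \<or> F' \<subseteq> F" if "F \<in> range G" "F' \<in> range G" for F F'
      using that G_mono by (metis imageE nat_le_linear)
  qed (use G_PR in blast)
  have \<beta>Q: "\<beta> * t \<in> Q" for t
  proof -
    have "\<beta> = q * \<beta>" unfolding q_def using p\<beta> by (simp add: left_diff_distrib)
    then have "\<beta> * t = q * (\<beta> * t)" by (metis mult.assoc)
    then show ?thesis unfolding Q_def principal_right_ideal_iff by blast
  qed
  have graph: "s + \<beta> * (X k * s) \<in> \<Gamma>" if s: "s \<in> E k" for k s
  proof -
    have "s + \<beta> * (X k * s) = (p + \<beta> * X k) * s"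
      using E(3)[OF s] by (simp add: distrib_right mult.assoc)
    then have "s + \<beta> * (X k * s) \<in> G k" unfolding G_def using s by blast
    then show ?thesis unfolding \<Gamma>_def using subset_rcl[of "\<Union>(range G)"] by blast
  qed
  have "rcl (\<Union>(range E)) \<subseteq> rsum \<Gamma> Q"
  proof (rule rcl_least[OF rsum_PR[OF \<Gamma> Q]])
    show "\<Union>(range E) \<subseteq> rsum \<Gamma> Q"
    proof
      fix s assume "s \<in> \<Union>(range E)"
      then obtain k where k: "s \<in> E k" by blast
      have "s = (s + \<beta> * (X k * s)) + - (\<beta> * (X k * s))" by simp
      then show "s \<in> rsum \<Gamma> Q"
        using graph[OF k] PR_closed(4)[OF Q \<beta>Q] unfolding rsum_def by blast
    qed
  qed
  with dense have "p \<in> rsum \<Gamma> Q" by blast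
  then obtain g r where g: "p = g + q * r" "g \<in> \<Gamma>"
    unfolding rsum_def Q_def by (auto simp: principal_right_ideal_iff)
  \<comment> \<open>\<open>g = p - q * r\<close> is a point of \<open>\<Gamma>\<close> over
    \<open>p\<close>; \<open>\<beta>'\<close> carries its second coordinate back to
    \<open>p R\<close>, and the factor \<open>p\<close> on the right puts \<open>x\<close> into the
    corner.\<close>
  define x where "x = - (\<beta>' * (q * r) * p)"
  have \<beta>q: "\<beta> * \<beta>' * q = q" using \<beta>(2) p by (simp add: q_def left_diff_distrib right_diff_distrib)
  have "\<beta> * x = - (q * r * p)"
    unfolding x_def using \<beta>q by (simp flip: mult.assoc)
  moreover have "p = g * p + q * r * p"
    using arg_cong[OF g(1), of "\<lambda>z. z * p"] p by (simp add: distrib_right)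
  ultimately have "p + \<beta> * x = g * p" by (metis add_diff_cancel_right' diff_conv_add_uminus)
  then have x\<Gamma>: "p + \<beta> * x \<in> \<Gamma>" using PR_closed(5)[OF \<Gamma> g(2)] by simp
  have px: "p * x = x" unfolding x_def using \<beta>(4) by (simp flip: mult.assoc)
  have xp: "x * p = x" unfolding x_def using p by (simp add: mult.assoc)
  \<comment> \<open>Two points of \<open>\<Gamma>\<close> over the same \<open>s\<close> differ by
    an element of \<open>Q\<close>, hence agree.\<close>
  have "x * s = X k * s" if s: "s \<in> E k" for k s
  proof -
    have "(p + \<beta> * x) * s = s + \<beta> * (x * s)" using E(3)[OF s] by (simp add: distrib_right mult.assoc)
    then have "s + \<beta> * (x * s) \<in> \<Gamma>" using PR_closed(5)[OF \<Gamma> x\<Gamma>] by metis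
    from PR_closed(3)[OF \<Gamma> this graph[OF s]]
    have "\<beta> * (x * s - X k * s) \<in> \<Gamma>" by (simp add: right_diff_distrib)
    then have "\<beta> * (x * s - X k * s) = 0" using \<beta>Q disj by blast
    then have "\<beta>' * \<beta> * (x * s - X k * s) = 0" by (simp add: mult.assoc)
    then show ?thesis
      using \<beta>(1) px X(1)[OF s] by (simp add: right_diff_distrib flip: mult.assoc)
  qed
  then show ?thesis using that px xp by blast
qed

end

section \<open>Halving idempotents\<close>

lemma idempotent_principal_iff: "e * e = e \<Longrightarrow> r \<in> principal_right_ideal e \<longleftrightarrow> e * r = r"
  by (auto simp: principal_right_ideal_iff simp flip: mult.assoc) metis

section \<open>Triples of mutually complementary ideals\<close>

datatype axis = Ax1 | Ax2 | Ax3

text \<open>Each of \<open>T Ax1\<close>, \<open>T Ax2\<close>, \<open>T Ax3\<close> is a relative complement of the other two in their common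
  join. The third is the graph of an isomorphism between the first two, and the symmetric
  formulation makes joins of chains of such triples unproblematic.\<close>

definition triple :: "'r::ring_1 set \<Rightarrow> (axis \<Rightarrow> 'r set) \<Rightarrow> bool"
  where "triple J T \<longleftrightarrow> (\<forall>i. T i \<in> PR \<and> T i \<subseteq> J) \<and> (\<forall>i j. i \<noteq> j \<longrightarrow> T i \<inter> T j = {0}) \<and>
    (\<forall>i j k. i \<noteq> j \<and> j \<noteq> k \<and> i \<noteq> k \<longrightarrow> T i \<subseteq> rcl (T j \<union> T k))"

context continuous_ring
begin

lemma tripleD:
  assumes "triple J T"
  shows "T i \<in> PR" "T i \<subseteq> J" "i \<noteq> j \<Longrightarrow> T i \<inter> T j = {0}"
    "i \<noteq> j \<Longrightarrow> j \<noteq> k \<Longrightarrow> i \<noteq> k \<Longrightarrow> T i \<subseteq> rcl (T j \<union> T k)"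
  using assms unfolding triple_def by blast+

text \<open>Two members of the chain are compared inside the larger one. Independence of the joins
  then takes upper continuity twice: first one \<open>S i\<close> against the join of the
  \<open>T j\<close>, then that join against the join in the other coordinate.\<close>

lemma triple_chain:
  assumes J: "J \<in> (PR :: 'r set set)" and C: "\<And>T. T \<in> C \<Longrightarrow> triple J T"
    and chain: "\<And>S T. S \<in> C \<Longrightarrow> T \<in> C \<Longrightarrow> S \<le> T \<or> T \<le> S"
  shows "triple J (\<lambda>i. rcl (\<Union>T\<in>C. T i))"
  unfolding triple_def
proof (intro conjI allI impI)
  fix i
  show "rcl (\<Union>T\<in>C. T i) \<in> PR" by (rule rcl_PR)
  show "rcl (\<Union>T\<in>C. T i) \<subseteq> J" using tripleD(2)[OF C] by (intro rcl_least[OF J]) blast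
next
  fix i j :: axis assume ij: "i \<noteq> j"
  have chain': "E \<subseteq> F \<or> F \<subseteq> E" if EF: "E \<in> (\<lambda>T. T k) ` C" "F \<in> (\<lambda>T. T k) ` C" for E F k
  proof -
    obtain S T where "E = S k" "F = T k" "S \<in> C" "T \<in> C" using EF by blast
    then show ?thesis using chain[of S T] by (auto simp: le_fun_def)
  qed
  have sub: "(\<lambda>T. T k) ` C \<subseteq> PR" for k using tripleD(1)[OF C] by blast
  have 1: "S i \<inter> T j = {0}" if "S \<in> C" "T \<in> C" for S T
  proof -
    have "S i \<inter> T j \<subseteq> T i \<inter> T j \<or> S i \<inter> T j \<subseteq> S i \<inter> S j"
      using chain[OF that] by (auto simp: le_fun_def)
    then have "S i \<inter> T j \<subseteq> {0}" using tripleD(3)[OF C ij] that by metis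
    then show ?thesis using PR_closed(1)[OF tripleD(1)[OF C]] that by blast
  qed
  have 2: "S i \<inter> rcl (\<Union>((\<lambda>T. T j) ` C)) = {0}" if "S \<in> C" for S
    by (rule upper_continuous[OF tripleD(1)[OF C[OF that]] sub chain']) (use 1 that in auto)
  have "rcl (\<Union>T\<in>C. T j) \<inter> rcl (\<Union>((\<lambda>T. T i) ` C)) = {0}"
    by (rule upper_continuous[OF rcl_PR sub chain']) (use 2 in auto)
  then show "rcl (\<Union>T\<in>C. T i) \<inter> rcl (\<Union>T\<in>C. T j) = {0}" by (simp add: Int_commute)
next
  fix i j k :: axis assume ijk: "i \<noteq> j \<and> j \<noteq> k \<and> i \<noteq> k"
  show "rcl (\<Union>T\<in>C. T i) \<subseteq> rcl (rcl (\<Union>T\<in>C. T j) \<union> rcl (\<Union>T\<in>C. T k))"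
  proof (intro rcl_least[OF rcl_PR] UN_least)
    fix T assume T: "T \<in> C"
    then have "T i \<subseteq> rcl (T j \<union> T k)" using tripleD(4)[OF C] ijk by blast
    also have "\<dots> \<subseteq> rcl (rcl (\<Union>T\<in>C. T j) \<union> rcl (\<Union>T\<in>C. T k))"
      using T subset_rcl[of "\<Union>T\<in>C. T j"] subset_rcl[of "\<Union>T\<in>C. T k"] by (intro rcl_mono) blast
    finally show "T i \<subseteq> rcl (rcl (\<Union>T\<in>C. T j) \<union> rcl (\<Union>T\<in>C. T k))" .
  qed
qed

text \<open>The join of all of \<open>S\<close> is already that of its first two coordinates, and it
  is independent of \<open>J'\<close>. So an equation between sums of an \<open>S\<close> part and a
  \<open>T\<close> part splits into its two parts.\<close>

lemma triple_join:
  assumes J: "J \<in> (PR :: 'r set set)" and S: "triple J S" and T: "triple J' T"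
    and J': "J' \<in> PR" "J' \<subseteq> J" and disj: "rcl (S Ax1 \<union> S Ax2) \<inter> J' = {0}"
  shows "triple J (\<lambda>i. rcl (S i \<union> T i))"
  unfolding triple_def
proof (intro conjI allI impI)
  fix i
  show "rcl (S i \<union> T i) \<in> PR" by (rule rcl_PR)
  show "rcl (S i \<union> T i) \<subseteq> J" using tripleD(2)[OF S] tripleD(2)[OF T] J' by (intro rcl_least[OF J]) blast
next
  fix i j :: axis assume ij: "i \<noteq> j"
  have M: "S k \<subseteq> rcl (S Ax1 \<union> S Ax2)" for k
    using tripleD(4)[OF S, of Ax3 Ax1 Ax2] subset_rcl[of "S Ax1 \<union> S Ax2"] by (cases k) auto
  have "x = 0" if x: "x \<in> rcl (S i \<union> T i)" "x \<in> rcl (S j \<union> T j)" for x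
  proof -
    obtain s t where st: "x = s + t" "s \<in> S i" "t \<in> T i"
      using x(1) unfolding rcl_Un[OF tripleD(1)[OF S] tripleD(1)[OF T]] rsum_def by blast
    obtain s' t' where st': "x = s' + t'" "s' \<in> S j" "t' \<in> T j"
      using x(2) unfolding rcl_Un[OF tripleD(1)[OF S] tripleD(1)[OF T]] rsum_def by blast
    have eq: "s - s' = t' - t" using st(1) st'(1) by (metis add_diff_cancel_left' add_diff_eq diff_add_cancel diff_diff_eq2)
    have "s - s' \<in> rcl (S Ax1 \<union> S Ax2)" using st st' M PR_closed(3)[OF rcl_PR] by blast
    moreover have "t' - t \<in> J'" using st st' tripleD(2)[OF T] PR_closed(3)[OF J'(1)] by blast
    ultimately have "s - s' = 0" "t' - t = 0" using disj eq by (metis IntI singletonD)+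
    then have "s \<in> S i \<inter> S j" "t \<in> T i \<inter> T j" using st st' by auto
    then show "x = 0" using tripleD(3)[OF S ij] tripleD(3)[OF T ij] st by auto
  qed
  then show "rcl (S i \<union> T i) \<inter> rcl (S j \<union> T j) = {0}"
    using PR_closed(1)[OF rcl_PR] by blast
next
  fix i j k :: axis assume ijk: "i \<noteq> j \<and> j \<noteq> k \<and> i \<noteq> k"
  have "S i \<subseteq> rcl (S j \<union> S k)" "T i \<subseteq> rcl (T j \<union> T k)"
    using tripleD(4)[OF S] tripleD(4)[OF T] ijk by blast+
  moreover have "rcl (S j \<union> S k) \<subseteq> rcl (rcl (S j \<union> T j) \<union> rcl (S k \<union> T k))"
      "rcl (T j \<union> T k) \<subseteq> rcl (rcl (S j \<union> T j) \<union> rcl (S k \<union> T k))"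
    using subset_rcl[of "S j \<union> T j"] subset_rcl[of "S k \<union> T k"] by (intro rcl_mono; blast)+
  ultimately show "rcl (S i \<union> T i) \<subseteq> rcl (rcl (S j \<union> T j) \<union> rcl (S k \<union> T k))"
    by (intro rcl_least[OF rcl_PR]) blast
qed

text \<open>An idempotent \<open>x\<close> that does not commute with some \<open>y\<close> yields a
  nonzero \<open>a = f * z * g\<close> between orthogonal idempotents. It has a copy
  \<open>b\<close> in \<open>g R\<close> with the same right annihilator, and \<open>a + b\<close>
  generates the graph of the isomorphism from \<open>a R\<close> to \<open>b R\<close>.\<close>

lemma triple_of_nonabelian:
  assumes w: "w * w = w" and nonab: "\<not> abelian_idempotent (w :: 'r)"
  obtains T where "triple (principal_right_ideal w) T" "T Ax1 \<noteq> {0}"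
proof -
  obtain x y where x: "x \<in> corner w" "x * x = x" and y: "y \<in> corner w" and xy: "x * y \<noteq> y * x"
    using w nonab unfolding abelian_idempotent_def by blast
  have wx: "w * x = x" "x * w = x" and wy: "w * y = y" "y * w = y"
    using x(1) y w unfolding corner_def by (auto simp: mult.assoc) (auto simp: mult.assoc[symmetric])
  \<comment> \<open>One of the blocks \<open>x * y * (w - x)\<close> and
    \<open>(w - x) * y * x\<close> is nonzero: if both vanished, then
    \<open>x * y = x * y * x = y * x\<close>.\<close>
  have "\<exists>f g z. f * g = 0 \<and> g * f = 0 \<and> f * f = f \<and> g * g = g \<and> w * f = f \<and> w * g = g \<and> f * z * g \<noteq> 0"
  proof (cases "x * y * (w - x) = 0")
    case True
    moreover have "x * y * w = x * y" using wy by (simp add: mult.assoc)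
    ultimately have "x * y = x * y * x" by (simp add: right_diff_distrib)
    then have "(w - x) * y * x = y * x - x * y" using wy by (simp add: left_diff_distrib)
    then have "(w - x) * y * x \<noteq> 0" using xy by simp
    then show ?thesis using x(2) wx w
      by (intro exI[of _ "w - x"] exI[of _ x] exI[of _ y]) (simp add: left_diff_distrib right_diff_distrib)
  next
    case False
    then show ?thesis using x(2) wx w
      by (intro exI[of _ "w - x"] exI[of _ x] exI[of _ y]) (simp add: left_diff_distrib right_diff_distrib)
  qed
  then obtain f g z where fg: "f * g = 0" "g * f = 0" "f * f = f" "g * g = g" "w * f = f" "w * g = g"
    "f * z * g \<noteq> 0" by blast
  define a where "a = f * z * g"
  have fa: "f * a = a" using fg(3) by (simp add: a_def flip: mult.assoc)
  have ag: "a * g = a" using fg(4) by (simp add: a_def mult.assoc)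
  obtain c where c: "a * c * a = a" using regular by blast
  \<comment> \<open>Since \<open>a * g = a\<close> and \<open>a * c * a = a\<close>, this gives
    \<open>a * b = a\<close>; so \<open>a\<close> and \<open>b\<close> have the same right
    annihilator, while \<open>b\<close> lies in \<open>g R\<close>.\<close>
  define b where "b = g * c * a"
  have ab: "a * b = a" using c ag by (simp add: b_def flip: mult.assoc)
  have gb: "g * b = b" using fg by (simp add: b_def flip: mult.assoc)
  have bg: "f * b = 0" "g * a = 0" using fg(1,2) gb fa by (metis mult.assoc mult_zero_left)+
  have zero_iff: "a * t = 0 \<longleftrightarrow> b * t = 0" for t
    using ab by (metis b_def mult.assoc mult_zero_right)
  have eq: "a * s = 0 \<and> b * t = 0" if "a * s = b * t" for s t
  proof -
    have "a * s = f * (b * t)" using that fa by (metis mult.assoc)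
    then have "a * s = 0" using bg by (simp flip: mult.assoc)
    then show ?thesis using that by simp
  qed
  define T where "T = case_axis (principal_right_ideal a) (principal_right_ideal b) (principal_right_ideal (a + b))"
  have T: "T Ax1 = principal_right_ideal a" "T Ax2 = principal_right_ideal b"
    "T Ax3 = principal_right_ideal (a + b)" by (simp_all add: T_def)
  have T_PR: "T i \<in> PR" for i by (cases i) (simp_all add: T)
  have disj: "T Ax1 \<inter> T Ax2 = {0}" "T Ax1 \<inter> T Ax3 = {0}" "T Ax2 \<inter> T Ax3 = {0}"
  proof -
    have "r = 0" if "r \<in> T Ax1" "r \<in> T Ax2" for r
      using that eq unfolding T principal_right_ideal_iff by metis
    moreover have "r = 0" if r: "r \<in> T Ax1" "r \<in> T Ax3" for r
    proof -
      obtain s t where st: "r = a * s" "r = (a + b) * t" using r unfolding T principal_right_ideal_iff by blast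
      then have "a * (s - t) = b * t" by (simp add: algebra_simps)
      then have "b * t = 0" "a * t = 0" using eq zero_iff by metis+
      then show ?thesis using st by (simp add: distrib_right)
    qed
    moreover have "r = 0" if r: "r \<in> T Ax2" "r \<in> T Ax3" for r
    proof -
      obtain s t where st: "r = b * s" "r = (a + b) * t" using r unfolding T principal_right_ideal_iff by blast
      then have "a * t = b * (s - t)" by (simp add: algebra_simps)
      then have "b * t = 0" "a * t = 0" using eq zero_iff by metis+
      then show ?thesis using st by (simp add: distrib_right)
    qed
    ultimately show "T Ax1 \<inter> T Ax2 = {0}" "T Ax1 \<inter> T Ax3 = {0}" "T Ax2 \<inter> T Ax3 = {0}"
      using PR_closed(1)[OF T_PR] by blast+
  qed
  have in_rcl: "x \<in> rcl (T j \<union> T k)" if "x = y + z \<or> x = y - z" "y \<in> T j" "z \<in> T k" for x y z j k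
    using that subset_rcl[of "T j \<union> T k"] PR_closed(2,3)[OF rcl_PR[of "T j \<union> T k"]] by blast
  have sub: "T i \<subseteq> rcl (T j \<union> T k)" if "i \<noteq> j" "j \<noteq> k" "i \<noteq> k" for i j k
  proof -
    have "a \<in> T Ax1" "b \<in> T Ax2" "a + b \<in> T Ax3" unfolding T by (rule self_in_principal)+
    then have "a \<in> rcl (T Ax3 \<union> T Ax2)" "b \<in> rcl (T Ax3 \<union> T Ax1)" "a + b \<in> rcl (T Ax1 \<union> T Ax2)"
      using in_rcl[of a "a + b" b Ax3 Ax2] in_rcl[of b "a + b" a Ax3 Ax1] in_rcl[of "a + b" a b Ax1 Ax2]
      by simp_all
    then have "T Ax1 \<subseteq> rcl (T Ax3 \<union> T Ax2)" "T Ax2 \<subseteq> rcl (T Ax3 \<union> T Ax1)" "T Ax3 \<subseteq> rcl (T Ax1 \<union> T Ax2)"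
      using principal_subset_iff[OF rcl_PR] T by metis+
    then show ?thesis using that by (cases i; cases j; cases k) (simp_all add: Un_commute)
  qed
  have "triple (principal_right_ideal w) T"
    unfolding triple_def
  proof (intro conjI allI impI)
    fix i j k :: axis
    show "T i \<in> PR" by (rule T_PR)
    have "w * a = a" "w * b = b" using fg(5,6) fa gb by (metis mult.assoc)+
    then have "a = w * a" "b = w * b" "a + b = w * (a + b)" by (simp_all add: distrib_left)
    then have "a \<in> principal_right_ideal w" "b \<in> principal_right_ideal w" "a + b \<in> principal_right_ideal w"
      unfolding principal_right_ideal_iff by blast+
    then show "T i \<subseteq> principal_right_ideal w" by (cases i) (simp_all add: T principal_subset_iff)
    show "T i \<inter> T j = {0}" if "i \<noteq> j" using that disj by (cases i; cases j) (auto simp: Int_commute)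
    show "T i \<subseteq> rcl (T j \<union> T k)" if "i \<noteq> j \<and> j \<noteq> k \<and> i \<noteq> k" using that sub by blast
  qed
  moreover have "T Ax1 \<noteq> {0}" using fg(7) self_in_principal[of a] unfolding T a_def by blast
  ultimately show ?thesis using that by blast
qed

text \<open>A triple maximal for coordinatewise inclusion must fill \<open>e R\<close>: a nonzero
  complement \<open>w\<close> is not abelian, so it contains a further nonzero triple, which
  \<open>triple_join\<close> would add.\<close>

lemma triple_full:
  assumes no_abelian: "\<And>w :: 'r. abelian_idempotent w \<Longrightarrow> w = 0" and e: "e * e = (e :: 'r)"
  obtains T where "triple (principal_right_ideal e) T" "rcl (T Ax1 \<union> T Ax2) = principal_right_ideal e"
proof -
  let ?J = "principal_right_ideal e"
  let ?A = "{T. triple ?J T}"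
  have J: "?J \<in> PR" by simp
  have "\<exists>m\<in>?A. \<forall>a\<in>?A. m \<le> a \<longrightarrow> a = m"
  proof (rule predicate_Zorn)
    show "partial_order_on ?A (relation_of (\<le>) ?A)"
      unfolding partial_order_on_def preorder_on_def refl_on_def trans_def antisym_def relation_of_def by auto
    fix C assume C: "C \<in> Chains (relation_of (\<le>) ?A)"
    then have "triple ?J T" if "T \<in> C" for T using that Chains_relation_of by blast
    moreover have "S \<le> T \<or> T \<le> S" if "S \<in> C" "T \<in> C" for S T
      using C that unfolding Chains_def relation_of_def by blast
    ultimately have "triple ?J (\<lambda>i. rcl (\<Union>T\<in>C. T i))" by (rule triple_chain[OF J])
    moreover have "T \<le> (\<lambda>i. rcl (\<Union>T\<in>C. T i))" if "T \<in> C" for T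
    proof (rule le_funI)
      show "T i \<subseteq> rcl (\<Union>T\<in>C. T i)" for i using that subset_rcl[of "\<Union>T\<in>C. T i"] by blast
    qed
    ultimately show "\<exists>u\<in>?A. \<forall>a\<in>C. a \<le> u" by blast
  qed
  then obtain S where S: "triple ?J S" and max: "\<And>T. triple ?J T \<Longrightarrow> S \<le> T \<Longrightarrow> T = S" by blast
  let ?M = "rcl (S Ax1 \<union> S Ax2)"
  have MJ: "?M \<subseteq> ?J" using tripleD(2)[OF S] by (intro rcl_least[OF J]) blast
  obtain g where g: "g * g = g" "g \<in> ?M" "?M = {r. g * r = r}"
    using rcl_PR[of "S Ax1 \<union> S Ax2"] by (rule idempotent_generator)
  have eg: "e * g = g" using g(2) MJ idempotent_principal_iff[OF e] by blast
  \<comment> \<open>Only \<open>e * g = g\<close> is known, so \<open>e - g\<close> need not be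
    idempotent; \<open>e - g * e\<close> is.\<close>
  define w where "w = e - g * e"
  have gw: "g * w = 0" using g(1) by (simp add: w_def right_diff_distrib flip: mult.assoc)
  have ww: "w * w = w"
  proof -
    have ew: "e * w = w" using e eg by (simp add: w_def right_diff_distrib flip: mult.assoc)
    have "w * w = e * w - g * (e * w)" by (simp add: w_def left_diff_distrib mult.assoc)
    then show ?thesis using ew gw by simp
  qed
  have "w = 0"
  proof (rule ccontr)
    assume "w \<noteq> 0"
    then have "\<not> abelian_idempotent w" using no_abelian by blast
    from triple_of_nonabelian[OF ww this]
    obtain T where T: "triple (principal_right_ideal w) T" "T Ax1 \<noteq> {0}" by blast
    have "w = e * w" using e eg by (simp add: w_def right_diff_distrib flip: mult.assoc)
    then have "w \<in> ?J" unfolding principal_right_ideal_iff by blast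
    then have wJ: "principal_right_ideal w \<subseteq> ?J" by (simp add: principal_subset_iff)
    have "r = 0" if r: "r \<in> ?M" "r \<in> principal_right_ideal w" for r
    proof -
      obtain t where "r = w * t" using r(2) unfolding principal_right_ideal_iff by blast
      then have "g * r = 0" using gw by (simp flip: mult.assoc)
      then show ?thesis using r(1) g(3) by simp
    qed
    then have disj: "?M \<inter> principal_right_ideal w = {0}"
      using PR_closed(1)[OF rcl_PR] PR_closed(1)[OF rangeI] by blast
    have "triple ?J (\<lambda>i. rcl (S i \<union> T i))"
      by (rule triple_join[OF J S T(1) rangeI wJ disj])
    moreover have "S \<le> (\<lambda>i. rcl (S i \<union> T i))"
    proof (rule le_funI)
      show "S i \<subseteq> rcl (S i \<union> T i)" for i using subset_rcl[of "S i \<union> T i"] by blast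
    qed
    ultimately have "(\<lambda>i. rcl (S i \<union> T i)) = S" by (rule max)
    then have "T Ax1 \<subseteq> S Ax1" using subset_rcl[of "S Ax1 \<union> T Ax1"] by (metis Un_subset_iff)
    then have "T Ax1 \<subseteq> ?M" using subset_rcl[of "S Ax1 \<union> S Ax2"] by blast
    then have "T Ax1 \<subseteq> {0}" using disj tripleD(2)[OF T(1)] by blast
    then show False using T(2) PR_closed(1)[OF tripleD(1)[OF T(1)]] by blast
  qed
  then have "e \<in> ?M" unfolding g(3) w_def by simp
  then have "?M = ?J" using MJ principal_subset_iff[OF rcl_PR] by blast
  then show ?thesis using that S by blast
qed

text \<open>Writing \<open>e = f + g\<close> along the first two coordinates gives the two halves.
  The third coordinate is the graph of an isomorphism between them, from which
  \<open>\<beta>\<close> and \<open>\<beta>'\<close> are read off.\<close>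

lemma halving:
  assumes no_abelian: "\<And>w :: 'r. abelian_idempotent w \<Longrightarrow> w = 0" and e: "e * e = (e :: 'r)"
  obtains f \<beta> \<beta>' where "f * f = f" "e * f = f" "f * e = f"
    "\<beta>' * \<beta> = f" "\<beta> * \<beta>' = e - f" "\<beta> * f = \<beta>" "f * \<beta>' = \<beta>'"
proof -
  obtain T where T: "triple (principal_right_ideal e) T"
    and full: "rcl (T Ax1 \<union> T Ax2) = principal_right_ideal e"
    using triple_full[OF no_abelian e] by blast
  note PRs = tripleD(1)[OF T]
  have zero: "x = 0" if "i \<noteq> j" "x \<in> T i" "x \<in> T j" for x i j
    using tripleD(3)[OF T that(1)] that by blast
  have sumE: "\<exists>y z. x = y + z \<and> y \<in> T j \<and> z \<in> T k" if "x \<in> rcl (T j \<union> T k)" for x j k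
    using that unfolding rcl_Un[OF PRs PRs] rsum_def by blast
  have left_e: "e * x = x" if "x \<in> T i" for x i
    using tripleD(2)[OF T, of i] that idempotent_principal_iff[OF e] by blast
  obtain f g where fg: "e = f + g" "f \<in> T Ax1" "g \<in> T Ax2"
    using sumE[of e Ax1 Ax2] full self_in_principal[of e] by blast
  have proj: "f * x = x \<and> g * x = 0" if x: "x \<in> T Ax1" for x
  proof -
    have "g * x = x - f * x" using left_e[OF x] fg(1) by (simp add: distrib_right eq_diff_eq add.commute)
    moreover have "x - f * x \<in> T Ax1" "g * x \<in> T Ax2"
      using PR_closed(3,5)[OF PRs] x fg by blast+
    ultimately have "g * x = 0" using zero[of Ax1 Ax2 "g * x"] by simp
    then show ?thesis using left_e[OF x] fg(1) by (simp add: distrib_right)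
  qed
  have proj': "g * x = x" if x: "x \<in> T Ax2" for x
  proof -
    have "f * x = x - g * x" using left_e[OF x] fg(1) by (simp add: distrib_right eq_diff_eq)
    moreover have "x - g * x \<in> T Ax2" "f * x \<in> T Ax1"
      using PR_closed(3,5)[OF PRs] x fg by blast+
    ultimately have "f * x = 0" using zero[of Ax1 Ax2 "f * x"] by simp
    then show ?thesis using left_e[OF x] fg(1) by (simp add: distrib_right)
  qed
  have ff: "f * f = f" and gg: "g * g = g" using proj[OF fg(2)] proj'[OF fg(3)] by auto
  have gf: "g * f = 0" using proj[OF fg(2)] by blast
  have "f * g = 0"
    using proj'[OF fg(3)] left_e[OF fg(3)] fg(1) by (simp add: distrib_right)
  then have ef: "e * f = f" "f * e = f" using fg(1) ff left_e[OF fg(2)] by (simp_all add: distrib_left)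
  \<comment> \<open>The two splittings single out the point \<open>f - g1\<close> of the graph over
    \<open>f\<close> and the point \<open>g - f1\<close> over \<open>g\<close>, whence the signs in
    \<open>\<beta>\<close> and \<open>\<beta>'\<close>.\<close>
  obtain h g1 where h: "f = h + g1" "h \<in> T Ax3" "g1 \<in> T Ax2"
    using sumE[of f Ax3 Ax2] tripleD(4)[OF T, of Ax1 Ax3 Ax2] fg(2) by auto
  obtain h' f1 where h': "g = h' + f1" "h' \<in> T Ax3" "f1 \<in> T Ax1"
    using sumE[of g Ax3 Ax1] tripleD(4)[OF T, of Ax2 Ax3 Ax1] fg(3) by auto
  define \<beta> \<beta>' where "\<beta> = - (g1 * f)" and "\<beta>' = - (f1 * g)"
  have \<beta>f: "\<beta> * f = \<beta>" using ff by (simp add: \<beta>_def mult.assoc)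
  have f\<beta>': "f * \<beta>' = \<beta>'" using proj[OF h'(3)] by (simp add: \<beta>'_def flip: mult.assoc)
  have \<beta>T: "\<beta> * x \<in> T Ax2" and \<beta>'T: "\<beta>' * x \<in> T Ax1" for x
    unfolding \<beta>_def \<beta>'_def using h(3) h'(3) PR_closed(4,5)[OF PRs] by (simp_all add: mult.assoc)
  have "f + \<beta> = h * f" "g + \<beta>' = h' * g"
    unfolding \<beta>_def \<beta>'_def using arg_cong[OF h(1), of "\<lambda>z. z * f"] arg_cong[OF h'(1), of "\<lambda>z. z * g"] ff gg
    by (simp_all add: distrib_right) (metis add_diff_cancel_right')+
  then have H: "f + \<beta> \<in> T Ax3" "g + \<beta>' \<in> T Ax3" using h(2) h'(2) PR_closed(5)[OF PRs] by simp_all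
  \<comment> \<open>In this combination the components in \<open>T Ax1\<close> cancel, leaving
    \<open>g - \<beta> * \<beta>'\<close> in two independent ideals. The other product is treated
    symmetrically.\<close>
  have "(g + \<beta>') - (f + \<beta>) * \<beta>' \<in> T Ax3" using H PR_closed(3,5)[OF PRs] by blast
  then have "g - \<beta> * \<beta>' \<in> T Ax3" using f\<beta>' by (simp add: distrib_right)
  moreover have "g - \<beta> * \<beta>' \<in> T Ax2" using fg(3) \<beta>T PR_closed(3)[OF PRs] by blast
  ultimately have "\<beta> * \<beta>' = g" using zero[of Ax3 Ax2] by (metis axis.distinct(5) eq_iff_diff_eq_0)
  have g\<beta>: "g * \<beta> = \<beta>" using proj'[OF \<beta>T[of 1]] by simp
  have "(f + \<beta>) - (g + \<beta>') * \<beta> \<in> T Ax3" using H PR_closed(3,5)[OF PRs] by blast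
  then have "f - \<beta>' * \<beta> \<in> T Ax3" using g\<beta> by (simp add: distrib_right)
  moreover have "f - \<beta>' * \<beta> \<in> T Ax1" using fg(2) \<beta>'T PR_closed(3)[OF PRs] by blast
  ultimately have "\<beta>' * \<beta> = f" using zero[of Ax3 Ax1] by (metis axis.distinct(3) eq_iff_diff_eq_0)
  moreover have "\<beta> * \<beta>' = e - f" using \<open>\<beta> * \<beta>' = g\<close> fg(1) by simp
  ultimately show ?thesis using that ff ef \<beta>f f\<beta>' by blast
qed

end

section \<open>Towers of matrix units\<close>

lemma sum_lessThan_add:
  "(\<Sum>i<n + m. g i) = (\<Sum>i<n. g i) + (\<Sum>i<m. g (n + i) :: 'a::comm_monoid_add)" for n m :: nat
  by (induction m) (simp_all add: add.assoc)

text \<open>Each \<open>f k\<close> splits into \<open>f (Suc k)\<close> and an equivalent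
  complement; left multiplication by \<open>\<beta> k\<close> carries \<open>f (Suc k) R\<close>
  onto the right ideal of that complement.\<close>

locale dyadic_tower = continuous_ring R
  for R :: "'r::ring_1 itself" +
  fixes f \<beta> \<beta>' :: "nat \<Rightarrow> 'r"
  assumes f_idem: "f k * f k = f k"
    and f_Suc: "f k * f (Suc k) = f (Suc k)" "f (Suc k) * f k = f (Suc k)"
    and \<beta>: "\<beta>' k * \<beta> k = f (Suc k)" "\<beta> k * \<beta>' k = f k - f (Suc k)"
      "\<beta> k * f (Suc k) = \<beta> k" "f (Suc k) * \<beta>' k = \<beta>' k"
begin

lemma \<beta>_eqs: "f (Suc k) * \<beta> k = 0" "f k * \<beta> k = \<beta> k" "\<beta>' k * f (Suc k) = 0" "\<beta>' k * f k = \<beta>' k"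
proof -
  have b: "(f k - f (Suc k)) * \<beta> k = \<beta> k"
    unfolding \<beta>(2)[symmetric] by (simp add: mult.assoc \<beta>(1,3))
  have b': "\<beta>' k * (f k - f (Suc k)) = \<beta>' k"
    unfolding \<beta>(2)[symmetric] by (simp add: \<beta>(1,4) flip: mult.assoc)
  have e: "f (Suc k) * (f k - f (Suc k)) = 0" "f k * (f k - f (Suc k)) = f k - f (Suc k)"
      "(f k - f (Suc k)) * f (Suc k) = 0" "(f k - f (Suc k)) * f k = f k - f (Suc k)"
    using f_idem[of k] f_idem[of "Suc k"] f_Suc[of k] by (simp_all add: left_diff_distrib right_diff_distrib)
  have "f (Suc k) * \<beta> k = f (Suc k) * (f k - f (Suc k)) * \<beta> k" "f k * \<beta> k = f k * (f k - f (Suc k)) * \<beta> k"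
    "\<beta>' k * f (Suc k) = \<beta>' k * ((f k - f (Suc k)) * f (Suc k))" "\<beta>' k * f k = \<beta>' k * ((f k - f (Suc k)) * f k)"
    by (simp_all only: mult.assoc b) (simp_all only: mult.assoc[symmetric] b')
  then show "f (Suc k) * \<beta> k = 0" "f k * \<beta> k = \<beta> k" "\<beta>' k * f (Suc k) = 0" "\<beta>' k * f k = \<beta>' k"
    by (simp_all only: e b b' mult_zero_left mult_zero_right)
qed

text \<open>The products \<open>col k i * row k j\<close> are the matrix units of size
  \<open>2 ^ k\<close> for the corner of \<open>f 0\<close>. Passing to the next level splits block
  \<open>i\<close> into the blocks \<open>i\<close> and \<open>i + 2 ^ k\<close>.\<close>

primrec col :: "nat \<Rightarrow> nat \<Rightarrow> 'r"
  where "col 0 i = f 0"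
  | "col (Suc k) i = (if i < 2 ^ k then col k i * f (Suc k) else col k (i - 2 ^ k) * \<beta> k)"

primrec row :: "nat \<Rightarrow> nat \<Rightarrow> 'r"
  where "row 0 i = f 0"
  | "row (Suc k) i = (if i < 2 ^ k then f (Suc k) * row k i else \<beta>' k * row k (i - 2 ^ k))"

lemma col_f: "col k i * f k = col k i"
  by (cases k) (simp_all add: f_idem \<beta> mult.assoc)

lemma f_row: "f k * row k i = row k i"
  by (cases k) (simp_all add: f_idem \<beta> flip: mult.assoc)

lemma f0_col: "f 0 * col k i = col k i"
  by (induction k arbitrary: i) (simp_all add: f_idem flip: mult.assoc)

lemma row_col: "i < 2 ^ k \<Longrightarrow> j < 2 ^ k \<Longrightarrow> row k i * col k j = (if i = j then f k else 0)"
proof (induction k arbitrary: i j)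
  case 0
  then show ?case by (simp add: f_idem)
next
  case (Suc k)
  have mid: "x * row k i * (col k j * y) = (if i = j then x * f k * y else 0)"
    if "i < 2 ^ k" "j < 2 ^ k" for x y i j
  proof -
    have "x * row k i * (col k j * y) = x * (row k i * col k j) * y" by (simp only: mult.assoc)
    then show ?thesis by (simp add: Suc.IH[OF that])
  qed
  have lt: "i - 2 ^ k < 2 ^ k" "j - 2 ^ k < 2 ^ k" using Suc.prems by auto
  show ?case
  proof (cases "i < 2 ^ k"; cases "j < 2 ^ k")
    assume "i < 2 ^ k" "j < 2 ^ k"
    then show ?thesis using f_Suc f_idem by (simp add: mid)
  next
    assume ij: "i < 2 ^ k" "\<not> j < 2 ^ k"
    then have "row (Suc k) i * col (Suc k) j = (if i = j - 2 ^ k then f (Suc k) * f k * \<beta> k else 0)"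
      using mid[OF ij(1) lt(2)] by simp
    then show ?thesis using ij f_Suc \<beta>_eqs by auto
  next
    assume ij: "\<not> i < 2 ^ k" "j < 2 ^ k"
    then have "row (Suc k) i * col (Suc k) j = (if i - 2 ^ k = j then \<beta>' k * f k * f (Suc k) else 0)"
      using mid[OF lt(1) ij(2)] by simp
    then show ?thesis using ij \<beta>_eqs by auto
  next
    assume ij: "\<not> i < 2 ^ k" "\<not> j < 2 ^ k"
    then have "row (Suc k) i * col (Suc k) j = (if i - 2 ^ k = j - 2 ^ k then \<beta>' k * f k * \<beta> k else 0)"
      using mid[OF lt] by simp
    moreover have "i - 2 ^ k = j - 2 ^ k \<longleftrightarrow> i = j" using ij by auto
    ultimately show ?thesis using \<beta>_eqs \<beta> by (simp add: mult.assoc)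
  qed
qed

lemma sum_col_row: "(\<Sum>i<2 ^ k. col k i * row k i) = f 0"
proof (induction k)
  case 0
  show ?case by (simp add: f_idem)
next
  case (Suc k)
  have "(\<Sum>i<2 ^ Suc k. col (Suc k) i * row (Suc k) i) =
      (\<Sum>i<2 ^ k. col k i * f (Suc k) * (f (Suc k) * row k i)) + (\<Sum>i<2 ^ k. col k i * \<beta> k * (\<beta>' k * row k i))"
    by (simp add: mult_2 sum_lessThan_add)
  also have "\<dots> = (\<Sum>i<2 ^ k. col k i * row k i)"
    unfolding sum.distrib[symmetric]
  proof (rule sum.cong)
    fix i
    have "col k i * f (Suc k) * (f (Suc k) * row k i) + col k i * \<beta> k * (\<beta>' k * row k i) =
        col k i * (f (Suc k) * f (Suc k) + \<beta> k * \<beta>' k) * row k i"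
      by (simp add: algebra_simps)
    then show "col k i * f (Suc k) * (f (Suc k) * row k i) + col k i * \<beta> k * (\<beta>' k * row k i) =
        col k i * row k i"
      by (simp add: f_idem \<beta> col_f)
  qed simp
  finally show ?case using Suc by simp
qed

lemma mod_power_diff:
  fixes j :: nat
  assumes "k \<le> l" "2 ^ l \<le> j"
  shows "(j - 2 ^ l) mod 2 ^ k = j mod 2 ^ k"
proof -
  obtain c where c: "(2 :: nat) ^ l = 2 ^ k * c" using le_imp_power_dvd[OF assms(1)] by (auto simp: dvd_def)
  have "(j - 2 ^ l + 2 ^ k * c) mod 2 ^ k = (j - 2 ^ l) mod 2 ^ k" by simp
  then show ?thesis using assms(2) unfolding c[symmetric] by simp
qed

text \<open>Refinement only adds higher binary digits, so block \<open>j\<close> at level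
  \<open>l\<close> lies inside the block at level \<open>k\<close> whose index consists of the
  lowest \<open>k\<close> digits of \<open>j\<close>.\<close>

lemma col_factor: "k \<le> l \<Longrightarrow> j < 2 ^ l \<Longrightarrow> \<exists>z. col l j = col k (j mod 2 ^ k) * z"
proof (induction l arbitrary: j rule: dec_induct)
  case base
  then show ?case by (intro exI[of _ 1]) simp
next
  case (step l)
  show ?case
  proof (cases "j < 2 ^ l")
    case True
    then obtain z where "col l j = col k (j mod 2 ^ k) * z" using step.IH by blast
    then show ?thesis using True by (auto simp: mult.assoc)
  next
    case False
    then have "j - 2 ^ l < 2 ^ l" using step.prems by simp
    then obtain z where "col l (j - 2 ^ l) = col k ((j - 2 ^ l) mod 2 ^ k) * z" using step.IH by blast
    moreover have "(j - 2 ^ l) mod 2 ^ k = j mod 2 ^ k"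
      using False step.hyps(1) by (simp add: mod_power_diff)
    ultimately show ?thesis using False by (auto simp: mult.assoc)
  qed
qed

lemma row_factor: "k \<le> l \<Longrightarrow> j < 2 ^ l \<Longrightarrow> \<exists>z. row l j = z * row k (j mod 2 ^ k)"
proof (induction l arbitrary: j rule: dec_induct)
  case base
  then show ?case by (intro exI[of _ 1]) simp
next
  case (step l)
  show ?case
  proof (cases "j < 2 ^ l")
    case True
    then obtain z where "row l j = z * row k (j mod 2 ^ k)" using step.IH by blast
    then show ?thesis using True by (auto simp flip: mult.assoc)
  next
    case False
    then have "j - 2 ^ l < 2 ^ l" using step.prems by simp
    then obtain z where "row l (j - 2 ^ l) = z * row k ((j - 2 ^ l) mod 2 ^ k)" using step.IH by blast
    moreover have "(j - 2 ^ l) mod 2 ^ k = j mod 2 ^ k"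
      using False step.hyps(1) by (simp add: mod_power_diff)
    ultimately show ?thesis using False by (auto simp flip: mult.assoc)
  qed
qed

lemma row_col_mod:
  assumes "k \<le> l" "i < 2 ^ k" "j < 2 ^ l" "j mod 2 ^ k \<noteq> i"
  shows "row k i * col l j = 0" "row l j * col k i = 0"
proof -
  have m: "j mod 2 ^ k < 2 ^ k" by simp
  obtain z where "col l j = col k (j mod 2 ^ k) * z" using col_factor assms by blast
  then show "row k i * col l j = 0" using row_col[OF assms(2) m] assms(4) by (simp flip: mult.assoc)
  obtain z where "row l j = z * row k (j mod 2 ^ k)" using row_factor assms by blast
  then show "row l j * col k i = 0" using row_col[OF m assms(2)] assms(4) by (simp add: mult.assoc)
qed

text \<open>The copies of \<open>w\<close> at successive scales are kept independent by placing those at scale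
  \<open>n j\<close> in the columns whose index is \<open>-1\<close> modulo \<open>2 ^ n j\<close>, but not modulo the next scale.\<close>

lemma small_idempotent_zero:
  assumes ww: "w * w = w"
    and small: "\<And>j. \<exists>k>j. \<exists>m<(2 :: nat) ^ (k - j). \<exists>g h. w = (\<Sum>s<m. g s * f k * h s)"
  shows "w = 0"
proof -
  obtain K M G H where K: "\<And>j. j < K j" and M: "\<And>j. M j < (2 :: nat) ^ (K j - j)"
    and w: "\<And>j. w = (\<Sum>s<M j. G j s * f (K j) * H j s)"
  proof -
    have "\<forall>j. \<exists>k m g h. j < k \<and> m < (2 :: nat) ^ (k - j) \<and> w = (\<Sum>s<m. g s * f k * h s)"
      using small by blast
    then show ?thesis using that unfolding choice_iff by blast
  qed
  \<comment> \<open>The hypothesis \<open>small\<close>, taken at \<open>n j\<close>, supplies an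
    expression of \<open>w\<close> at level \<open>n (Suc j)\<close> with few terms.\<close>
  define n where "n = rec_nat 0 (\<lambda>_. K)"
  have n_Suc: "n (Suc j) = K (n j)" for j by (simp add: n_def)
  have n_less: "n j < n (Suc j)" for j using K n_Suc by simp
  have n_mono: "n i \<le> n j" if "i \<le> j" for i j
    using that n_less by (metis lift_Suc_mono_le less_imp_le)
  define \<sigma> :: "nat \<Rightarrow> nat \<Rightarrow> nat" where "\<sigma> j s = 2 ^ n j * s + (2 ^ n j - 1)" for j s
  \<comment> \<open>Since \<open>s + 1 < 2 ^ (n (Suc j) - n j)\<close>, the last index
    \<open>2 ^ n (Suc j) - 1\<close> is left out. It is the residue reserved for all later scales,
    as \<open>\<sigma>_mod\<close> shows.\<close>
  have \<sigma>_bound: "\<sigma> j s < 2 ^ n (Suc j) - 1" if "s < M (n j)" for j s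
  proof -
    have "s + 1 < 2 ^ (n (Suc j) - n j)" using that M[of "n j"] n_Suc by simp
    then have "2 ^ n j * (s + 2) \<le> 2 ^ n j * (2 :: nat) ^ (n (Suc j) - n j)" by (intro mult_left_mono) auto
    also have "\<dots> = 2 ^ n (Suc j)" using n_less[of j] by (simp flip: power_add)
    finally have "2 ^ n j * s + 2 * 2 ^ n j \<le> 2 ^ n (Suc j)" by (simp add: algebra_simps)
    moreover have "(2 :: nat) ^ n j > 0" by simp
    ultimately show ?thesis unfolding \<sigma>_def by linarith
  qed
  have \<sigma>_bound': "\<sigma> j s < 2 ^ n (Suc j)" if "s < M (n j)" for j s
    using \<sigma>_bound[OF that] by simp
  have \<sigma>_mod: "\<sigma> j s mod 2 ^ n (Suc i) = 2 ^ n (Suc i) - 1" if ij: "i < j" for i j s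
  proof -
    obtain d where d: "n j = n (Suc i) + d" using le_Suc_ex[OF n_mono[OF Suc_leI[OF ij]]] by blast
    obtain c where c: "(2 :: nat) ^ d = Suc c" using gr0_implies_Suc[of "2 ^ d"] by auto
    have *: "a * Suc c * s + (a * Suc c - 1) = a * (Suc c * s + c) + (a - 1)" if "a > 0" for a :: nat
      using that by (cases a) (simp_all add: algebra_simps)
    have "\<sigma> j s = 2 ^ n (Suc i) * (Suc c * s + c) + (2 ^ n (Suc i) - 1)"
      unfolding \<sigma>_def d power_add c by (rule *) simp
    also have "\<dots> mod 2 ^ n (Suc i) = (2 ^ n (Suc i) - 1) mod 2 ^ n (Suc i)"
      by (rule mod_mult_self4)
    finally show ?thesis by simp
  qed
  have \<sigma>_inj: "\<sigma> j s = \<sigma> j t \<longleftrightarrow> s = t" for j s t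
    by (simp only: \<sigma>_def add_right_cancel mult_cancel1) simp
  \<comment> \<open>\<open>\<gamma> j\<close> distributes the right factors of the expression of
    \<open>w\<close> over the columns \<open>\<sigma> j t\<close>, and \<open>\<delta> j\<close>
    reads them off and restores the left factors; for equal indices the product returns
    \<open>w\<close>.\<close>
  define \<gamma> where "\<gamma> j = (\<Sum>t<M (n j). col (n (Suc j)) (\<sigma> j t) * H (n j) t * w)" for j
  define \<delta> where "\<delta> j = (\<Sum>s<M (n j). w * G (n j) s * row (n (Suc j)) (\<sigma> j s))" for j
  have \<delta>\<gamma>: "\<delta> i * \<gamma> j = (\<Sum>s<M (n i). \<Sum>t<M (n j).
      w * G (n i) s * (row (n (Suc i)) (\<sigma> i s) * col (n (Suc j)) (\<sigma> j t)) * H (n j) t * w)" for i j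
    unfolding \<gamma>_def \<delta>_def sum_product by (simp add: mult.assoc)
  show ?thesis
  proof (rule no_infinite_copies)
    fix i j
    show "\<delta> i * \<gamma> j = (if i = j then w else 0)"
    proof (cases i j rule: linorder_cases)
      case less
      have "row (n (Suc i)) (\<sigma> i s) * col (n (Suc j)) (\<sigma> j t) = 0" if "s < M (n i)" "t < M (n j)" for s t
        using less n_mono[of "Suc i" "Suc j"] \<sigma>_bound[OF that(1)] \<sigma>_bound'[OF that(1)] \<sigma>_bound'[OF that(2)] \<sigma>_mod[OF less, of t]
        by (intro row_col_mod(1)) auto
      then show ?thesis unfolding \<delta>\<gamma> using less by simp
    next
      case greater
      have "row (n (Suc i)) (\<sigma> i s) * col (n (Suc j)) (\<sigma> j t) = 0" if "s < M (n i)" "t < M (n j)" for s t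
        using greater n_mono[of "Suc j" "Suc i"] \<sigma>_bound[OF that(2)] \<sigma>_bound'[OF that(1)] \<sigma>_bound'[OF that(2)] \<sigma>_mod[OF greater, of s]
        by (intro row_col_mod(2)) auto
      then show ?thesis unfolding \<delta>\<gamma> using greater by simp
    next
      case equal
      have "\<delta> j * \<gamma> j = (\<Sum>s<M (n j). \<Sum>t<M (n j).
          if s = t then w * G (n j) s * f (n (Suc j)) * H (n j) s * w else 0)"
        unfolding \<delta>\<gamma> using \<sigma>_inj by (intro sum.cong) (auto simp: row_col \<sigma>_bound')
      also have "\<dots> = w * (\<Sum>s<M (n j). G (n j) s * f (K (n j)) * H (n j) s) * w"
        by (simp add: sum_distrib_left sum_distrib_right n_Suc mult.assoc)
      also have "\<dots> = w" using w[of "n j"] ww by simp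
      finally show ?thesis using equal by simp
    qed
  next
    show "\<gamma> j * w = \<gamma> j" for j unfolding \<gamma>_def using ww by (simp add: sum_distrib_right mult.assoc)
  qed
qed

end

lemma (in continuous_ring) dyadic_tower_exists:
  assumes no_abelian: "\<And>w :: 'r. abelian_idempotent w \<Longrightarrow> w = 0" and p: "p * p = (p :: 'r)"
  obtains f \<beta> \<beta>' where "dyadic_tower R f \<beta> \<beta>'" "f 0 = p"
proof -
  have "\<forall>e :: 'r. \<exists>f \<beta> \<beta>'. e * e = e \<longrightarrow> f * f = f \<and> e * f = f \<and> f * e = f \<and>
      \<beta>' * \<beta> = f \<and> \<beta> * \<beta>' = e - f \<and> \<beta> * f = \<beta> \<and> f * \<beta>' = \<beta>'"
  proof
    fix e :: 'r
    show "\<exists>f \<beta> \<beta>'. e * e = e \<longrightarrow> f * f = f \<and> e * f = f \<and> f * e = f \<and>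
      \<beta>' * \<beta> = f \<and> \<beta> * \<beta>' = e - f \<and> \<beta> * f = \<beta> \<and> f * \<beta>' = \<beta>'"
    proof (cases "e * e = e")
      case True
      show ?thesis by (rule halving[OF no_abelian True]) blast+
    qed simp
  qed
  then obtain F B B' where FB: "\<And>e :: 'r. e * e = e \<Longrightarrow> F e * F e = F e \<and> e * F e = F e \<and> F e * e = F e \<and>
      B' e * B e = F e \<and> B e * B' e = e - F e \<and> B e * F e = B e \<and> F e * B' e = B' e"
    unfolding choice_iff by blast
  have idem: "(F ^^ k) p * (F ^^ k) p = (F ^^ k) p" for k
    by (induction k) (simp_all add: p FB)
  have "dyadic_tower R (\<lambda>k. (F ^^ k) p) (\<lambda>k. B ((F ^^ k) p)) (\<lambda>k. B' ((F ^^ k) p))"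
    by unfold_locales (use FB[OF idem] idem in simp_all)
  then show ?thesis using that by force
qed

section \<open>Algebras exhausted by tiles\<close>

text \<open>The recursion doubles exactly as that of \<open>col\<close>: the factor
  \<open>c k\<close> on the algebra side plays the role of \<open>\<beta> k\<close>.\<close>

primrec tile_basis :: "(nat \<Rightarrow> 'a::ring_1) \<Rightarrow> nat \<Rightarrow> nat \<Rightarrow> 'a"
  where "tile_basis c 0 i = 1"
  | "tile_basis c (Suc k) i = (if i < 2 ^ k then tile_basis c k i else tile_basis c k (i - 2 ^ k) * c k)"

lemma (in unital_algebra) tile_span_Suc:
  assumes "v \<in> span (tile_basis c k ` {..<2 ^ k})"
  shows "v \<in> span (tile_basis c (Suc k) ` {..<2 ^ Suc k})"
    and "v * c k \<in> span (tile_basis c (Suc k) ` {..<2 ^ Suc k})"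
proof -
  let ?T = "span (tile_basis c (Suc k) ` {..<2 ^ Suc k})"
  have "v \<in> ?T \<and> v * c k \<in> ?T"
    using assms
  proof (induction rule: span_induct_alt)
    case base
    show ?case by (simp add: span_zero)
  next
    case (step d x y)
    then obtain i where i: "x = tile_basis c k i" "i < 2 ^ k" by auto
    have *: "tile_basis c (Suc k) j \<in> ?T" if "j < 2 ^ Suc k" for j
      using that by (intro span_base imageI) simp
    have "x \<in> ?T" "x * c k \<in> ?T" using *[of i] *[of "i + 2 ^ k"] i by simp_all
    then show ?case using step.IH by (simp add: distrib_right span_add span_scale flip: scale_mult_left)
  qed
  then show "v \<in> ?T" "v * c k \<in> ?T" by auto
qed

text \<open>The last assumption is of Folner type: for finite \<open>F\<close> and any
  \<open>j\<close>, in some tile, of dimension \<open>2 ^ k\<close>, the vectors kept in the tile by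
  \<open>F\<close> have codimension below \<open>2 ^ (k - j)\<close>.\<close>

locale tiled_algebra = unital_algebra scale
  for scale :: "'k::field \<Rightarrow> 'a::ring_1 \<Rightarrow> 'a" +
  fixes c :: "nat \<Rightarrow> 'a"
  assumes tile_inj: "inj_on (tile_basis c k) {..<2 ^ k}"
    and tile_independent: "independent (tile_basis c k ` {..<2 ^ k})"
    and tile_growth: "finite F \<Longrightarrow> \<exists>k>j. \<exists>S. finite S \<and> card S < 2 ^ (k - j) \<and>
      span (tile_basis c k ` {..<2 ^ k}) \<subseteq> span ({v \<in> span (tile_basis c k ` {..<2 ^ k}).
        \<forall>a\<in>F. a * v \<in> span (tile_basis c k ` {..<2 ^ k})} \<union> S)"
begin

abbreviation tile :: "nat \<Rightarrow> 'a set"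
  where "tile k \<equiv> span (tile_basis c k ` {..<2 ^ k})"

definition tile_dom :: "nat \<Rightarrow> 'a set \<Rightarrow> 'a set"
  where "tile_dom k F = {v \<in> tile k. \<forall>a\<in>F. a * v \<in> tile k}"

lemma tile_basis_in: "i < 2 ^ k \<Longrightarrow> tile_basis c k i \<in> tile k"
  by (intro span_base) simp

lemma tile_Suc:
  assumes "v \<in> tile k"
  shows "v \<in> tile (Suc k)" "v * c k \<in> tile (Suc k)"
  using tile_span_Suc[OF assms] .

lemma tile_dom_Suc:
  assumes "v \<in> tile_dom k F"
  shows "v \<in> tile_dom (Suc k) F" "v * c k \<in> tile_dom (Suc k) F"
  using assms tile_Suc unfolding tile_dom_def by (auto simp flip: mult.assoc)

lemma linear_left_mult: "Vector_Spaces.linear scale scale ((*) a)"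
  by unfold_locales (simp_all add: distrib_left scale_mult_right)

end

text \<open>\<open>b\<close> and \<open>b'\<close> identify the half \<open>f 0\<close>, which
  carries the tower, with the half \<open>1 - f 0\<close>, which serves as room for the graphs in
  \<open>glue\<close>.\<close>

locale tiled_tower = dyadic_tower R f \<beta> \<beta>' + A: tiled_algebra scaleA c + V: unital_algebra scale
  for R :: "'r::ring_1 itself" and f \<beta> \<beta>'
    and scaleA :: "'k::field \<Rightarrow> 'a::ring_1 \<Rightarrow> 'a" and c
    and scale :: "'k \<Rightarrow> 'r \<Rightarrow> 'r" +
  fixes b b' :: 'r
  assumes b: "b' * b = f 0" "b * b' = 1 - f 0" "b * f 0 = b" "f 0 * b' = b'"
begin

section \<open>Embedding the tiles\<close>

sublocale pair: vector_space_pair scaleA scale ..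

sublocale pairA: vector_space_pair scaleA scaleA ..

lemma embed_ex:
  "\<exists>g. Vector_Spaces.linear scaleA scale g \<and> (\<forall>i<2 ^ k. g (tile_basis c k i) = col k i) \<and>
    (\<forall>v. f 0 * g v = g v) \<and> (\<forall>v. g v * f k = g v)"
proof -
  obtain g where g: "Vector_Spaces.linear scaleA scale g"
    "\<forall>x\<in>tile_basis c k ` {..<2 ^ k}. g x = col k (the_inv_into {..<2 ^ k} (tile_basis c k) x)"
    using pair.linear_independent_extend[OF A.tile_independent[of k],
        where f = "\<lambda>x. col k (the_inv_into {..<2 ^ k} (tile_basis c k) x)"] by blast
  interpret g: Vector_Spaces.linear scaleA scale g by fact
  \<comment> \<open>Off the tile the linear extension is arbitrary; the factors \<open>f 0\<close>
    and \<open>f k\<close> enforce the two corner identities for every \<open>v\<close>.\<close>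
  have "Vector_Spaces.linear scaleA scale (\<lambda>v. f 0 * g v * f k)"
    by unfold_locales (simp_all add: g.add g.scale distrib_left distrib_right
        flip: V.scale_mult_left V.scale_mult_right)
  moreover have "f 0 * g (tile_basis c k i) * f k = col k i" if "i < 2 ^ k" for i
    using g(2) that the_inv_into_f_f[OF A.tile_inj[of k], of i] by (simp add: f0_col col_f)
  moreover have "f 0 * (f 0 * g v * f k) = f 0 * g v * f k" "f 0 * g v * f k * f k = f 0 * g v * f k" for v
    by (simp_all add: f_idem mult.assoc) (simp add: f_idem flip: mult.assoc)
  ultimately show ?thesis by (intro exI[of _ "\<lambda>v. f 0 * g v * f k"]) blast
qed

definition embed :: "nat \<Rightarrow> 'a \<Rightarrow> 'r"
  where "embed k = (SOME g. Vector_Spaces.linear scaleA scale g \<and>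
    (\<forall>i<2 ^ k. g (tile_basis c k i) = col k i) \<and> (\<forall>v. f 0 * g v = g v) \<and> (\<forall>v. g v * f k = g v))"

lemma embed:
  shows linear_embed: "Vector_Spaces.linear scaleA scale (embed k)"
    and embed_basis: "i < 2 ^ k \<Longrightarrow> embed k (tile_basis c k i) = col k i"
    and f0_embed: "f 0 * embed k v = embed k v"
    and embed_f: "embed k v * f k = embed k v"
  using someI_ex[OF embed_ex[of k]] unfolding embed_def[symmetric] by blast+

sublocale embed: Vector_Spaces.linear scaleA scale "embed k" for k
  by (rule linear_embed)

lemma embed_Suc:
  assumes "v \<in> A.tile k"
  shows "embed (Suc k) v = embed k v * f (Suc k)" "embed (Suc k) (v * c k) = embed k v * \<beta> k"
proof -
  have "embed (Suc k) v = embed k v * f (Suc k) \<and> embed (Suc k) (v * c k) = embed k v * \<beta> k"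
    using assms
  proof (induction rule: A.span_induct_alt)
    case base
    show ?case by (simp add: embed.zero)
  next
    case (step d x y)
    then obtain i where i: "x = tile_basis c k i" "i < 2 ^ k" by auto
    have "embed (Suc k) x = embed k x * f (Suc k)"
      using embed_basis[of i "Suc k"] embed_basis[of i k] i by simp
    moreover have "embed (Suc k) (x * c k) = embed k x * \<beta> k"
      using embed_basis[of "i + 2 ^ k" "Suc k"] embed_basis[of i k] i by simp
    ultimately show ?case using step.IH
      by (simp add: distrib_right embed.add embed.scale V.scale_mult_left flip: A.scale_mult_left)
  qed
  then show "embed (Suc k) v = embed k v * f (Suc k)" "embed (Suc k) (v * c k) = embed k v * \<beta> k"
    by auto
qed

text \<open>Compatibility of levels: \<open>f k = f (Suc k) + \<beta> k * \<beta>' k\<close> splits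
  the copy of \<open>v\<close> into those of \<open>v\<close> and \<open>v * c k\<close> one level
  up.\<close>

lemma embed_split:
  assumes "v \<in> A.tile k"
  shows "embed k v = embed (Suc k) v + embed (Suc k) (v * c k) * \<beta>' k"
proof -
  have "embed k v = embed k v * (f (Suc k) + \<beta> k * \<beta>' k)" by (simp add: \<beta> embed_f)
  then show ?thesis using embed_Suc[OF assms] by (simp add: distrib_left mult.assoc)
qed

text \<open>The matrix of \<open>g\<close> on tile \<open>k\<close>. Where \<open>g\<close> leaves
  the tile the value depends on the choice of \<open>embed k\<close>, so it is applied to vectors
  whose image stays inside.\<close>

definition truncate :: "nat \<Rightarrow> ('a \<Rightarrow> 'a) \<Rightarrow> 'r"
  where "truncate k g = (\<Sum>j<2 ^ k. embed k (g (tile_basis c k j)) * row k j)"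

lemma truncate_embed:
  assumes g: "Vector_Spaces.linear scaleA scaleA g" and v: "v \<in> A.tile k"
  shows "truncate k g * embed k v = embed k (g v)"
proof -
  interpret g: Vector_Spaces.linear scaleA scaleA g by fact
  show ?thesis
    using v
  proof (induction rule: A.span_induct_alt)
    case base
    show ?case by (simp add: embed.zero g.zero)
  next
    case (step d x y)
    then obtain i where i: "x = tile_basis c k i" "i < 2 ^ k" by auto
    have "truncate k g * embed k x = (\<Sum>j<2 ^ k. if j = i then embed k (g x) * f k else 0)"
      unfolding truncate_def sum_distrib_right i(1) embed_basis[OF i(2)]
      using i by (intro sum.cong) (auto simp: mult.assoc row_col)
    then have "truncate k g * embed k x = embed k (g x)" using i(2) by (simp add: embed_f)
    then show ?case using step.IH
      by (simp add: distrib_left embed.add embed.scale g.add g.scale flip: V.scale_mult_right)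
  qed
qed

section \<open>Domains of left multiplication and their density\<close>

definition dom :: "nat \<Rightarrow> 'a set \<Rightarrow> 'r set"
  where "dom k F = rcl (embed k ` A.tile_dom k F)"

lemma dom_PR: "dom k F \<in> PR"
  by (simp only: dom_def rcl_PR)

lemma embed_in_dom: "v \<in> A.tile_dom k F \<Longrightarrow> embed k v \<in> dom k F"
  unfolding dom_def using subset_rcl by blast

text \<open>The condition on \<open>F\<close> passes from \<open>v\<close> to
  \<open>v * c k\<close>, because left and right multiplication commute; \<open>embed_split\<close>
  then rewrites each generator one level up.\<close>

lemma dom_Suc: "dom k F \<subseteq> dom (Suc k) F"
  unfolding dom_def[of k]
proof (rule rcl_least[OF dom_PR], safe)
  fix v assume v: "v \<in> A.tile_dom k F"
  then have "v \<in> A.tile k" by (simp add: A.tile_dom_def)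
  then show "embed k v \<in> dom (Suc k) F"
    using embed_in_dom[OF A.tile_dom_Suc(1)[OF v]] embed_in_dom[OF A.tile_dom_Suc(2)[OF v]]
    by (simp only: embed_split) (intro PR_closed(2,5)[OF dom_PR])
qed

lemma dom_mono: "k \<le> l \<Longrightarrow> dom k F \<subseteq> dom l F"
  by (rule lift_Suc_mono_le[of "\<lambda>k. dom k F", OF dom_Suc])

lemma f0_dom: "s \<in> dom k F \<Longrightarrow> f 0 * s = s"
  unfolding dom_def by (erule rcl_closed_1) (auto simp: f0_embed)

text \<open>A complementary idempotent \<open>w\<close> annihilates the domains, so at each scale it factors through
  the few basis vectors outside the domain.\<close>

lemma dom_dense:
  assumes F: "finite F"
  shows "f 0 \<in> rcl (\<Union>k. dom k F)"
proof -
  let ?E = "rcl (\<Union>k. dom k F)"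
  obtain e where e: "e * e = e" "e \<in> ?E" "?E = {r. e * r = r}"
    using rcl_PR[of "\<Union>k. dom k F"] by (rule idempotent_generator)
  have f0e: "f 0 * e = e" by (rule rcl_closed_1[OF e(2)]) (use f0_dom in blast)
  define w where "w = f 0 - e * f 0"
  have w_dom: "w * embed k v = 0" if "v \<in> A.tile_dom k F" for k v
  proof -
    have "embed k v \<in> ?E" using embed_in_dom[OF that] subset_rcl[of "\<Union>k. dom k F"] by blast
    then have "e * embed k v = embed k v" using e(3) by blast
    then show ?thesis unfolding w_def by (simp add: left_diff_distrib mult.assoc f0_embed)
  qed
  have ew: "e * w = 0" unfolding w_def using e(1) by (simp add: right_diff_distrib flip: mult.assoc)
  have f0w: "f 0 * w = w" unfolding w_def using f0e f_idem by (simp add: right_diff_distrib flip: mult.assoc)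
  have ww: "w * w = w"
  proof -
    have "w * w = f 0 * w - e * (f 0 * w)" by (simp add: w_def left_diff_distrib mult.assoc)
    then show ?thesis using ew f0w by simp
  qed
  have wf0: "w * f 0 = w" unfolding w_def using f_idem by (simp add: left_diff_distrib mult.assoc)
  have "w = 0"
  proof (rule small_idempotent_zero[OF ww])
    fix j
    obtain k S where k: "k > j" and S: "finite S" "card S < 2 ^ (k - j)"
      "A.tile k \<subseteq> A.span (A.tile_dom k F \<union> S)"
      using A.tile_growth[OF F, of j] unfolding A.tile_dom_def by blast
    have "\<exists>u x. tile_basis c k i = u + (\<Sum>s\<in>S. scaleA (x s) s) \<and> w * embed k u = 0" if i: "i < 2 ^ k" for i
    proof -
      have "tile_basis c k i \<in> A.span (A.tile_dom k F \<union> S)" using A.tile_basis_in[OF i] S(3) by blast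
      then obtain u t where ut: "tile_basis c k i = u + t" "u \<in> A.span (A.tile_dom k F)" "t \<in> A.span S"
        unfolding A.span_Un by blast
      have "w * embed k u = 0"
        using ut(2)
      proof (induction rule: A.span_induct_alt)
        case base
        show ?case by (simp add: embed.zero)
      next
        case (step d x y)
        then show ?case using w_dom
          by (simp add: distrib_left embed.add embed.scale flip: V.scale_mult_right)
      qed
      moreover obtain x where "t = (\<Sum>s\<in>S. scaleA (x s) s)"
        using ut(3) unfolding A.span_finite[OF S(1)] by blast
      ultimately show ?thesis using ut(1) by blast
    qed
    then obtain u x where ux: "\<And>i. i < 2 ^ k \<Longrightarrow> tile_basis c k i = u i + (\<Sum>s\<in>S. scaleA (x i s) s)"
      "\<And>i. i < 2 ^ k \<Longrightarrow> w * embed k (u i) = 0" by metis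
    \<comment> \<open>Modulo vectors killed by \<open>w\<close>, each basis vector is a combination
      of \<open>S\<close>. Collecting the coefficients by elements of \<open>S\<close> expresses
      \<open>w\<close> through \<open>f k\<close> with only \<open>card S\<close> terms, as
      \<open>small_idempotent_zero\<close> demands.\<close>
    define h where "h s = (\<Sum>i<2 ^ k. scale (x i s) (row k i))" for s
    have fh: "f k * h s = h s" for s
      unfolding h_def by (simp add: sum_distrib_left f_row flip: V.scale_mult_right)
    have "w = (\<Sum>i<2 ^ k. w * col k i * row k i)"
      using wf0 unfolding sum_col_row[of k, symmetric] by (simp add: sum_distrib_left mult.assoc)
    also have "\<dots> = (\<Sum>i<2 ^ k. \<Sum>s\<in>S. w * embed k s * scale (x i s) (row k i))"
    proof (rule sum.cong)
      fix i assume "i \<in> {..<(2 :: nat) ^ k}"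
      then have i: "i < 2 ^ k" by simp
      have "w * col k i = w * embed k (\<Sum>s\<in>S. scaleA (x i s) s)"
        unfolding embed_basis[OF i, symmetric] ux(1)[OF i] embed.add distrib_left ux(2)[OF i] by simp
      also have "\<dots> = (\<Sum>s\<in>S. scale (x i s) (w * embed k s))"
        by (simp add: embed.sum embed.scale sum_distrib_left flip: V.scale_mult_right)
      finally show "w * col k i * row k i = (\<Sum>s\<in>S. w * embed k s * scale (x i s) (row k i))"
        by (simp add: sum_distrib_right flip: V.scale_mult_left V.scale_mult_right)
    qed simp
    also have "\<dots> = (\<Sum>s\<in>S. w * embed k s * h s)"
      unfolding h_def by (subst sum.swap) (simp add: sum_distrib_left)
    finally have w_eq: "w = (\<Sum>s\<in>S. w * embed k s * h s)" .
    obtain \<phi> where \<phi>: "bij_betw \<phi> {..<card S} S"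
      using ex_bij_betw_nat_finite[OF S(1)] by (auto simp: atLeast0LessThan)
    have w_sum: "w = (\<Sum>i<card S. w * embed k (\<phi> i) * f k * h (\<phi> i))"
      using w_eq sum.reindex_bij_betw[OF \<phi>, of "\<lambda>s. w * embed k s * h s"] by (simp add: mult.assoc fh)
    have "\<exists>g h. w = (\<Sum>s<card S. g s * f k * h s)"
      by (rule exI[of _ "\<lambda>i. w * embed k (\<phi> i)"], rule exI[of _ "\<lambda>i. h (\<phi> i)"]) (rule w_sum)
    with S(2) have "\<exists>m<(2 :: nat) ^ (k - j). \<exists>g h. w = (\<Sum>s<m. g s * f k * h s)" by blast
    with k show "\<exists>k>j. \<exists>m<(2 :: nat) ^ (k - j). \<exists>g h. w = (\<Sum>s<m. g s * f k * h s)" by blast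
  qed
  then have "e * f 0 = f 0" by (simp add: w_def)
  then show ?thesis using e(3) by blast
qed

section \<open>Left multiplication operators\<close>

lemma eq_by_dom:
  assumes "finite F" "x * f 0 = x" "y * f 0 = y"
    and "\<And>k v. v \<in> A.tile_dom k F \<Longrightarrow> x * embed k v = y * embed k v"
  shows "x = y"
proof -
  have "x * f 0 = y * f 0"
  proof (rule rcl_closed[OF dom_dense[OF assms(1)]])
    fix s assume "s \<in> (\<Union>k. dom k F)"
    then obtain k where "s \<in> dom k F" by blast
    then show "x * s = y * s"
      unfolding dom_def by (rule rcl_closed) (use assms(4) in blast)
  qed
  then show ?thesis using assms by simp
qed

text \<open>On the domain at level \<open>k\<close> the truncated multiplication is the true one,
  and it does not change at the next level since \<open>a * (v * c k) = (a * v) * c k\<close>. These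
  compatible partial maps are glued along the dense union of the domains.\<close>

lemma lmul_ex:
  "\<exists>x. f 0 * x = x \<and> x * f 0 = x \<and> (\<forall>k. \<forall>v\<in>A.tile_dom k {a}. x * embed k v = embed k (a * v))"
proof -
  define X where "X k = truncate k ((*) a)" for k
  have X: "X k * embed k v = embed k (a * v)" if "v \<in> A.tile k" for k v
    unfolding X_def by (rule truncate_embed[OF A.linear_left_mult that])
  have X_Suc: "X (Suc k) * s = X k * s" if "s \<in> dom k {a}" for k s
    using that unfolding dom_def
  proof (rule rcl_closed, safe)
    fix v assume "v \<in> A.tile_dom k {a}"
    then have v: "v \<in> A.tile k" "a * v \<in> A.tile k" by (simp_all add: A.tile_dom_def)
    have "X (Suc k) * embed k v = embed (Suc k) (a * v) + embed (Suc k) (a * v * c k) * \<beta>' k"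
      using X[OF A.tile_Suc(1)[OF v(1)]] X[OF A.tile_Suc(2)[OF v(1)]]
      by (simp add: embed_split[OF v(1)] distrib_left flip: mult.assoc)
    then show "X (Suc k) * embed k v = X k * embed k v"
      using embed_split[OF v(2)] X[OF v(1)] by simp
  qed
  have f0X: "f 0 * (X k * s) = X k * s" for k s
    unfolding X_def truncate_def by (simp add: sum_distrib_left sum_distrib_right f0_embed flip: mult.assoc)
  obtain x where x: "f 0 * x = x" "x * f 0 = x" "\<And>k s. s \<in> dom k {a} \<Longrightarrow> x * s = X k * s"
    by (rule glue[of "f 0" b' b "\<lambda>k. dom k {a}" X])
      (use b f_idem dom_PR dom_Suc f0_dom f0X X_Suc dom_dense[of "{a}"] in auto)
  have "x * embed k v = embed k (a * v)" if "v \<in> A.tile_dom k {a}" for k v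
    using x(3)[OF embed_in_dom[OF that]] X[of v k] that by (simp add: A.tile_dom_def)
  then show ?thesis using x(1,2) by blast
qed

definition lmul :: "'a \<Rightarrow> 'r"
  where "lmul a = (SOME x. f 0 * x = x \<and> x * f 0 = x \<and>
    (\<forall>k. \<forall>v\<in>A.tile_dom k {a}. x * embed k v = embed k (a * v)))"

lemma lmul:
  shows f0_lmul: "f 0 * lmul a = lmul a" and lmul_f0: "lmul a * f 0 = lmul a"
    and lmul_embed: "v \<in> A.tile k \<Longrightarrow> a * v \<in> A.tile k \<Longrightarrow> lmul a * embed k v = embed k (a * v)"
  using someI_ex[OF lmul_ex[of a]] unfolding lmul_def[symmetric] by (auto simp: A.tile_dom_def)

lemma lmul_add: "lmul (x + y) = lmul x + lmul y"
\<comment> \<open>The common domain of all elements involved is still dense, and on it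
  \<open>lmul_embed\<close> computes both sides.\<close>
proof (rule eq_by_dom[of "{x, y, x + y}"])
  fix k v assume "v \<in> A.tile_dom k {x, y, x + y}"
  then show "lmul (x + y) * embed k v = (lmul x + lmul y) * embed k v"
    by (simp add: A.tile_dom_def lmul_embed distrib_right embed.add)
qed (simp_all add: lmul_f0 distrib_right)

lemma lmul_mult: "lmul (x * y) = lmul x * lmul y"
proof (rule eq_by_dom[of "{y, x * y}"])
  fix k v assume "v \<in> A.tile_dom k {y, x * y}"
  then show "lmul (x * y) * embed k v = lmul x * lmul y * embed k v"
    by (simp add: A.tile_dom_def lmul_embed mult.assoc)
qed (simp_all add: lmul_f0 mult.assoc)

lemma lmul_scale: "lmul (scaleA d x) = scale d (lmul x)"
proof (rule eq_by_dom[of "{x, scaleA d x}"])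
  fix k v assume "v \<in> A.tile_dom k {x, scaleA d x}"
  then show "lmul (scaleA d x) * embed k v = scale d (lmul x) * embed k v"
    by (simp add: A.tile_dom_def lmul_embed embed.scale flip: V.scale_mult_left A.scale_mult_left)
qed (simp_all add: lmul_f0 flip: V.scale_mult_left)

lemma lmul_1: "lmul 1 = f 0"
proof (rule eq_by_dom[of "{1}"])
  fix k v assume "v \<in> A.tile_dom k {1}"
  then show "lmul 1 * embed k v = f 0 * embed k v"
    by (simp add: A.tile_dom_def lmul_embed f0_embed)
qed (simp_all add: lmul_f0 f_idem)

text \<open>Injectivity of multiplication by \<open>a\<close> gives a linear left inverse
  \<open>g\<close>, whose truncations invert \<open>lmul a\<close> on the domains. Hence the
  annihilator of \<open>lmul a\<close> is independent of every domain and, by upper continuity, of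
  their join, which contains \<open>f 0\<close>.\<close>

lemma lmul_injective:
  assumes a: "\<And>v. a * v = 0 \<Longrightarrow> v = 0" and r: "lmul a * r = 0"
  shows "f 0 * r = 0"
proof -
  have "inj ((*) a)"
  proof (rule injI)
    fix x y assume "a * x = a * y"
    then have "a * (x - y) = 0" by (simp add: right_diff_distrib)
    then show "x = y" using a by fastforce
  qed
  then obtain g where g: "Vector_Spaces.linear scaleA scaleA g" "g \<circ> (*) a = id"
    using pairA.linear_injective_left_inverse[OF A.linear_left_mult] by blast
  have ga: "g (a * v) = v" for v using g(2) by (metis comp_apply id_apply)
  let ?W = "{s. lmul a * s = 0}"
  have "?W \<inter> rcl (\<Union>(range (\<lambda>k. dom k {a}))) = {0}"
  proof (rule upper_continuous[OF annihilator_PR])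
    fix E assume "E \<in> range (\<lambda>k. dom k {a})"
    then obtain k where E: "E = dom k {a}" by blast
    have "s = 0" if s: "lmul a * s = 0" "s \<in> dom k {a}" for s
    proof -
      have "truncate k g * lmul a * s = s"
        using s(2) unfolding dom_def
      proof (rule rcl_closed_1, safe)
        fix v assume "v \<in> A.tile_dom k {a}"
        then show "truncate k g * lmul a * embed k v = embed k v"
          by (simp add: A.tile_dom_def mult.assoc lmul_embed truncate_embed[OF g(1)] ga)
      qed
      then show "s = 0" using s(1) by (simp add: mult.assoc)
    qed
    then show "?W \<inter> E = {0}" unfolding E using PR_closed(1)[OF dom_PR] by auto
  next
    fix E E' assume "E \<in> range (\<lambda>k. dom k {a})" "E' \<in> range (\<lambda>k. dom k {a})"
    then obtain k l where "E = dom k {a}" "E' = dom l {a}" by blast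
    then show "E \<subseteq> E' \<or> E' \<subseteq> E" using dom_mono[of k l] dom_mono[of l k] nat_le_linear[of k l] by metis
  qed (auto intro: dom_PR)
  moreover have "f 0 * r \<in> ?W" using r by (simp add: lmul_f0 flip: mult.assoc)
  moreover have "f 0 * r \<in> rcl (\<Union>(range (\<lambda>k. dom k {a})))"
    using PR_closed(5)[OF rcl_PR dom_dense[of "{a}"]] by simp
  ultimately show ?thesis by blast
qed

text \<open>The image of \<open>a\<close> acts diagonally, by \<open>lmul a\<close> on the half
  \<open>f 0\<close> and by its conjugate under \<open>b\<close> on the other half, so that
  \<open>1\<close> goes to \<open>1\<close>. Injectivity on both halves gives a unit by
  \<open>injective_unit\<close>.\<close>

lemma embedding:
  "\<exists>h. unital_algebra_hom scaleA scale h \<and>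
    (\<forall>a. (\<forall>v. a * v = 0 \<longrightarrow> v = 0) \<longrightarrow> (\<exists>d. h a * d = 1 \<and> d * h a = 1))"
proof -
  define h where "h a = lmul a + b * lmul a * b'" for a
  have pb: "f 0 * b = 0"
  proof -
    have "f 0 * b = f 0 * (b * b') * b" using b(1,3) by (simp add: mult.assoc)
    then show ?thesis using f_idem b(2) by (simp add: right_diff_distrib)
  qed
  have bp: "b' * f 0 = 0"
  proof -
    have "b' * f 0 = b' * (b * b') * f 0" using b(1,4) by (simp flip: mult.assoc)
    then show ?thesis using f_idem b(2) by (simp add: left_diff_distrib mult.assoc)
  qed
  have lb: "lmul x * b = 0" and bl: "b' * lmul x = 0" for x
    using lmul_f0[of x] f0_lmul[of x] pb bp by (metis mult.assoc mult_zero_right, metis mult.assoc mult_zero_left)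
  have add: "h (x + y) = h x + h y" for x y
    by (simp add: h_def lmul_add distrib_left distrib_right)
  have mult: "h (x * y) = h x * h y" for x y
  proof -
    have "h x * h y = lmul x * lmul y + (lmul x * b) * lmul y * b' + b * lmul x * (b' * lmul y) +
        b * (lmul x * (b' * b) * lmul y) * b'"
      unfolding h_def by (simp only: distrib_left distrib_right mult.assoc add_ac)
    then show ?thesis using b(1) lb bl by (simp add: lmul_f0 lmul_mult h_def mult.assoc)
  qed
  have "h (scaleA d x) = scale d (h x)" for d x
    by (simp add: h_def lmul_scale V.scale_right_distrib flip: V.scale_mult_left V.scale_mult_right)
  moreover have "h 1 = 1" using b(2,3) by (simp add: h_def lmul_1)
  ultimately have hom: "unital_algebra_hom scaleA scale h"
    by unfold_locales (simp_all add: add mult)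
  have "r = 0" if a: "\<forall>v. a * v = 0 \<longrightarrow> v = 0" and r: "h a * r = 0" for a r
  proof -
    have "f 0 * (h a * r) = lmul a * r"
      using pb f0_lmul unfolding h_def by (simp add: distrib_left distrib_right flip: mult.assoc)
    then have 1: "f 0 * r = 0" using r a by (intro lmul_injective[of a]) auto
    have "b' * (h a * r) = lmul a * (b' * r)"
      using b(1) bl f0_lmul unfolding h_def by (simp add: distrib_left distrib_right flip: mult.assoc)
    then have "f 0 * (b' * r) = 0" using r a by (intro lmul_injective[of a]) auto
    then have "b' * r = 0" using b(4) by (simp flip: mult.assoc)
    then have "(b * b') * r = 0" by (simp add: mult.assoc)
    then show "r = 0" using 1 b(2) by (simp add: left_diff_distrib)
  qed
  then have "\<exists>d. h a * d = 1 \<and> d * h a = 1" if "\<forall>v. a * v = 0 \<longrightarrow> v = 0" for a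
    using injective_unit[of "h a"] that by metis
  with hom show ?thesis by blast
qed

end

theorem tiled_algebra_embedding:
  fixes scale :: "'k::field \<Rightarrow> 'r::ring_1 \<Rightarrow> 'r"
  assumes "unital_algebra scale" "continuous_regular_ring TYPE('r)"
    and no_abelian: "\<forall>e :: 'r. abelian_idempotent e \<longrightarrow> e = 0"
    and "tiled_algebra scaleA c"
  shows "\<exists>h. unital_algebra_hom scaleA scale h \<and>
    (\<forall>a. (\<forall>v. a * v = 0 \<longrightarrow> v = 0) \<longrightarrow> (\<exists>d. h a * d = 1 \<and> d * h a = 1))"
proof -
  interpret continuous_ring "TYPE('r)" by (rule continuous_ring.intro) fact
  \<comment> \<open>Halving \<open>1\<close> gives the half \<open>p\<close> at which the tower
    starts and the isomorphism with its complement.\<close>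
  obtain p b b' :: 'r where p: "p * p = p" "b' * b = p" "b * b' = 1 - p" "b * p = b" "p * b' = b'"
    by (rule halving[of 1]) (use no_abelian in auto)
  obtain f \<beta> \<beta>' where tower: "dyadic_tower TYPE('r) f \<beta> \<beta>'" "f 0 = p"
    using dyadic_tower_exists[OF _ p(1)] no_abelian by blast
  interpret tiled_tower "TYPE('r)" f \<beta> \<beta>' scaleA c scale b b'
    using assms tower p by (intro tiled_tower.intro tiled_tower_axioms.intro) simp_all
  show ?thesis by (rule embedding)
qed

section \<open>The Weyl algebra\<close>

lemma weyl_px_monom: "weyl_px (monom 1 i) = weyl_x ^ i"
  by (induction i) (simp_all add: monom_Suc monom_0 weyl_const_0 weyl_const_1)

lemma weyl_nf_monom: "weyl_nf (monom p j) = weyl_px p * weyl_y ^ j"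
  by (induction j) (simp_all add: monom_0 monom_Suc mult.assoc power_commutes)

lemma weyl_mon_eq: "weyl_mon (i, j) = weyl_x ^ i * weyl_y ^ j"
  by (simp add: weyl_mon_def weyl_nf_monom weyl_px_monom)

lemma weyl_nf_inject: "weyl_nf P = weyl_nf Q \<longleftrightarrow> P = Q"
proof
  assume "weyl_nf P = weyl_nf Q"
  then have "weyl_nf (P - Q) = 0" using weyl_nf_add[of "P - Q" Q] by simp
  then show "P = Q" by (simp add: weyl_nf_eq_0_iff)
qed simp

lemma inj_weyl_mon: "inj (weyl_mon :: _ \<Rightarrow> 'k::field_char_0 weyl)"
proof (rule injI)
  fix p q :: "nat \<times> nat"
  assume "(weyl_mon p :: 'k weyl) = weyl_mon q"
  then have eq: "monom (monom (1 :: 'k) (fst p)) (snd p) = monom (monom 1 (fst q)) (snd q)"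
    by (simp add: weyl_mon_def weyl_nf_inject)
  from arg_cong[OF eq, of "\<lambda>P. coeff (coeff P (snd p)) (fst p)"] show "p = q"
    by (auto simp: prod_eq_iff split: if_splits)
qed

lemma independent_weyl_mon:
  assumes "finite I"
  shows "weyl.independent (weyl_mon ` I :: 'k::field_char_0 weyl set)"
proof
  assume "weyl.dependent (weyl_mon ` I :: 'k weyl set)"
  then obtain u :: "'k weyl \<Rightarrow> 'k" where u: "\<exists>v\<in>weyl_mon ` I. u v \<noteq> 0" "(\<Sum>v\<in>weyl_mon ` I. weyl_scale (u v) v) = 0"
    using weyl.dependent_finite[of "weyl_mon ` I"] assms by auto
  have "(\<Sum>p\<in>I. weyl_scale (u (weyl_mon p)) (weyl_mon p)) = 0"
    using u(2) by (simp add: sum.reindex inj_on_subset[OF inj_weyl_mon])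
  then have "(\<Sum>p\<in>I. monom (monom (u (weyl_mon p)) (fst p)) (snd p)) = 0"
    unfolding weyl_sum_mon[of "\<lambda>p. u (weyl_mon p)"] by (simp add: weyl_nf_eq_0_iff)
  then have "u (weyl_mon (i, j)) = 0" if "(i, j) \<in> I" for i j
    using coeff_sum_mon[OF assms, of "\<lambda>p. u (weyl_mon p)" j i] that by simp
  then show False using u(1) by auto
qed

section \<open>Boxes of monomials\<close>

definition weyl_box :: "nat \<Rightarrow> nat \<Rightarrow> 'k::field_char_0 weyl set"
  where "weyl_box m n = weyl.span (weyl_mon ` ({..<m} \<times> {..<n}))"

lemma weyl_box_mono: "m \<le> m' \<Longrightarrow> n \<le> n' \<Longrightarrow> weyl_box m n \<subseteq> weyl_box m' n'"
  unfolding weyl_box_def by (intro weyl.span_mono image_mono) auto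

lemma weyl_box_monoD: "v \<in> weyl_box m n \<Longrightarrow> m \<le> m' \<Longrightarrow> n \<le> n' \<Longrightarrow> v \<in> weyl_box m' n'"
  using weyl_box_mono by blast

lemma weyl_mon_in_box: "i < m \<Longrightarrow> j < n \<Longrightarrow> weyl_x ^ i * weyl_y ^ j \<in> weyl_box m n"
  unfolding weyl_box_def by (intro weyl.span_base) (auto simp flip: weyl_mon_eq)

lemma weyl_box_closed:
  shows "0 \<in> weyl_box m n"
    and "u \<in> weyl_box m n \<Longrightarrow> v \<in> weyl_box m n \<Longrightarrow> u + v \<in> weyl_box m n"
    and "u \<in> weyl_box m n \<Longrightarrow> weyl_scale c u \<in> weyl_box m n"
  unfolding weyl_box_def by (rule weyl.span_zero weyl.span_add weyl.span_scale; assumption?)+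

lemma weyl_box_induct [consumes 1, case_names zero mon]:
  assumes "v \<in> weyl_box m n" "P 0"
    and "\<And>c i j v. i < m \<Longrightarrow> j < n \<Longrightarrow> P v \<Longrightarrow> P (weyl_scale c (weyl_x ^ i * weyl_y ^ j) + v)"
  shows "P v"
  using assms(1) unfolding weyl_box_def
proof (induction rule: weyl.span_induct_alt)
  case base
  show ?case by (rule assms(2))
next
  case (step c x y)
  then show ?case using assms(3) by (auto simp: weyl_mon_eq)
qed

lemma weyl_x_box: "(v :: 'k::field_char_0 weyl) \<in> weyl_box m n \<Longrightarrow> weyl_x * v \<in> weyl_box (Suc m) n"
proof (induction rule: weyl_box_induct)
  case (mon c i j v)
  then have "(weyl_x :: 'k weyl) * (weyl_x ^ i * weyl_y ^ j) \<in> weyl_box (Suc m) n"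
    using weyl_mon_in_box[of "Suc i" "Suc m" j n] by (simp add: mult.assoc)
  then show ?case using mon.IH
    unfolding distrib_left weyl.scale_mult_right[symmetric] by (intro weyl_box_closed(2,3))
qed (simp add: weyl_box_closed)

lemma weyl_box_y: "(v :: 'k::field_char_0 weyl) \<in> weyl_box m n \<Longrightarrow> v * weyl_y \<in> weyl_box m (Suc n)"
proof (induction rule: weyl_box_induct)
  case (mon c i j v)
  then have "(weyl_x :: 'k weyl) ^ i * weyl_y ^ j * weyl_y \<in> weyl_box m (Suc n)"
    using weyl_mon_in_box[of i m "Suc j" "Suc n"] by (simp add: mult.assoc power_commutes)
  then show ?case using mon.IH
    unfolding distrib_right weyl.scale_mult_left[symmetric] by (intro weyl_box_closed(2,3))
qed (simp add: weyl_box_closed)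

text \<open>Moving \<open>y\<close> past a power of \<open>x\<close> adds only terms with smaller
  exponents, so the box of the leading term suffices.\<close>

lemma weyl_y_mon: "(weyl_y :: 'k::field_char_0 weyl) * (weyl_x ^ i * weyl_y ^ j) \<in> weyl_box (Suc i) (Suc (Suc j))"
proof (induction i)
  case 0
  show ?case using weyl_mon_in_box[of 0 1 "Suc j" "Suc (Suc j)"] by simp
next
  case (Suc i)
  have "(weyl_y :: 'k weyl) * (weyl_x ^ Suc i * weyl_y ^ j) =
      weyl_x * (weyl_y * (weyl_x ^ i * weyl_y ^ j)) + weyl_x ^ i * weyl_y ^ j"
  proof -
    have "(weyl_y :: 'k weyl) * (weyl_x ^ Suc i * weyl_y ^ j) = (weyl_y * weyl_x) * (weyl_x ^ i * weyl_y ^ j)"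
      by (simp add: mult.assoc)
    then show ?thesis by (simp add: weyl_relation distrib_right mult.assoc)
  qed
  then show ?case
    using weyl_box_closed(2)[OF weyl_x_box[OF Suc] weyl_mon_in_box[of i "Suc (Suc i)" j "Suc (Suc j)"]]
    by simp
qed

lemma weyl_y_box: "(v :: 'k::field_char_0 weyl) \<in> weyl_box m n \<Longrightarrow> weyl_y * v \<in> weyl_box m (Suc n)"
proof (induction rule: weyl_box_induct)
  case (mon c i j v)
  then have "(weyl_y :: 'k weyl) * (weyl_x ^ i * weyl_y ^ j) \<in> weyl_box m (Suc n)"
    by (intro weyl_box_monoD[OF weyl_y_mon]) auto
  then show ?case using mon.IH
    unfolding distrib_left weyl.scale_mult_right[symmetric] by (intro weyl_box_closed(2,3))
qed (simp add: weyl_box_closed)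

text \<open>Commuting \<open>x\<close> to the left past \<open>y ^ j\<close> leaves a correction
  with lower powers of \<open>y\<close>. The bound \<open>j\<close>, excluding \<open>y ^ j\<close>
  itself, is what drives the induction in \<open>weyl_tile\<close>.\<close>

lemma weyl_mon_x:
  "(weyl_x :: 'k::field_char_0 weyl) ^ i * weyl_y ^ j * weyl_x - weyl_x ^ Suc i * weyl_y ^ j \<in> weyl_box (Suc i) j"
proof (induction j)
  case 0
  show ?case by (simp add: weyl_box_closed power_commutes)
next
  case (Suc j)
  have "(weyl_x :: 'k weyl) ^ i * weyl_y ^ Suc j * weyl_x = weyl_x ^ i * weyl_y ^ j * (weyl_y * weyl_x)"
    by (simp only: power_Suc2 mult.assoc)
  also have "\<dots> = weyl_x ^ i * weyl_y ^ j * weyl_x * weyl_y + weyl_x ^ i * weyl_y ^ j"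
    by (simp add: weyl_relation distrib_left mult.assoc)
  finally have "(weyl_x :: 'k weyl) ^ i * weyl_y ^ Suc j * weyl_x - weyl_x ^ Suc i * weyl_y ^ Suc j =
      (weyl_x ^ i * weyl_y ^ j * weyl_x - weyl_x ^ Suc i * weyl_y ^ j) * weyl_y + weyl_x ^ i * weyl_y ^ j"
    by (simp add: power_Suc2 left_diff_distrib mult.assoc del: power_Suc)
  then show ?case
    using weyl_box_closed(2)[OF weyl_box_y[OF Suc] weyl_mon_in_box[of i "Suc i" j "Suc j"]] by simp
qed

lemma weyl_box_x: "(v :: 'k::field_char_0 weyl) \<in> weyl_box m n \<Longrightarrow> v * weyl_x \<in> weyl_box (Suc m) n"
proof (induction rule: weyl_box_induct)
  case (mon c i j v)
  then have "(weyl_x :: 'k weyl) ^ i * weyl_y ^ j * weyl_x - weyl_x ^ Suc i * weyl_y ^ j \<in> weyl_box (Suc m) n"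
      "(weyl_x :: 'k weyl) ^ Suc i * weyl_y ^ j \<in> weyl_box (Suc m) n"
    by (intro weyl_box_monoD[OF weyl_mon_x] weyl_mon_in_box; simp)+
  from weyl_box_closed(2)[OF this] have "(weyl_x :: 'k weyl) ^ i * weyl_y ^ j * weyl_x \<in> weyl_box (Suc m) n" by simp
  then show ?case using mon.IH
    unfolding distrib_right weyl.scale_mult_left[symmetric] by (intro weyl_box_closed(2,3))
qed (simp add: weyl_box_closed)

lemma weyl_box_power:
  assumes "v \<in> weyl_box m n"
  shows "v * weyl_x ^ k \<in> weyl_box (m + k) n" "v * weyl_y ^ k \<in> weyl_box m (n + k)"
  using assms weyl_box_x[of "v * weyl_x ^ _"] weyl_box_y[of "v * weyl_y ^ _"]
  by (induction k) (simp_all add: power_Suc2 del: power_Suc flip: mult.assoc)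

lemma weyl_mon_power:
  "(weyl_x :: 'k::field_char_0 weyl) ^ i * weyl_y ^ j * weyl_x ^ m - weyl_x ^ (i + m) * weyl_y ^ j \<in> weyl_box (i + m) j"
proof (induction m)
  case 0
  show ?case using weyl_box_closed(1) by simp
next
  case (Suc m)
  have "(weyl_x :: 'k weyl) ^ i * weyl_y ^ j * weyl_x ^ Suc m - weyl_x ^ (i + Suc m) * weyl_y ^ j =
      (weyl_x ^ i * weyl_y ^ j * weyl_x ^ m - weyl_x ^ (i + m) * weyl_y ^ j) * weyl_x +
      (weyl_x ^ (i + m) * weyl_y ^ j * weyl_x - weyl_x ^ Suc (i + m) * weyl_y ^ j)"
    by (simp add: power_Suc2 left_diff_distrib mult.assoc del: power_Suc)
  then show ?case using weyl_box_closed(2)[OF weyl_box_x[OF Suc] weyl_mon_x[of "i + m" j]]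
    by (metis add_Suc_right)
qed

section \<open>Tiles as boxes\<close>

definition weyl_step :: "nat \<Rightarrow> 'k::field_char_0 weyl"
  where "weyl_step k = (if even k then weyl_y else weyl_x) ^ (2 ^ (k div 2))"

text \<open>For even \<open>k\<close> right multiplication by a power of \<open>y\<close> shifts
  monomials exactly. For odd \<open>k\<close> a power of \<open>x\<close> shifts them only up to
  lower powers of \<open>y\<close>, so the enlarged box is recovered by induction on the exponent of
  \<open>y\<close>.\<close>

lemma weyl_tile:
  "weyl.span (tile_basis weyl_step k ` {..<2 ^ k}) =
    (weyl_box (2 ^ (k div 2)) (2 ^ ((k + 1) div 2)) :: 'k::field_char_0 weyl set)"
proof (induction k)
  case 0
  have "tile_basis weyl_step 0 ` {..<2 ^ 0} = {1 :: 'k weyl}" by (auto simp: lessThan_Suc)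
  moreover have "weyl_mon ` ({..<1} \<times> {..<1}) = {1 :: 'k weyl}" using weyl_mon_eq[of 0 0, where ?'a = 'k] by (auto simp: lessThan_Suc)
  ultimately show ?case by (simp add: weyl_box_def)
next
  case (Suc k)
  define m n m' n' :: nat
    where "m = 2 ^ (k div 2)" and "n = 2 ^ ((k + 1) div 2)"
      and "m' = 2 ^ (Suc k div 2)" and "n' = 2 ^ ((Suc k + 1) div 2)"
  note defs = this
  define T :: "'k weyl set" where "T = weyl.span (tile_basis weyl_step (Suc k) ` {..<2 ^ Suc k})"
  have IH: "weyl.span (tile_basis weyl_step k ` {..<2 ^ k}) = (weyl_box m n :: 'k weyl set)"
    using Suc by (simp only: defs)
  have m': "m' = (if even k then m else m + m)" and n': "n' = (if even k then n + n else n)"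
    and mn: "even k \<Longrightarrow> n = m" by (auto elim!: evenE oddE simp: defs mult_2)
  have step: "weyl_step k = (if even k then weyl_y else weyl_x :: 'k weyl) ^ m"
    by (simp add: weyl_step_def defs)
  have up: "v \<in> weyl_box m' n'" "v * weyl_step k \<in> weyl_box m' n'" if "v \<in> weyl_box m n" for v :: "'k weyl"
  proof -
    show "v \<in> weyl_box m' n'" by (rule weyl_box_monoD[OF that]) (simp_all add: m' n')
    show "v * weyl_step k \<in> weyl_box m' n'"
      using weyl_box_power[OF that, of m] mn by (cases "even k") (simp_all add: m' n' step)
  qed
  have down: "v \<in> T" "v * weyl_step k \<in> T" if "v \<in> weyl_box m n" for v
    using weyl.tile_span_Suc[of v weyl_step k] that unfolding IH T_def by auto
  have "T = weyl_box m' n'"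
  proof
    show "T \<subseteq> weyl_box m' n'"
      unfolding weyl_box_def T_def
    proof (rule weyl.span_minimal[OF _ weyl.subspace_span], fold weyl_box_def, safe)
      fix i assume i: "i < (2 :: nat) ^ Suc k"
      have "tile_basis weyl_step k j \<in> (weyl_box m n :: 'k weyl set)" if "j < 2 ^ k" for j
        unfolding IH[symmetric] using that by (intro weyl.span_base) simp
      then show "tile_basis weyl_step (Suc k) i \<in> (weyl_box m' n' :: 'k weyl set)"
        using up i by simp
    qed
    have sT: "weyl.subspace T" unfolding T_def by (rule weyl.subspace_span)
    have sub: "weyl_box a b \<subseteq> T" if "\<And>i j. i < a \<Longrightarrow> j < b \<Longrightarrow> weyl_x ^ i * weyl_y ^ j \<in> T" for a b
      unfolding weyl_box_def by (rule weyl.span_minimal[OF _ sT]) (auto simp: weyl_mon_eq that)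
    show "weyl_box m' n' \<subseteq> T"
    proof (cases "even k")
      case True
      show ?thesis
      proof (rule sub)
        fix i j assume ij: "i < m'" "j < n'"
        show "weyl_x ^ i * weyl_y ^ j \<in> T"
        proof (cases "j < n")
          case True
          then show ?thesis using ij m' \<open>even k\<close> by (intro down(1) weyl_mon_in_box) auto
        next
          case False
          then have "weyl_x ^ i * weyl_y ^ (j - n) * weyl_step k = weyl_x ^ i * (weyl_y ^ j :: 'k weyl)"
            using \<open>even k\<close> mn by (simp add: step mult.assoc flip: power_add)
          moreover have "weyl_x ^ i * weyl_y ^ (j - n) \<in> (weyl_box m n :: 'k weyl set)"
            using ij False m' n' \<open>even k\<close> by (intro weyl_mon_in_box) auto
          ultimately show ?thesis using down(2) by metis
        qed
      qed
    next
      case False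
      have "weyl_box m' b \<subseteq> T" if "b \<le> n" for b
        using that
      proof (induction b)
        case 0
        show ?case by (rule sub) simp
      next
        case (Suc b)
        show ?case
        proof (rule sub)
          fix i j assume ij: "i < m'" "j < Suc b"
          show "weyl_x ^ i * weyl_y ^ j \<in> T"
          proof (cases "i < m")
            case True
            then show ?thesis using ij Suc.prems by (intro down(1) weyl_mon_in_box) auto
          next
            case i: False
            have "weyl_x ^ (i - m) * weyl_y ^ j \<in> (weyl_box m n :: 'k weyl set)"
              using ij Suc.prems m' False by (intro weyl_mon_in_box) auto
            then have 1: "weyl_x ^ (i - m) * weyl_y ^ j * weyl_x ^ m \<in> T"
              using down(2) False by (simp add: step)
            have "weyl_x ^ (i - m) * weyl_y ^ j * weyl_x ^ m - weyl_x ^ i * weyl_y ^ j \<in> (weyl_box i j :: 'k weyl set)"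
              using weyl_mon_power[of "i - m" j m] i by simp
            also have "weyl_box i j \<subseteq> (weyl_box m' b :: 'k weyl set)" using ij by (intro weyl_box_mono) auto
            also have "\<dots> \<subseteq> T" using Suc by simp
            finally show ?thesis using weyl.subspace_diff[OF sT 1] by force
          qed
        qed
      qed
      then show ?thesis using n' False by simp
    qed
  qed
  then show ?case by (simp only: defs T_def)
qed

section \<open>Growth of boxes under left multiplication\<close>

lemma weyl_box_growth: "\<exists>d. \<forall>m n. \<forall>v\<in>weyl_box m n. a * v \<in> weyl_box (m + d) (n + d)"
proof (induction a rule: weyl_induct)
  case (add a b)
  then obtain d e where de: "\<And>m n v. v \<in> weyl_box m n \<Longrightarrow> a * v \<in> weyl_box (m + d) (n + d)"
    "\<And>m n v. v \<in> weyl_box m n \<Longrightarrow> b * v \<in> weyl_box (m + e) (n + e)" by blast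
  have "(a + b) * v \<in> weyl_box (m + (d + e)) (n + (d + e))" if v: "v \<in> weyl_box m n" for v m n
    unfolding distrib_right
    by (intro weyl_box_closed(2) weyl_box_monoD[OF de(1)[OF v]] weyl_box_monoD[OF de(2)[OF v]]) auto
  then show ?case by blast
next
  case (const c)
  show ?case using weyl_box_closed(3)[of _ _ _ c] by (intro exI[of _ 0]) (simp add: weyl_scale_def)
next
  case (x a)
  then obtain d where d: "\<And>m n v. v \<in> weyl_box m n \<Longrightarrow> a * v \<in> weyl_box (m + d) (n + d)" by blast
  have "weyl_x * a * v \<in> weyl_box (m + Suc d) (n + Suc d)" if v: "v \<in> weyl_box m n" for v m n
    unfolding mult.assoc by (rule weyl_box_monoD[OF weyl_x_box[OF d[OF v]]]) auto
  then show ?case by blast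
next
  case (y a)
  then obtain d where d: "\<And>m n v. v \<in> weyl_box m n \<Longrightarrow> a * v \<in> weyl_box (m + d) (n + d)" by blast
  have "weyl_y * a * v \<in> weyl_box (m + Suc d) (n + Suc d)" if v: "v \<in> weyl_box m n" for v m n
    unfolding mult.assoc by (rule weyl_box_monoD[OF weyl_y_box[OF d[OF v]]]) auto
  then show ?case by blast
qed

lemma weyl_box_growth_finite:
  assumes "finite F"
  shows "\<exists>d. \<forall>a\<in>F. \<forall>m n. \<forall>v\<in>weyl_box m n. a * v \<in> weyl_box (m + d) (n + d)"
  using assms
proof (induction F)
  case (insert a F)
  then obtain d e where de: "\<And>b m n v. b \<in> F \<Longrightarrow> v \<in> weyl_box m n \<Longrightarrow> b * v \<in> weyl_box (m + d) (n + d)"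
    "\<And>m n v. v \<in> weyl_box m n \<Longrightarrow> a * v \<in> weyl_box (m + e) (n + e)"
    using weyl_box_growth[of a] by blast
  have "b * v \<in> weyl_box (m + (d + e)) (n + (d + e))" if b: "b \<in> insert a F" and v: "v \<in> weyl_box m n" for b v m n
    using b weyl_box_monoD[OF de(1)[OF _ v, of b], of "m + (d + e)" "n + (d + e)"]
      weyl_box_monoD[OF de(2)[OF v], of "m + (d + e)" "n + (d + e)"] by auto
  then show ?case by blast
qed simp

lemma card_fringe:
  "card ({..<N} \<times> {..<N} - {..<N - d} \<times> {..<N - d}) \<le> 2 * d * N" for N d :: nat
proof -
  have "{..<N} \<times> {..<N} - {..<N - d} \<times> {..<N - d} \<subseteq> {N - d..<N} \<times> {..<N} \<union> {..<N} \<times> {N - d..<N}"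
    by auto
  then have "card ({..<N} \<times> {..<N} - {..<N - d} \<times> {..<N - d}) \<le>
      card ({N - d..<N} \<times> {..<N} \<union> {..<N} \<times> {N - d..<N})"
    by (intro card_mono) auto
  also have "\<dots> \<le> card ({N - d..<N} \<times> {..<N}) + card ({..<N} \<times> {N - d..<N})" by (rule card_Un_le)
  also have "\<dots> \<le> d * N + N * d"
    unfolding card_cartesian_product by (intro add_mono mult_mono) auto
  finally show ?thesis by (simp add: mult.commute)
qed

lemma weyl_tiled: "tiled_algebra weyl_scale (weyl_step :: nat \<Rightarrow> 'k::field_char_0 weyl)"
proof unfold_locales
  fix k
  let ?I = "{..<2 ^ (k div 2)} \<times> {..<2 ^ ((k + 1) div 2)} :: (nat \<times> nat) set"
  let ?B = "tile_basis weyl_step k ` {..<2 ^ k} :: 'k weyl set"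
  have "k = k div 2 + (k + 1) div 2" by presburger
  then have card: "card ?I = 2 ^ k" by (simp add: card_cartesian_product flip: power_add)
  have span: "weyl.span ?B = weyl.span (weyl_mon ` ?I)"
    using weyl_tile[of k, where ?'k = 'k] by (simp add: weyl_box_def)
  have "weyl.dim ?B = card (weyl_mon ` ?I :: 'k weyl set)"
    by (rule weyl.dim_eq_card[OF span[symmetric] independent_weyl_mon]) simp
  also have "\<dots> = 2 ^ k" using card by (simp add: card_image inj_on_subset[OF inj_weyl_mon])
  finally have dim: "weyl.dim ?B = 2 ^ k" .
  \<comment> \<open>At most \<open>2 ^ k\<close> vectors span a space of dimension
    \<open>2 ^ k\<close>, so they are distinct and form a basis.\<close>
  have "weyl.dim ?B \<le> card ?B" by (rule weyl.dim_le_card) (auto intro: weyl.span_base)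
  then have cardB: "card ?B = 2 ^ k" using dim card_image_le[of "{..<2 ^ k}" "tile_basis weyl_step k :: _ \<Rightarrow> 'k weyl"] by simp
  then show "inj_on (tile_basis weyl_step k :: _ \<Rightarrow> 'k weyl) {..<2 ^ k}" by (intro eq_card_imp_inj_on) simp_all
  obtain B where B: "B \<subseteq> ?B" "weyl.independent B" "?B \<subseteq> weyl.span B"
    using weyl.maximal_independent_subset[of ?B] by blast
  then have "card B = weyl.dim ?B" using weyl.basis_card_eq_dim by blast
  then have "B = ?B" using dim cardB B(1) by (intro card_subset_eq) auto
  then show "weyl.independent ?B" using B(2) by simp
next
  fix F :: "'k weyl set" and j :: nat
  assume "finite F"
  then obtain d where d: "\<And>a m n v. a \<in> F \<Longrightarrow> v \<in> weyl_box m n \<Longrightarrow> a * v \<in> weyl_box (m + d) (n + d)"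
    using weyl_box_growth_finite[of F] by blast
  \<comment> \<open>Level \<open>2 * l\<close> is a square box of side \<open>N = 2 ^ l\<close>.
    Outside the square of side \<open>N - d\<close> it has at most \<open>2 * d * N\<close>
    monomials, and this \<open>l\<close> makes \<open>2 ^ (2 * d + 1) * N\<close> equal to
    \<open>2 ^ (2 * l - j)\<close>.\<close>
  define l where "l = 2 * d + j + 1"
  define N where "N = (2 :: nat) ^ l"
  have tile: "weyl.span (tile_basis weyl_step (2 * l) ` {..<2 ^ (2 * l)}) = (weyl_box N N :: 'k weyl set)"
    unfolding weyl_tile N_def by simp
  define S where "S = (weyl_mon ` ({..<N} \<times> {..<N} - {..<N - d} \<times> {..<N - d}) :: 'k weyl set)"
  have "card S \<le> 2 * d * N"
    unfolding S_def by (rule order_trans[OF card_image_le card_fringe]) simp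
  also have "\<dots> < 2 ^ (2 * d + 1) * N"
  proof -
    have "2 * d < 2 ^ (2 * d + 1)" using less_exp[of "2 * d + 1"] by linarith
    then show ?thesis by (simp add: N_def)
  qed
  also have "\<dots> = 2 ^ (2 * l - j)" by (simp add: N_def l_def flip: power_add)
  finally have card: "card S < 2 ^ (2 * l - j)" .
  have dN: "d \<le> N"
    using less_exp[of l] unfolding N_def l_def by linarith
  have "weyl_box N N \<subseteq> weyl.span ({v \<in> weyl_box N N. \<forall>a\<in>F. a * v \<in> weyl_box N N} \<union> S)"
    (is "_ \<subseteq> weyl.span (?D \<union> S)")
    unfolding weyl_box_def[of N N]
  proof (rule weyl.span_minimal[OF _ weyl.subspace_span], fold weyl_box_def, safe)
    fix p q assume pq: "p < N" "q < N"
    show "weyl_mon (p, q) \<in> weyl.span (?D \<union> S)"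
    proof (cases "p < N - d \<and> q < N - d")
      case True
      then have in_box: "weyl_mon (p, q) \<in> weyl_box (N - d) (N - d)"
        unfolding weyl_mon_eq by (intro weyl_mon_in_box) auto
      have "weyl_mon (p, q) \<in> weyl_box N N" using in_box by (rule weyl_box_monoD) auto
      moreover have "a * weyl_mon (p, q) \<in> weyl_box N N" if "a \<in> F" for a
        using d[OF that in_box] dN by simp
      ultimately show ?thesis by (intro weyl.span_base) auto
    next
      case False
      then show ?thesis using pq by (intro weyl.span_base) (auto simp: S_def)
    qed
  qed
  then show "\<exists>k>j. \<exists>S. finite S \<and> card S < 2 ^ (k - j) \<and>
      weyl.span (tile_basis weyl_step k ` {..<2 ^ k}) \<subseteq> weyl.span ({v \<in> weyl.span (tile_basis weyl_step k ` {..<2 ^ k}).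
        \<forall>a\<in>F. a * v \<in> weyl.span (tile_basis weyl_step k ` {..<2 ^ k})} \<union> S)"
    using card unfolding tile[symmetric]
    by (intro exI[of _ "2 * l"] conjI exI[of _ S]) (simp_all add: l_def S_def)
qed

section \<open>Extension to the quotient division ring\<close>

lemma ore_extension:
  fixes h :: "'a::right_ore_domain \<Rightarrow> 'r::ring_1"
  assumes add: "\<And>a b. h (a + b) = h a + h b" and mult: "\<And>a b. h (a * b) = h a * h b"
    and unit: "\<And>a. a \<noteq> 0 \<Longrightarrow> \<exists>d. h a * d = 1 \<and> d * h a = 1"
  obtains H :: "'a ore_quotient \<Rightarrow> 'r" where "\<And>x y. H (x + y) = H x + H y"
    "\<And>x y. H (x * y) = H x * H y" "\<And>a. H (ore_of a) = h a"
proof -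
  obtain j where j: "\<And>s. s \<noteq> 0 \<Longrightarrow> h s * j s = 1" "\<And>s. s \<noteq> 0 \<Longrightarrow> j s * h s = 1"
    using unit by metis
  \<comment> \<open>A common right factor of numerator and denominator cancels under
    \<open>h\<close>; any two representatives of a fraction are compared this way.\<close>
  have j_mult: "h u * j (s * u) = j s" if "s \<noteq> 0" "s * u \<noteq> 0" for s u
  proof -
    have "h u * j (s * u) = j s * (h (s * u) * j (s * u))"
      using j(2)[OF that(1)] by (simp add: mult flip: mult.assoc)
    then show ?thesis using j(1)[OF that(2)] by simp
  qed
  have wd: "h a * j s = h b * j t" if eq: "Frac a s = Frac b t" and st: "s \<noteq> 0" "t \<noteq> 0" for a b s t
  proof -
    obtain u v where uv: "s * u = t * v" "s * u \<noteq> 0" "a * u = b * v"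
      using eq unfolding Frac_eq_iff[OF st] ore_rel_simp by blast
    have "h a * j s = h (a * u) * j (s * u)" using j_mult[OF st(1) uv(2)] by (simp add: mult mult.assoc)
    also have "\<dots> = h b * (h v * j (t * v))" unfolding uv(1,3) by (simp add: mult mult.assoc)
    finally show ?thesis using j_mult[OF st(2)] uv by simp
  qed
  define H where "H q = (SOME r. \<exists>a s. s \<noteq> 0 \<and> q = Frac a s \<and> r = h a * j s)" for q
  have H: "H (Frac a s) = h a * j s" if "s \<noteq> 0" for a s
    unfolding H_def
  proof (rule some_equality)
    show "\<exists>b t. t \<noteq> 0 \<and> Frac a s = Frac b t \<and> h a * j s = h b * j t" using that by blast
    show "r = h a * j s" if "\<exists>b t. t \<noteq> 0 \<and> Frac a s = Frac b t \<and> r = h b * j t" for r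
      using that wd \<open>s \<noteq> 0\<close> by metis
  qed
  have h1: "h 1 * j 1 = 1" using j(1)[of 1] by simp
  show ?thesis
  proof
    show "H (x + y) = H x + H y" for x y
      by (rule Frac_cases2[of x y]) (simp add: Frac_add_same H add distrib_right)
    show "H (x * y) = H x * H y" for x y
    proof -
      obtain a s where x: "x = Frac a s" "s \<noteq> 0" by (rule Frac_cases)
      obtain b t where y: "y = Frac b t" "t \<noteq> 0" by (rule Frac_cases)
      obtain p e where p: "b * p = s * e" "p \<noteq> 0" using swap_denom[OF x(2)] .
      have tp: "t * p \<noteq> 0" using p y by simp
      have "H x * H y = h a * j s * h b * (h p * j (t * p))"
        unfolding x(1) y(1) H[OF x(2)] H[OF y(2)] j_mult[OF y(2) tp] by (simp add: mult.assoc)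
      also have "\<dots> = h a * j s * h (b * p) * j (t * p)" by (simp add: mult mult.assoc)
      also have "\<dots> = h a * (j s * h s) * h e * j (t * p)" unfolding p(1) by (simp add: mult mult.assoc)
      also have "\<dots> = H (x * y)"
        unfolding x(1) y(1) Frac_mult[OF x(2) y(2) p] H[OF tp] using j(2)[OF x(2)] by (simp add: mult)
      finally show ?thesis by simp
    qed
    show "H (ore_of a) = h a" for a
    proof -
      \<comment> \<open>\<open>h 1\<close> is idempotent and has a right inverse, hence equals
        \<open>1\<close>.\<close>
      have "h 1 = 1" using h1 mult[of 1 1] by (metis mult.assoc mult_1_left mult_1_right)
      then show ?thesis using h1 by (simp add: ore_of_def H)
    qed
  qed
qed

theorem corollary2:
  fixes scale :: "'k::field_char_0 \<Rightarrow> 'r::ring_1 \<Rightarrow> 'r"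
  assumes "unital_algebra scale"
    and "continuous_regular_ring TYPE('r)"
    and "\<forall>e :: 'r. abelian_idempotent e \<longrightarrow> e = 0"
  shows "\<exists>h :: 'k weyl_field \<Rightarrow> 'r. unital_algebra_hom weyl_field_scale scale h \<and> inj h"
proof -
  obtain h :: "'k weyl \<Rightarrow> 'r" where hom: "unital_algebra_hom weyl_scale scale h"
    and unit: "\<And>a. (\<forall>v. a * v = 0 \<longrightarrow> v = 0) \<Longrightarrow> \<exists>d. h a * d = 1 \<and> d * h a = 1"
    using tiled_algebra_embedding[OF assms weyl_tiled] by blast
  interpret h: unital_algebra_hom weyl_scale scale h by (rule hom)
  \<comment> \<open>In a domain every nonzero \<open>a\<close> has injective left
    multiplication.\<close>
  have "\<exists>d. h a * d = 1 \<and> d * h a = 1" if "a \<noteq> 0" for a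
    using that by (intro unit) auto
  then obtain H :: "'k weyl_field \<Rightarrow> 'r" where H: "\<And>x y. H (x + y) = H x + H y"
    "\<And>x y. H (x * y) = H x * H y" "\<And>a. H (ore_of a) = h a"
    using ore_extension[OF h.add h.map_mult] by blast
  have H1: "H 1 = 1" using H(3)[of 1] by (simp add: ore_of_1 h.map_one)
  have "H (weyl_field_scale d q) = scale d (H q)" for d q
  proof -
    have "h (weyl_const d) = scale d 1" using h.scale[of d 1] by (simp add: weyl_scale_def h.map_one)
    then show ?thesis by (simp add: weyl_field_scale_def H flip: h.B.scale_mult_left)
  qed
  then have "unital_algebra_hom weyl_field_scale scale H"
    by unfold_locales (simp_all add: H H1)
  moreover have "inj H"
  \<comment> \<open>A difference of distinct elements is invertible, so mapping it to
    \<open>0\<close> would force \<open>1 = 0\<close>.\<close>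
  proof (rule injI, rule ccontr)
    fix x y assume xy: "H x = H y" "x \<noteq> y"
    have "H (x - y) = 0" using H(1)[of "x - y" y] xy(1) by simp
    then have "H (inverse (x - y) * (x - y)) = 0" using H(2) by simp
    then show False using xy(2) H1 by simp
  qed
  ultimately show ?thesis by blast
qed

end
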